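(* Let $K$ be a field, $S=K[x_1,\ldots,x_n]$, let $G$ be a finite simple graph on $[n]=\{1,\ldots,n\}$, and let $M_G$ be its edge module. The following conditions are equivalent: (i) The defining ideal of $\operatorname{Sym}(M_G)$ satisfies the $x$-condition. (ii) $\operatorname{Sym}_j(M_G)$ has linear resolution for all $j$. (iii) $M_G$ has linear resolution. (iv) $G$ is chordal.
   Context: Let $F$ be the free $S$-module with basis $e_1,\ldots,e_n$ (graded with $\deg e_i=1$) and let $C_G\subset F$ be the submodule generated by the elements $x_ie_j-x_je_i$ with $\{i,j\}\in E(G)$. The edge module of $G$ is $M_G=F/C_G$, generated by $f_i=e_i+C_G$, $i=1,\ldots,n$. $\operatorname{Sym}(M_G)=\bigoplus_j\operatorname{Sym}_j(M_G)$ is the symmetric algebra over $S$, with $\operatorname{Sym}_j(M_G)$ its graded components (symmetric powers). The defining ideal $J$ of $\operatorname{Sym}(M_G)$ is the kernel of the surjection $T=K[x_1,\ldots,x_n,y_1,\ldots,y_n]\to\operatorname{Sym}(M_G)$, $x_i\mapsto x_i$, $y_i\mapsto f_i$; explicitly $J=(x_iy_j-x_jy_i:\{i,j\}\in E(G))$. $J$ satisfies the $x$-condition with respect to a monomial order $<$ on $T$ if every minimal monomial generator of $\operatorname{in}_<(J)$ has the form $vw$ with $v$ a monomial of degree $\le1$ in $x_1,\ldots,x_n$ and $w$ a monomial in $y_1,\ldots,y_n$; in (i) it is meant that this holds for some monomial order on $T$. A graph is chordal if it has no induced cycle of length $\ge4$. *)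

theory Defs
  imports "HOL-Library.Poly_Mapping" "HOL-Algebra.Module" "HOL-Algebra.QuotRing"
    "HOL-Algebra.Generated_Groups"
begin

section \<open>Polynomial rings\<close>

text \<open>A monomial is an exponent vector \<open>'v \<Rightarrow>\<^sub>0 nat\<close>, and a polynomial maps monomials to coefficients.\<close>

type_synonym ('v, 'a) mpoly = "('v \<Rightarrow>\<^sub>0 nat) \<Rightarrow>\<^sub>0 'a"

definition monomials :: "'v set \<Rightarrow> ('v \<Rightarrow>\<^sub>0 nat) set" where
  "monomials V = {m. Poly_Mapping.keys m \<subseteq> V}"

definition mon_deg :: "('v \<Rightarrow>\<^sub>0 nat) \<Rightarrow> nat" where
  "mon_deg m = (\<Sum>v\<in>Poly_Mapping.keys m. Poly_Mapping.lookup m v)"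

definition mp_const :: "'a::zero \<Rightarrow> ('v, 'a) mpoly" where
  "mp_const a = Poly_Mapping.single 0 a"

definition mp_var :: "'v \<Rightarrow> ('v, 'a::comm_ring_1) mpoly" where
  "mp_var v = Poly_Mapping.single (Poly_Mapping.single v 1) 1"

text \<open>\<open>mpoly_ring A V\<close> is \<open>A[v : v \<in> V]\<close>; \<open>A\<close> is meant to be (the carrier of) a subring of the
  coefficient type.\<close>

definition mpoly_ring :: "'a::comm_ring_1 set \<Rightarrow> 'v set \<Rightarrow> ('v, 'a) mpoly ring" where
  "mpoly_ring A V =
    \<lparr>carrier = {p. range (Poly_Mapping.lookup p) \<subseteq> A \<and> Poly_Mapping.keys p \<subseteq> monomials V},
     mult = (*), one = 1, zero = 0, add = (+)\<rparr>"

definition homogeneous :: "int \<Rightarrow> ('v, 'a::zero) mpoly \<Rightarrow> bool" where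
  "homogeneous k p \<longleftrightarrow> (\<forall>m\<in>Poly_Mapping.keys p. int (mon_deg m) = k)"

text \<open>Substitution: coefficients are mapped by \<open>c\<close>, variables by \<open>g\<close>.\<close>

definition mpoly_eval ::
    "('a::zero \<Rightarrow> 'b::comm_ring_1) \<Rightarrow> ('v \<Rightarrow> 'b) \<Rightarrow> ('v, 'a) mpoly \<Rightarrow> 'b" where
  "mpoly_eval c g p = (\<Sum>m\<in>Poly_Mapping.keys p. c (Poly_Mapping.lookup p m) *
      (\<Prod>v\<in>Poly_Mapping.keys m. g v ^ Poly_Mapping.lookup m v))"


section \<open>Graded modules over a polynomial ring\<close>

text \<open>The ring components \<open>mult\<close> and \<open>one\<close>, which the module record inherits, play no role for
  modules and are left unspecified.\<close>

record ('a, 'b) graded_module = "('a, 'b) module" +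
  component :: "int \<Rightarrow> 'b set"

text \<open>The graded free module over the ring \<open>'a[V]\<close> with basis indexed by \<open>I\<close>, the basis element with
  index \<open>i\<close> having degree \<open>d i\<close>; its elements are the coordinate functions, vanishing outside of \<open>I\<close>.\<close>

definition free_module :: "'v set \<Rightarrow> 'i set \<Rightarrow> ('i \<Rightarrow> int) \<Rightarrow>
    (('v, 'a::comm_ring_1) mpoly, 'i \<Rightarrow> ('v, 'a) mpoly) graded_module" where
  "free_module V I d =
    \<lparr>carrier = {f. (\<forall>i\<in>I. f i \<in> carrier (mpoly_ring UNIV V)) \<and> (\<forall>i. i \<notin> I \<longrightarrow> f i = 0)},
     mult = undefined, one = undefined,
     zero = (\<lambda>i. 0), add = (\<lambda>f g i. f i + g i),
     smult = (\<lambda>s f i. s * f i),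
     component = (\<lambda>k. {f. (\<forall>i\<in>I. f i \<in> carrier (mpoly_ring UNIV V) \<and> homogeneous (k - d i) (f i)) \<and>
                         (\<forall>i. i \<notin> I \<longrightarrow> f i = 0)})\<rparr>"

definition basis_vec :: "'i \<Rightarrow> 'i \<Rightarrow> 'a::zero_neq_one" where
  "basis_vec i = (\<lambda>j. if j = i then 1 else 0)"

definition gen_submodule ::
    "('a, 'c) ring_scheme \<Rightarrow> ('a, 'b, 'd) module_scheme \<Rightarrow> 'b set \<Rightarrow> 'b set" where
  "gen_submodule R M X = \<Inter>{N. submodule N R M \<and> X \<subseteq> N}"

definition quotient_module ::
    "('a, 'b) graded_module \<Rightarrow> 'b set \<Rightarrow> ('a, 'b set) graded_module" where
  "quotient_module M N =
    \<lparr>carrier = a_rcosets\<^bsub>M\<^esub> N,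
     mult = undefined, one = undefined,
     zero = N, add = set_add M,
     smult = (\<lambda>s X. \<Union>x\<in>X. N +>\<^bsub>M\<^esub> (s \<odot>\<^bsub>M\<^esub> x)),
     component = (\<lambda>k. (\<lambda>x. N +>\<^bsub>M\<^esub> x) ` component M k)\<rparr>"

definition graded_hom :: "('a, 'c) ring_scheme \<Rightarrow> ('a, 'b1) graded_module \<Rightarrow>
    ('a, 'b2) graded_module \<Rightarrow> ('b1 \<Rightarrow> 'b2) \<Rightarrow> bool" where
  "graded_hom R M N f \<longleftrightarrow>
     f \<in> hom (add_monoid M) (add_monoid N) \<and>
     (\<forall>s\<in>carrier R. \<forall>x\<in>carrier M. f (s \<odot>\<^bsub>M\<^esub> x) = s \<odot>\<^bsub>N\<^esub> f x) \<and>
     (\<forall>k. f ` component M k \<subseteq> component N k)"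

text \<open>A graded free resolution \<open>\<dots> \<rightarrow> F 1 \<rightarrow> F 0 \<rightarrow> M \<rightarrow> 0\<close> where \<open>F i\<close> is the direct sum of the
  \<open>S(- a i j)\<close> with \<open>j < b i\<close>, the map \<open>F (i + 1) \<rightarrow> F i\<close> is \<open>\<phi> i\<close>, and the augmentation is \<open>\<epsilon>\<close>.\<close>

definition graded_free_resolution :: "'v set \<Rightarrow> (('v, 'k::field) mpoly, 'm) graded_module \<Rightarrow>
    (nat \<Rightarrow> nat) \<Rightarrow> (nat \<Rightarrow> nat \<Rightarrow> int) \<Rightarrow>
    (nat \<Rightarrow> (nat \<Rightarrow> ('v, 'k) mpoly) \<Rightarrow> (nat \<Rightarrow> ('v, 'k) mpoly)) \<Rightarrow>
    ((nat \<Rightarrow> ('v, 'k) mpoly) \<Rightarrow> 'm) \<Rightarrow> bool" where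
  "graded_free_resolution V M b a \<phi> \<epsilon> \<longleftrightarrow>
     (let S = mpoly_ring UNIV V; F = (\<lambda>i. free_module V {..<b i} (a i)) in
       graded_hom S (F 0) M \<epsilon> \<and>
       (\<forall>i. graded_hom S (F (Suc i)) (F i) (\<phi> i)) \<and>
       \<epsilon> ` carrier (F 0) = carrier M \<and>
       a_kernel (F 0) M \<epsilon> = \<phi> 0 ` carrier (F 1) \<and>
       (\<forall>i. a_kernel (F (Suc i)) (F i) (\<phi> i) = \<phi> (Suc i) ` carrier (F (Suc (Suc i)))))"

text \<open>Minimality: the image of \<open>\<phi> i\<close> lies in \<open>\<mm> F i\<close>, with \<open>\<mm>\<close> the ideal generated by the variables,
  that is, the ideal of polynomials with zero constant coefficient.\<close>

definition minimal_graded_free_resolution where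
  "minimal_graded_free_resolution V M b a \<phi> \<epsilon> \<longleftrightarrow>
     graded_free_resolution V M b a \<phi> \<epsilon> \<and>
     (\<forall>i. \<forall>f\<in>carrier (free_module V {..<b (Suc i)} (a (Suc i))). \<forall>j<b i. Poly_Mapping.lookup (\<phi> i f j) 0 = 0)"

text \<open>Since minimal graded free resolutions are unique up to isomorphism, ``the'' minimal resolution
  is linear if and only if some minimal resolution is.\<close>

definition has_linear_resolution :: "'v set \<Rightarrow> (('v, 'k::field) mpoly, 'm) graded_module \<Rightarrow> bool" where
  "has_linear_resolution V M \<longleftrightarrow>
     (\<exists>b a \<phi> \<epsilon> d. minimal_graded_free_resolution V M b a \<phi> \<epsilon> \<and>
        (\<forall>i. \<forall>j<b i. a i j = d + int i))"


section \<open>Symmetric algebras\<close>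

text \<open>The symmetric algebra of an \<open>R\<close>-module \<open>M\<close>, constructed as the polynomial ring over \<open>R\<close> with one
  indeterminate for each element of \<open>M\<close>, modulo the relations that make the inclusion of \<open>M\<close>
  \<open>R\<close>-linear. The operations of \<open>R\<close> are assumed to be those of the type class.\<close>

definition sym_relations ::
    "('r::comm_ring_1, 'c) ring_scheme \<Rightarrow> ('r, 'm, 'd) module_scheme \<Rightarrow> ('m, 'r) mpoly set" where
  "sym_relations R M =
     {mp_var (x \<oplus>\<^bsub>M\<^esub> y) - mp_var x - mp_var y |x y. x \<in> carrier M \<and> y \<in> carrier M} \<union>
     {mp_var (s \<odot>\<^bsub>M\<^esub> x) - mp_const s * mp_var x |s x. s \<in> carrier R \<and> x \<in> carrier M}"

definition sym_cover ::
    "('r::comm_ring_1, 'c) ring_scheme \<Rightarrow> ('r, 'm, 'd) module_scheme \<Rightarrow> ('m, 'r) mpoly ring" where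
  "sym_cover R M = mpoly_ring (carrier R) (carrier M)"

definition sym_ideal ::
    "('r::comm_ring_1, 'c) ring_scheme \<Rightarrow> ('r, 'm, 'd) module_scheme \<Rightarrow> ('m, 'r) mpoly set" where
  "sym_ideal R M = Idl\<^bsub>sym_cover R M\<^esub> (sym_relations R M)"

definition sym_algebra ::
    "('r::comm_ring_1, 'c) ring_scheme \<Rightarrow> ('r, 'm, 'd) module_scheme \<Rightarrow> ('m, 'r) mpoly set ring" where
  "sym_algebra R M = sym_cover R M Quot sym_ideal R M"

definition sym_class :: "('r::comm_ring_1, 'c) ring_scheme \<Rightarrow> ('r, 'm, 'd) module_scheme \<Rightarrow>
    ('m, 'r) mpoly \<Rightarrow> ('m, 'r) mpoly set" where
  "sym_class R M p = sym_ideal R M +>\<^bsub>sym_cover R M\<^esub> p"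

text \<open>\<open>Sym\<^sub>j(M)\<close> for a graded module \<open>M\<close> over \<open>S = 'k[V]\<close>. Its component of degree \<open>k\<close> is spanned by the
  products \<open>s \<cdot> x\<^sub>1 \<cdots> x\<^sub>j\<close> with homogeneous factors whose degrees in \<open>S\<close> and \<open>M\<close> sum to \<open>k\<close>; here
  \<open>x\<^sub>1 \<cdots> x\<^sub>j\<close> is written as a monomial \<open>u\<close> in elements of \<open>M\<close>, and \<open>\<delta>\<close> gives their degrees.\<close>

definition sym_power :: "'v set \<Rightarrow> (('v, 'k::field) mpoly, 'm) graded_module \<Rightarrow> nat \<Rightarrow>
    (('v, 'k) mpoly, ('m, ('v, 'k) mpoly) mpoly set) graded_module" where
  "sym_power V M j =
    (let S = mpoly_ring UNIV V; A = sym_algebra S M in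
     \<lparr>carrier = sym_class S M ` {p \<in> carrier (sym_cover S M). homogeneous (int j) p},
      mult = undefined, one = undefined,
      zero = \<zero>\<^bsub>A\<^esub>, add = (\<oplus>\<^bsub>A\<^esub>),
      smult = (\<lambda>s X. sym_class S M (mp_const s) \<otimes>\<^bsub>A\<^esub> X),
      component = (\<lambda>k. generate (add_monoid A)
        {sym_class S M (Poly_Mapping.single u s) |u s \<delta>.
           s \<in> carrier S \<and> u \<in> monomials (carrier M) \<and> mon_deg u = j \<and>
           (\<forall>x\<in>Poly_Mapping.keys u. x \<in> component M (\<delta> x)) \<and>
           homogeneous (k - (\<Sum>x\<in>Poly_Mapping.keys u. int (Poly_Mapping.lookup u x) * \<delta> x)) s})\<rparr>)"


section \<open>Graphs and edge modules\<close>

definition simple_graph :: "nat \<Rightarrow> nat set set \<Rightarrow> bool" where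
  "simple_graph n E \<longleftrightarrow> (\<forall>e\<in>E. e \<subseteq> {1..n} \<and> card e = 2)"

text \<open>The list runs once through the vertices of the cycle, so its length is the length of the cycle.\<close>

definition induced_cycle :: "nat \<Rightarrow> nat set set \<Rightarrow> nat list \<Rightarrow> bool" where
  "induced_cycle n E vs \<longleftrightarrow>
     3 \<le> length vs \<and> distinct vs \<and> set vs \<subseteq> {1..n} \<and>
     (\<forall>i j. i < j \<and> j < length vs \<longrightarrow>
        ({vs ! i, vs ! j} \<in> E \<longleftrightarrow> j = Suc i \<or> i = 0 \<and> Suc j = length vs))"

definition chordal :: "nat \<Rightarrow> nat set set \<Rightarrow> bool" where
  "chordal n E \<longleftrightarrow> \<not> (\<exists>vs. induced_cycle n E vs \<and> 4 \<le> length vs)"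

text \<open>The free module \<open>F\<close> with basis \<open>e\<^sub>1, \<dots>, e\<^sub>n\<close> in degree \<open>1\<close>, and its submodule \<open>C\<^sub>G\<close>.\<close>

definition edge_cover ::
    "nat \<Rightarrow> ((nat, 'k::field) mpoly, nat \<Rightarrow> (nat, 'k) mpoly) graded_module" where
  "edge_cover n = free_module {1..n} {1..n} (\<lambda>_. 1)"

definition edge_relations :: "nat \<Rightarrow> nat set set \<Rightarrow> (nat \<Rightarrow> (nat, 'k::field) mpoly) set" where
  "edge_relations n E = gen_submodule (mpoly_ring UNIV {1..n}) (edge_cover n)
     {(\<lambda>l. mp_var i * basis_vec j l - mp_var j * basis_vec i l) |i j. {i, j} \<in> E}"

definition edge_module ::
    "nat \<Rightarrow> nat set set \<Rightarrow> ((nat, 'k::field) mpoly, (nat \<Rightarrow> (nat, 'k) mpoly) set) graded_module" where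
  "edge_module n E = quotient_module (edge_cover n) (edge_relations n E)"

definition edge_module_gen :: "nat \<Rightarrow> nat set set \<Rightarrow> nat \<Rightarrow> (nat \<Rightarrow> (nat, 'k::field) mpoly) set" where
  "edge_module_gen n E i = edge_relations n E +>\<^bsub>edge_cover n\<^esub> basis_vec i"


section \<open>The defining ideal of the symmetric algebra\<close>

text \<open>In \<open>T = K[x\<^sub>1, \<dots>, x\<^sub>n, y\<^sub>1, \<dots>, y\<^sub>n]\<close> the variables are \<open>x\<^sub>i = Inl i\<close> and \<open>y\<^sub>i = Inr i\<close>.\<close>

definition xy_vars :: "nat \<Rightarrow> (nat + nat) set" where
  "xy_vars n = {1..n} <+> {1..n}"

definition sym_presentation :: "nat \<Rightarrow> nat set set \<Rightarrow> (nat + nat, 'k::field) mpoly \<Rightarrow>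
    ((nat \<Rightarrow> (nat, 'k) mpoly) set, (nat, 'k) mpoly) mpoly set" where
  "sym_presentation n E p =
     sym_class (mpoly_ring UNIV {1..n}) (edge_module n E)
       (mpoly_eval (\<lambda>a. mp_const (mp_const a))
          (case_sum (\<lambda>i. mp_const (mp_var i)) (\<lambda>i. mp_var (edge_module_gen n E i))) p)"

definition defining_ideal :: "nat \<Rightarrow> nat set set \<Rightarrow> (nat + nat, 'k::field) mpoly set" where
  "defining_ideal n E =
     a_kernel (mpoly_ring UNIV (xy_vars n))
       (sym_algebra (mpoly_ring UNIV {1..n})
          (edge_module n E :: (_, (nat \<Rightarrow> (nat, 'k) mpoly) set) graded_module))
       (sym_presentation n E)"


section \<open>Initial ideals and the \<open>x\<close>-condition\<close>

definition monomial_order :: "'v set \<Rightarrow> ('v \<Rightarrow>\<^sub>0 nat) rel \<Rightarrow> bool" where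
  "monomial_order V r \<longleftrightarrow>
     linear_order_on (monomials V) r \<and>
     (\<forall>u\<in>monomials V. (0, u) \<in> r) \<and>
     (\<forall>u v w. (u, v) \<in> r \<and> w \<in> monomials V \<longrightarrow> (u + w, v + w) \<in> r)"

definition initial_monomial :: "('v \<Rightarrow>\<^sub>0 nat) rel \<Rightarrow> ('v, 'k::zero) mpoly \<Rightarrow> 'v \<Rightarrow>\<^sub>0 nat" where
  "initial_monomial r p = (THE u. u \<in> Poly_Mapping.keys p \<and> (\<forall>v\<in>Poly_Mapping.keys p. (v, u) \<in> r))"

definition initial_ideal ::
    "'v set \<Rightarrow> ('v \<Rightarrow>\<^sub>0 nat) rel \<Rightarrow> ('v, 'k::field) mpoly set \<Rightarrow> ('v, 'k) mpoly set" where
  "initial_ideal V r J =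
     Idl\<^bsub>mpoly_ring UNIV V\<^esub> {Poly_Mapping.single (initial_monomial r p) 1 |p. p \<in> J \<and> p \<noteq> 0}"

text \<open>The minimal monomial generators of a monomial ideal are the monomials in it that are minimal
  with respect to divisibility.\<close>

definition minimal_monomial_generators ::
    "'v set \<Rightarrow> ('v, 'k::field) mpoly set \<Rightarrow> ('v \<Rightarrow>\<^sub>0 nat) set" where
  "minimal_monomial_generators V I =
     {u \<in> monomials V. Poly_Mapping.single u 1 \<in> I \<and>
        (\<forall>v w. u = v + w \<and> Poly_Mapping.single v 1 \<in> I \<longrightarrow> v = u)}"

definition x_condition ::
    "nat \<Rightarrow> (nat + nat \<Rightarrow>\<^sub>0 nat) rel \<Rightarrow> (nat + nat, 'k::field) mpoly set \<Rightarrow> bool" where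
  "x_condition n r J \<longleftrightarrow>
     (\<forall>u\<in>minimal_monomial_generators (xy_vars n) (initial_ideal (xy_vars n) r J).
        \<exists>v w. u = v + w \<and>
          v \<in> monomials (Inl ` {1..n}) \<and> mon_deg v \<le> 1 \<and> w \<in> monomials (Inr ` {1..n}))"

end

theory Submission
  imports Defs
begin

text \<open>Chordality is linked to each algebraic condition through the equivalence relation \<open>\<approx>\<close> on monomials of
\<open>K[x, y]\<close> generated by the exchanges \<open>t x\<^sub>i y\<^sub>j \<approx> t x\<^sub>j y\<^sub>i\<close> along edges \<open>{i, j}\<close>. The defining ideal \<open>J\<close> consists of
the polynomials whose coefficients sum to zero over each class (\<open>defining_ideal_eq\<close>). Exchanges may be
carried out along any path all of whose vertices carry a variable of the monomial (\<open>equivalent_swap\<close>).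

If \<open>G\<close> is chordal, Dirac's theorem on simplicial vertices gives a vertex order \<open>\<rho>\<close> in which the earlier
neighbours of every vertex form a clique (\<open>chordal_elimination_order\<close>). Call a monomial bad if it admits
an exchange moving a \<open>y\<close> to an earlier vertex. Every class contains exactly one monomial that is not
bad, and it is reached from all others by such downward exchanges (\<open>down_reaches_nonbad\<close>). Since \<open>\<rho>\<close> is
an elimination order, a bad monomial has a bad divisor \<open>x\<^sub>i y\<^sup>w\<close> with the same \<open>y\<close>-part
(\<open>bad_linear_divisor\<close>). This one fact has two consequences:
\<^item> For the lexicographic order in which downward exchanges decrease monomials, the bad monomials are the
  monomials of the initial ideal, whence the \<open>x\<close>-condition (\<open>chordal_x_condition\<close>).
\<^item> Order the generators \<open>y\<^sup>w\<close> of \<open>Sym\<^sub>j(M\<^sub>G)\<close> by their weight with respect to \<open>\<rho>\<close>. The successive colon ideals are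
  then generated by variables, namely the \<open>x\<^sub>i\<close> for which \<open>x\<^sub>i y\<^sup>w\<close> is bad. Colon ideals generated by variables
  pass from a module to its syzygy module with generators of degree one higher, so they produce a linear
  resolution (\<open>variable_colons_syzygies\<close>, \<open>sym_power_linear\<close>).

For the converse directions, \<open>Sym\<^sub>1(M\<^sub>G)\<close> is isomorphic to \<open>M\<^sub>G\<close>, so linearity of all symmetric powers contains
linearity of \<open>M\<^sub>G\<close> (\<open>sym_power_1_linear\<close>). If \<open>M\<^sub>G\<close> has linear resolution, the syzygies between the relations
\<open>x\<^sub>i e\<^sub>j - x\<^sub>j e\<^sub>i\<close> are generated by linear ones. On an induced cycle of length at least four the coefficients
of a linear syzygy at the edges of the cycle only involve variables outside the cycle, while going once around the cycle gives a
syzygy whose coefficients are monomials in the variables of the cycle, a contradiction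
(\<open>linear_resolution_chordal\<close>). Finally, a monomial order induces a total order of the vertices by comparing
\<open>x\<^sub>a y\<^sub>b\<close> with \<open>x\<^sub>b y\<^sub>a\<close>. The smallest vertex \<open>m\<close> of an induced cycle of length at least four has two non-adjacent
larger neighbours \<open>a\<close>, \<open>b\<close> on the cycle, and the monomial \<open>x\<^sub>m x\<^sub>b y\<^sub>a\<close> (for \<open>a\<close> below \<open>b\<close>) violates the \<open>x\<close>-condition
(\<open>x_condition_no_valley\<close>, \<open>x_condition_chordal\<close>).\<close>

section \<open>Chordal graphs and elimination orders\<close>

lemma relpow_along_fun:
  assumes "\<And>i. i < l \<Longrightarrow> (f i, f (Suc i)) \<in> R" and "i \<le> j" "j \<le> l"
  shows "(f i, f j) \<in> R ^^ (j - i)"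
  unfolding relpow_fun_conv using assms
  by (intro exI[of _ "\<lambda>k. f (i + k)"]) auto

text \<open>A walk of least length between two related points has neither repetitions nor chords, since either
would yield a shorter walk. Applied to graphs, this produces induced paths.\<close>
lemma shortest_path:
  assumes "(s, t) \<in> R\<^sup>*"
  obtains f and l :: nat where "f 0 = s" "f l = t"
    "\<And>i. i < l \<Longrightarrow> (f i, f (Suc i)) \<in> R"
    "\<And>i j. i < j \<Longrightarrow> j \<le> l \<Longrightarrow> f i \<noteq> f j"
    "\<And>i j. Suc i < j \<Longrightarrow> j \<le> l \<Longrightarrow> (f i, f j) \<notin> R"
    "\<And>k. (s, t) \<in> R ^^ k \<Longrightarrow> l \<le> k"
proof -
  define l where "l = (LEAST l. (s, t) \<in> R ^^ l)"
  have st: "(s, t) \<in> R ^^ l"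
    unfolding l_def using assms by (auto simp: rtrancl_is_UN_relpow intro: LeastI)
  have least: "l \<le> k" if "(s, t) \<in> R ^^ k" for k
    unfolding l_def using that by (rule Least_le)
  obtain f where f: "f 0 = s" "f l = t" and step: "\<And>i. i < l \<Longrightarrow> (f i, f (Suc i)) \<in> R"
    using st unfolding relpow_fun_conv by auto
  note sub = relpow_along_fun[of l f R, OF step]
  have shortcut: "False" if "i + k < j" "j \<le> l" "(f i, f j) \<in> R ^^ k" for i j k
  proof -
    have "(s, f i) \<in> R ^^ i" "(f j, t) \<in> R ^^ (l - j)"
      using sub[of 0 i] sub[of j l] that f by auto
    then have "(s, t) \<in> R ^^ (i + k + (l - j))"
      using that(3) unfolding relpow_add by blast
    from least[OF this] that show False by simp
  qed
  show ?thesis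
  proof (rule that[of f l])
    show "f i \<noteq> f j" if "i < j" "j \<le> l" for i j
      using shortcut[of i 0 j] that by auto
    show "(f i, f j) \<notin> R" if "Suc i < j" "j \<le> l" for i j
      using shortcut[of i 1 j] that by auto
  qed (use f step least in auto)
qed

definition edges_in :: "nat set set \<Rightarrow> nat set \<Rightarrow> nat rel" where
  "edges_in E D = {(a, b). a \<in> D \<and> b \<in> D \<and> {a, b} \<in> E}"

lemma edges_in_rtrancl_sym: "(a, b) \<in> (edges_in E D)\<^sup>* \<Longrightarrow> (b, a) \<in> (edges_in E D)\<^sup>*"
proof -
  have "sym (edges_in E D)" by (auto simp: sym_def edges_in_def insert_commute)
  then show "(a, b) \<in> (edges_in E D)\<^sup>* \<Longrightarrow> (b, a) \<in> (edges_in E D)\<^sup>*"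
    using sym_rtrancl symE by metis
qed

lemma edges_in_mono: "D \<subseteq> D' \<Longrightarrow> edges_in E D \<subseteq> edges_in E D'"
  by (auto simp: edges_in_def)

lemma simple_graph_irrefl: "simple_graph n E \<Longrightarrow> {a} \<notin> E"
  by (force simp: simple_graph_def)

definition simplicial :: "nat set set \<Rightarrow> nat set \<Rightarrow> nat \<Rightarrow> bool" where
  "simplicial E V v \<longleftrightarrow> v \<in> V \<and>
     (\<forall>a\<in>V. \<forall>b\<in>V. a \<noteq> b \<and> {a, v} \<in> E \<and> {b, v} \<in> E \<longrightarrow> {a, b} \<in> E)"

text \<open>A shortest path from \<open>s\<close> to \<open>t\<close> through \<open>C\<close> is induced, and closing it with \<open>v\<close>, which has no neighbour in \<open>C\<close>,
gives an induced cycle. It has length at least four unless \<open>s\<close> and \<open>t\<close> are adjacent.\<close>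
lemma chordal_common_neighbour:
  assumes simple: "simple_graph n E" and chordal: "chordal n E"
    and v: "v \<in> {1..n}" "{v, s} \<in> E" "{v, t} \<in> E"
    and C: "C \<subseteq> {1..n}" "\<And>c. c \<in> C \<Longrightarrow> c \<noteq> v \<and> {v, c} \<notin> E"
    and path: "(s, t) \<in> (edges_in E (C \<union> {s, t}))\<^sup>*" and "s \<noteq> t"
  shows "{s, t} \<in> E"
proof (rule ccontr)
  assume nonadj: "{s, t} \<notin> E"
  let ?R = "edges_in E (C \<union> {s, t})"
  from path obtain f l where f: "f 0 = s" "f l = t"
    and step: "\<And>i. i < l \<Longrightarrow> (f i, f (Suc i)) \<in> ?R"
    and dist: "\<And>i j. i < j \<Longrightarrow> j \<le> l \<Longrightarrow> f i \<noteq> f j"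
    and chord: "\<And>i j. Suc i < j \<Longrightarrow> j \<le> l \<Longrightarrow> (f i, f j) \<notin> ?R"
    by (rule shortest_path) (rule that)
  have st: "s \<in> {1..n}" "t \<in> {1..n}" and vst: "v \<noteq> s" "v \<noteq> t"
    using v simple simple_graph_irrefl[OF simple] by (auto simp: simple_graph_def)
  have l: "2 \<le> l"
  proof -
    have "l \<noteq> 0" using f \<open>s \<noteq> t\<close> by (metis)
    moreover have "l \<noteq> 1" using f step[of 0] nonadj by (auto simp: edges_in_def)
    ultimately show ?thesis by simp
  qed
  have fin: "f i \<in> C \<union> {s, t}" if "i \<le> l" for i
    using that step[of i] step[of "i - 1"] l by (cases "i < l") (auto simp: edges_in_def)
  have interior: "f i \<in> C" if "0 < i" "i < l" for i
    using fin[of i] dist[of 0 i] dist[of i l] that f by auto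
  have fv: "f i \<noteq> v" if "i \<le> l" for i
    using fin[OF that] C vst by auto
  have adj_v: "{v, f i} \<in> E \<longleftrightarrow> i = 0 \<or> i = l" if "i \<le> l" for i
    using interior[of i] C v f that by (cases "i = 0 \<or> i = l") auto
  have adj: "{f i, f j} \<in> E \<longleftrightarrow> j = Suc i" if "i < j" "j \<le> l" for i j
    using step[of i] chord[of i j] fin[of i] fin[of j] that
    by (cases "j = Suc i") (auto simp: edges_in_def)
  let ?vs = "v # map f [0..<Suc l]"
  have nth: "?vs ! Suc k = f k" if "k \<le> l" for k
  proof -
    have "?vs ! Suc k = f ([0..<Suc l] ! k)" using that by (subst nth_Cons_Suc, subst nth_map) auto
    then show ?thesis using that by (simp add: nth_append del: upt_Suc)
  qed
  have "induced_cycle n E ?vs"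
    unfolding induced_cycle_def
  proof (intro conjI allI impI)
    show "3 \<le> length ?vs" using l by simp
    have "inj_on f {0..<Suc l}"
      by (rule linorder_inj_onI) (auto simp: dist)
    moreover have "v \<notin> f ` {0..<Suc l}"
      by (metis atLeastLessThan_iff fv imageE less_Suc_eq_le)
    ultimately show "distinct ?vs" by (simp add: distinct_map del: upt_Suc)
    have "f i \<in> {1..n}" if "i \<le> l" for i using fin[OF that] C(1) st by blast
    then have "f ` {0..<Suc l} \<subseteq> {1..n}" by (auto simp del: atLeastAtMost_iff)
    then show "set ?vs \<subseteq> {1..n}" using v by (simp del: upt_Suc)
    fix i j assume ij: "i < j \<and> j < length ?vs"
    then obtain j' where j': "j = Suc j'" "j' \<le> l" by (cases j) auto
    show "{?vs ! i, ?vs ! j} \<in> E \<longleftrightarrow> j = Suc i \<or> i = 0 \<and> Suc j = length ?vs"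
    proof (cases i)
      case 0
      then show ?thesis using adj_v[OF j'(2)] j' nth[OF j'(2)] by auto
    next
      case (Suc i')
      then show ?thesis using adj[of i' j'] ij j' nth[of i'] nth[of j'] by auto
    qed
  qed
  moreover have "4 \<le> length ?vs" using l by simp
  ultimately show False using chordal unfolding chordal_def by blast
qed

text \<open>Dirac's theorem. The first conjunct, which provides a simplicial vertex that is neither \<open>v\<close> nor adjacent
to \<open>v\<close>, is what makes the induction work: let \<open>C\<close> be a component of the graph induced on
the non-neighbours of \<open>v\<close>, and let \<open>S\<close> be the set of vertices outside \<open>C\<close> with a neighbour in \<open>C\<close>. All of \<open>S\<close> is
adjacent to \<open>v\<close>, so \<open>S\<close> is a clique by the preceding lemma. The smaller graph on \<open>C \<union> S\<close> has a simplicial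
vertex in \<open>C\<close>, and that vertex is simplicial in the whole graph because its neighbours all lie in \<open>C \<union> S\<close>.\<close>
lemma chordal_simplicial:
  assumes simple: "simple_graph n E" and chordal: "chordal n E" and "V \<subseteq> {1..n}"
  shows "(\<forall>v\<in>V. \<forall>u\<in>V. u \<noteq> v \<and> {u, v} \<notin> E \<longrightarrow> (\<exists>w. simplicial E V w \<and> w \<noteq> v \<and> {w, v} \<notin> E)) \<and>
         (V \<noteq> {} \<longrightarrow> (\<exists>w. simplicial E V w))"
  using \<open>V \<subseteq> {1..n}\<close>
proof (induction "card V" arbitrary: V rule: less_induct)
  case less
  have fin: "finite V" using less.prems finite_subset by blast
  have IH: "\<exists>w. simplicial E U w \<and> w \<noteq> v \<and> {w, v} \<notin> E"
    if "U \<subset> V" "v \<in> U" "u \<in> U" "u \<noteq> v" "{u, v} \<notin> E" for U u v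
  proof -
    have "U \<subseteq> {1..n}" using that(1) less.prems by blast
    from less.hyps[OF psubset_card_mono[OF fin that(1)] this] that(2-5) show ?thesis by blast
  qed
  have IH': "\<exists>w. simplicial E U w" if "U \<subset> V" "U \<noteq> {}" for U
  proof -
    have "U \<subseteq> {1..n}" using that(1) less.prems by blast
    from less.hyps[OF psubset_card_mono[OF fin that(1)] this] that(2) show ?thesis by blast
  qed
  have irrefl: "{a} \<notin> E" for a by (rule simple_graph_irrefl[OF simple])
  have first: "\<exists>w. simplicial E V w \<and> w \<noteq> v \<and> {w, v} \<notin> E"
    if v: "v \<in> V" and u: "u \<in> V" "u \<noteq> v" "{u, v} \<notin> E" for u v
  proof -
    define W where "W = {x \<in> V. x \<noteq> v \<and> {x, v} \<notin> E}"
    define C where "C = {x. (u, x) \<in> (edges_in E W)\<^sup>*}"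
    define S where "S = {s \<in> V. s \<notin> C \<and> (\<exists>c\<in>C. {s, c} \<in> E)}"
    have uC: "u \<in> C" by (simp add: C_def)
    have uW: "u \<in> W" using u by (simp add: W_def)
    have "x \<in> W" if "x \<in> C" for x
    proof -
      have "(u, x) \<in> (edges_in E W)\<^sup>*" using that by (simp add: C_def)
      then show ?thesis by (cases rule: rtranclE) (use uW in \<open>auto simp: edges_in_def\<close>)
    qed
    then have CW: "C \<subseteq> W" by blast
    have C_ext: "y \<in> C" if "x \<in> C" "y \<in> W" "{y, x} \<in> E" for x y
      using that CW unfolding C_def
      by (auto simp: edges_in_def insert_commute intro: rtrancl_into_rtrancl)
    have S_nbr: "{v, s} \<in> E" if sS: "s \<in> S" for s
    proof -
      obtain c where c: "c \<in> C" "{s, c} \<in> E" "s \<in> V" "s \<notin> C" using sS by (auto simp: S_def)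
      have "s \<noteq> v" using c CW by (auto simp: W_def insert_commute)
      moreover have "s \<notin> W" using C_ext c by blast
      ultimately show ?thesis using c by (auto simp: W_def insert_commute)
    qed
    have C_conn: "(a, b) \<in> (edges_in E C)\<^sup>*" if "a \<in> C" "b \<in> C" for a b
    proof -
      have "(u, x) \<in> (edges_in E C)\<^sup>*" if "(u, x) \<in> (edges_in E W)\<^sup>*" for x
        using that
      proof (induction rule: rtrancl_induct)
        case (step y z)
        then have "y \<in> C" "z \<in> C"
          by (auto simp: C_def intro: rtrancl_into_rtrancl)
        then have "(y, z) \<in> edges_in E C" using step by (auto simp: edges_in_def)
        with step show ?case by (metis rtrancl_into_rtrancl)
      qed simp
      then have "(u, a) \<in> (edges_in E C)\<^sup>*" "(u, b) \<in> (edges_in E C)\<^sup>*"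
        using that by (auto simp: C_def)
      then show ?thesis using edges_in_rtrancl_sym rtrancl_trans by metis
    qed
    have S_clique: "{s, t} \<in> E" if st: "s \<in> S" "t \<in> S" "s \<noteq> t" for s t
    proof (rule chordal_common_neighbour[OF simple chordal, of v s t C])
      show "v \<in> {1..n}" using v less.prems by blast
      show "{v, s} \<in> E" "{v, t} \<in> E" using S_nbr st by auto
      show "C \<subseteq> {1..n}" using CW less.prems by (auto simp: W_def)
      show "c \<noteq> v \<and> {v, c} \<notin> E" if "c \<in> C" for c
        using CW that by (auto simp: W_def insert_commute)
      obtain c d where "c \<in> C" "{s, c} \<in> E" "d \<in> C" "{t, d} \<in> E"
        using st by (auto simp: S_def)
      then have "(s, c) \<in> edges_in E (C \<union> {s, t})" "(d, t) \<in> edges_in E (C \<union> {s, t})"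
        "(c, d) \<in> (edges_in E (C \<union> {s, t}))\<^sup>*"
        using C_conn[of c d] rtrancl_mono[OF edges_in_mono[of C "C \<union> {s, t}" E]]
        by (auto simp: edges_in_def insert_commute)
      then show "(s, t) \<in> (edges_in E (C \<union> {s, t}))\<^sup>*"
        by (meson converse_rtrancl_into_rtrancl rtrancl_into_rtrancl)
      show "s \<noteq> t" by fact
    qed
    have vn: "v \<notin> C \<union> S" using CW S_nbr[of v] irrefl[of v] by (auto simp: W_def)
    have "C \<union> S \<subseteq> V" using CW unfolding W_def S_def by blast
    with v vn have CS: "C \<union> S \<subset> V" by blast
    \<comment> \<open>Either a vertex of \<open>S\<close> has a non-neighbour in \<open>C\<close>, and induction applies to \<open>C \<union> S\<close>, or \<open>C\<close> is joined completely to \<open>S\<close>.\<close>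
    have "\<exists>w\<in>C. simplicial E (C \<union> S) w"
    proof (cases "\<exists>s\<in>S. \<exists>c\<in>C. {c, s} \<notin> E")
      case True
      then obtain s c where sc: "s \<in> S" "c \<in> C" "{c, s} \<notin> E" by blast
      then have "c \<noteq> s" by (auto simp: S_def)
      with IH[OF CS, of s c] sc
      obtain w where "simplicial E (C \<union> S) w" "w \<noteq> s" "{w, s} \<notin> E" by blast
      moreover from this have "w \<in> C" using S_clique[of w s] sc by (auto simp: simplicial_def)
      ultimately show ?thesis by blast
    next
      case False
      have "C \<subset> V" using CS by blast
      then obtain w where w: "simplicial E C w" using IH'[of C] uC by blast
      have "simplicial E (C \<union> S) w"
        unfolding simplicial_def
      proof (intro conjI ballI impI)
        show "w \<in> C \<union> S" using w by (simp add: simplicial_def)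
        fix a b assume ab: "a \<in> C \<union> S" "b \<in> C \<union> S" "a \<noteq> b \<and> {a, w} \<in> E \<and> {b, w} \<in> E"
        consider "a \<in> C" "b \<in> C" | "a \<in> S" "b \<in> S" | "a \<in> C" "b \<in> S" | "a \<in> S" "b \<in> C"
          using ab by blast
        then show "{a, b} \<in> E"
        proof cases
          case 1 then show ?thesis using w ab unfolding simplicial_def by blast
        next
          case 2 then show ?thesis using S_clique ab by blast
        next
          case 3 then show ?thesis using False by blast
        next
          case 4 then have "{b, a} \<in> E" using False by blast
          then show ?thesis by (simp add: insert_commute)
        qed
      qed
      then show ?thesis using w by (auto simp: simplicial_def)
    qed
    then obtain w where w: "w \<in> C" "simplicial E (C \<union> S) w" by blast
    have nb: "a \<in> C \<union> S" if "a \<in> V" "{a, w} \<in> E" for a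
      using that w by (auto simp: S_def)
    have "simplicial E V w"
      using w nb CW unfolding simplicial_def W_def by blast
    then show ?thesis using w CW by (auto simp: W_def)
  qed
  moreover have "\<exists>w. simplicial E V w" if ne: "V \<noteq> {}"
  proof -
    obtain v where v: "v \<in> V" using ne by blast
    show ?thesis
    proof (cases "\<exists>u\<in>V. u \<noteq> v \<and> {u, v} \<notin> E")
      case True then show ?thesis using first v by blast
    next
      case False
      show ?thesis
      proof (cases "V = {v}")
        case True then show ?thesis by (auto simp: simplicial_def)
      next
        case ne: False
        then have "V - {v} \<subset> V" "V - {v} \<noteq> {}" using v by auto
        then obtain w where w: "simplicial E (V - {v}) w" using IH'[of "V - {v}"] by blast
        have univ: "{u, v} \<in> E \<and> {v, u} \<in> E" if "u \<in> V" "u \<noteq> v" for u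
          using False that by (metis insert_commute)
        have "simplicial E V w"
          unfolding simplicial_def
        proof (intro conjI ballI impI)
          show "w \<in> V" using w by (simp add: simplicial_def)
          fix a b assume ab: "a \<in> V" "b \<in> V" "a \<noteq> b \<and> {a, w} \<in> E \<and> {b, w} \<in> E"
          show "{a, b} \<in> E"
          proof (cases "a = v \<or> b = v")
            case True then show ?thesis using univ ab by metis
          next
            case False with w ab show ?thesis unfolding simplicial_def by blast
          qed
        qed
        then show ?thesis by blast
      qed
    qed
  qed
  ultimately show ?case by blast
qed

text \<open>The reverse of a perfect elimination order: the neighbours of \<open>v\<close> that come earlier are pairwise adjacent.\<close>
definition elimination_order :: "nat set set \<Rightarrow> nat set \<Rightarrow> (nat \<Rightarrow> nat) \<Rightarrow> bool" where
  "elimination_order E V \<rho> \<longleftrightarrow> inj_on \<rho> V \<and>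
     (\<forall>v\<in>V. \<forall>a\<in>V. \<forall>b\<in>V. a \<noteq> b \<and> {a, v} \<in> E \<and> {b, v} \<in> E \<and> \<rho> a < \<rho> v \<and> \<rho> b < \<rho> v
        \<longrightarrow> {a, b} \<in> E)"

text \<open>A simplicial vertex is put last, and the remaining vertices are ordered by induction. Bounding the
ranks by the number of vertices leaves the rank \<open>k\<close> free for the last one.\<close>
lemma chordal_elimination_order_aux:
  assumes simple: "simple_graph n E" and chordal: "chordal n E" and "V \<subseteq> {1..n}"
  shows "\<exists>\<rho>. elimination_order E V \<rho> \<and> \<rho> ` V \<subseteq> {..<card V}"
  using \<open>V \<subseteq> {1..n}\<close>
proof (induction "card V" arbitrary: V)
  case 0
  then have "V = {}" using finite_subset by fastforce
  then show ?case by (simp add: elimination_order_def)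
next
  case (Suc k)
  have fin: "finite V" using Suc.prems finite_subset by blast
  have "V \<noteq> {}" using Suc.hyps by auto
  then obtain w where w: "simplicial E V w"
    using chordal_simplicial[OF simple chordal Suc.prems] by blast
  have wV: "w \<in> V" using w by (simp add: simplicial_def)
  have "k = card (V - {w})" using Suc.hyps fin wV by simp
  then obtain \<rho> where \<rho>: "elimination_order E (V - {w}) \<rho>" "\<rho> ` (V - {w}) \<subseteq> {..<k}"
    using Suc.hyps(1)[of "V - {w}"] Suc.prems by blast
  let ?\<rho> = "\<rho>(w := k)"
  have less: "?\<rho> x < k" if "x \<in> V" "x \<noteq> w" for x using \<rho>(2) that by auto
  have "inj_on ?\<rho> V"
  proof (rule inj_onI)
    fix x y assume xy: "x \<in> V" "y \<in> V" "?\<rho> x = ?\<rho> y"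
    show "x = y"
    proof (cases "x = w \<or> y = w")
      case True then show ?thesis using less[of x] less[of y] xy by fastforce
    next
      case False then show ?thesis using xy \<rho>(1) by (auto simp: elimination_order_def dest: inj_onD)
    qed
  qed
  moreover have "{a, b} \<in> E" if "v \<in> V" "a \<in> V" "b \<in> V" "a \<noteq> b" "{a, v} \<in> E" "{b, v} \<in> E"
    "?\<rho> a < ?\<rho> v" "?\<rho> b < ?\<rho> v" for v a b
  proof (cases "v = w")
    case True with w that(2-6) show ?thesis unfolding simplicial_def by blast
  next
    case False
    then have "?\<rho> v < k" using less that(1) by blast
    then have "a \<noteq> w" "b \<noteq> w" using that(7,8) by (auto split: if_splits)
    then have "v \<in> V - {w}" "a \<in> V - {w}" "b \<in> V - {w}" "\<rho> a < \<rho> v" "\<rho> b < \<rho> v"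
      using that(1-3,7,8) False by auto
    with \<rho>(1) that(4-6) show ?thesis unfolding elimination_order_def by blast
  qed
  ultimately have "elimination_order E V ?\<rho>" unfolding elimination_order_def by blast
  moreover have "?\<rho> ` V \<subseteq> {..<card V}" using less Suc.hyps(2)[symmetric] by force
  ultimately show ?case by blast
qed

lemma chordal_elimination_order:
  assumes "simple_graph n E" and "chordal n E"
  obtains \<rho> where "elimination_order E {1..n} \<rho>"
  using chordal_elimination_order_aux[OF assms order_refl] by blast

section \<open>Polynomials\<close>

abbreviation "lookup \<equiv> Poly_Mapping.lookup"
abbreviation "keys \<equiv> Poly_Mapping.keys"
abbreviation "single \<equiv> Poly_Mapping.single"

lemma keys_add_nat: "keys (m + m') = keys m \<union> keys (m' :: 'v \<Rightarrow>\<^sub>0 nat)"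
  by (auto simp: in_keys_iff lookup_add)

lemma monomials_add_iff [simp]: "m + m' \<in> monomials V \<longleftrightarrow> m \<in> monomials V \<and> m' \<in> monomials V"
  by (auto simp: monomials_def keys_add_nat)

lemma monomials_zero [simp]: "0 \<in> monomials V"
  by (simp add: monomials_def)

lemma monomials_single [simp]: "single v (Suc k) \<in> monomials V \<longleftrightarrow> v \<in> V"
  by (simp add: monomials_def)

lemma mon_deg_superset: "finite A \<Longrightarrow> keys m \<subseteq> A \<Longrightarrow> mon_deg m = (\<Sum>v\<in>A. lookup m v)"
  unfolding mon_deg_def by (rule sum.mono_neutral_left) (auto simp: in_keys_iff)

lemma mon_deg_add [simp]: "mon_deg (m + m') = mon_deg m + mon_deg m'"
proof -
  have "mon_deg (m + m') = (\<Sum>v\<in>keys m \<union> keys m'. lookup m v + lookup m' v)"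
    by (subst mon_deg_superset[of "keys m \<union> keys m'"]) (auto simp: lookup_add keys_add_nat)
  then show ?thesis
    by (simp add: sum.distrib mon_deg_superset[of "keys m \<union> keys m'" m]
        mon_deg_superset[of "keys m \<union> keys m'" m'])
qed

lemma mon_deg_zero [simp]: "mon_deg 0 = 0"
  by (simp add: mon_deg_def)

lemma mon_deg_single [simp]: "mon_deg (single v k) = k"
  by (simp add: mon_deg_def)

lemma mon_deg_eq_0_iff [simp]: "mon_deg m = 0 \<longleftrightarrow> m = 0"
  by (auto simp: mon_deg_def in_keys_iff intro!: poly_mapping_eqI)

lemma mon_deg_eq_1: "mon_deg m = Suc 0 \<Longrightarrow> \<exists>v. m = single v 1"
proof -
  assume 1: "mon_deg m = Suc 0"
  then have "m \<noteq> 0" by auto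
  then obtain v where "lookup m v \<noteq> 0" by (metis lookup_zero poly_mapping_eqI)
  then have m: "m = single v 1 + (m - single v 1)"
    by (intro poly_mapping_eqI) (auto simp: lookup_add lookup_minus lookup_single when_def)
  then have "mon_deg m = 1 + mon_deg (m - single v 1)" by (metis mon_deg_add mon_deg_single)
  with 1 have "m - single v 1 = 0" by simp
  with m show ?thesis by (metis add.right_neutral)
qed

lemma mon_minus_single: "lookup m v > 0 \<Longrightarrow> m = (m - single v 1) + single v (1::nat)"
  by (intro poly_mapping_eqI) (auto simp: lookup_add lookup_minus lookup_single when_def)

lemma poly_sum_monomials: "p = (\<Sum>m\<in>keys p. single m (lookup p m))"
  by (intro poly_mapping_eqI)
    (auto simp: lookup_sum lookup_single when_def in_keys_iff if_distrib sum.delta' cong: if_cong)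

lemma poly_induct [case_names zero single add]:
  fixes p :: "'a \<Rightarrow>\<^sub>0 'b::comm_monoid_add"
  assumes "P 0" and "\<And>m. m \<in> keys p \<Longrightarrow> P (single m (lookup p m))"
    and "\<And>q r. P q \<Longrightarrow> P r \<Longrightarrow> P (q + r)"
  shows "P p"
proof -
  have "P (\<Sum>m\<in>A. single m (lookup p m))" if "A \<subseteq> keys p" for A
    using finite_subset[OF that finite_keys] that
    by (induction A rule: finite_induct) (auto intro: assms)
  from this[of "keys p"] show ?thesis using poly_sum_monomials[of p] by simp
qed

text \<open>For maps between polynomial rings that are additive but have no further structure, such as the
extraction of a coefficient.\<close>
lemma additive_sum:
  assumes "h 0 = 0" and "\<And>p q. h (p + q) = h p + h q"
  shows "h (\<Sum>i\<in>I. f i) = (\<Sum>i\<in>I. h (f i))"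
  by (induction I rule: infinite_finite_induct) (auto simp: assms)

text \<open>The underlying set of the polynomial ring in the variables \<open>V\<close>, inside the ring of polynomials in all
variables of the type, where type-class arithmetic is available.\<close>
definition PV :: "'v set \<Rightarrow> ('v, 'a::comm_ring_1) mpoly set" where
  "PV V = {p. keys p \<subseteq> monomials V}"

lemma carrier_mpoly_ring: "carrier (mpoly_ring UNIV V) = PV V"
  by (simp add: mpoly_ring_def PV_def)

lemma PV_zero [simp]: "0 \<in> PV V" by (simp add: PV_def)
lemma PV_one [simp]: "1 \<in> PV V" by (simp add: PV_def)
lemma PV_add [simp, intro]: "p \<in> PV V \<Longrightarrow> q \<in> PV V \<Longrightarrow> p + q \<in> PV V"
  using keys_add[of p q] by (auto simp: PV_def)
lemma PV_uminus [simp, intro]: "p \<in> PV V \<Longrightarrow> - p \<in> PV V" by (simp add: PV_def)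
lemma PV_diff [simp, intro]: "p \<in> PV V \<Longrightarrow> q \<in> PV V \<Longrightarrow> p - q \<in> PV V"
  using PV_add[of p V "- q"] by simp
lemma PV_mult [simp, intro]: "p \<in> PV V \<Longrightarrow> q \<in> PV V \<Longrightarrow> p * q \<in> PV V"
  using keys_mult[of p q] by (fastforce simp: PV_def)
lemma PV_sum [intro]: "(\<And>i. i \<in> I \<Longrightarrow> f i \<in> PV V) \<Longrightarrow> (\<Sum>i\<in>I. f i) \<in> PV V"
  by (induction I rule: infinite_finite_induct) auto
lemma PV_const [simp]: "mp_const a \<in> PV V" by (simp add: PV_def mp_const_def)
lemma PV_var [simp]: "v \<in> V \<Longrightarrow> mp_var v \<in> PV V" by (simp add: PV_def mp_var_def)
lemma PV_single: "m \<in> monomials V \<Longrightarrow> single m a \<in> PV V" by (simp add: PV_def)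

lemma homogeneous_zero [simp]: "homogeneous k 0" by (simp add: homogeneous_def)
lemma homogeneous_add [intro]: "homogeneous k p \<Longrightarrow> homogeneous k q \<Longrightarrow> homogeneous k (p + q)"
  using keys_add[of p q] by (auto simp: homogeneous_def)
lemma homogeneous_uminus [simp]: "homogeneous k (- p :: ('v, 'a::ab_group_add) mpoly) \<longleftrightarrow> homogeneous k p"
  by (simp add: homogeneous_def)
lemma homogeneous_diff [intro]:
  "homogeneous k p \<Longrightarrow> homogeneous k q \<Longrightarrow> homogeneous k (p - q :: ('v, 'a::ab_group_add) mpoly)"
  using homogeneous_add[of k p "- q"] by simp
lemma homogeneous_sum: "(\<And>i. i \<in> I \<Longrightarrow> homogeneous k (f i)) \<Longrightarrow> homogeneous k (\<Sum>i\<in>I. f i)"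
  by (induction I rule: infinite_finite_induct) auto
lemma homogeneous_mult:
  fixes p q :: "('v, 'a::semiring_0) mpoly"
  shows "homogeneous k p \<Longrightarrow> homogeneous l q \<Longrightarrow> homogeneous (k + l) (p * q)"
  using keys_mult[of p q] by (fastforce simp: homogeneous_def)
lemma homogeneous_var [simp]: "homogeneous 1 (mp_var v)" by (simp add: homogeneous_def mp_var_def)
lemma homogeneous_const [simp]: "homogeneous 0 (mp_const a)" by (simp add: homogeneous_def mp_const_def)
lemma homogeneous_one [simp]: "homogeneous 0 1" by (simp add: homogeneous_def)
lemma mp_const_0 [simp]: "mp_const 0 = 0" by (simp add: mp_const_def)
lemma mp_const_1 [simp]: "mp_const 1 = 1" by (simp add: mp_const_def)
lemma mp_const_add: "mp_const (a + b) = mp_const a + mp_const b" by (simp add: mp_const_def single_add)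
lemma mp_const_uminus: "mp_const (- a) = - mp_const a" by (simp add: mp_const_def single_uminus)
lemma mp_const_mult: "mp_const (a * b) = mp_const a * (mp_const b :: ('v, 'a::comm_ring_1) mpoly)"
  by (simp add: mp_const_def mult_single)
lemma mp_const_sum: "mp_const (\<Sum>i\<in>I. f i) = (\<Sum>i\<in>I. mp_const (f i))"
  by (rule additive_sum) (auto simp: mp_const_add)

lemma lookup_const_mult: "lookup (mp_const a * p) m = a * lookup (p :: ('v, 'a::comm_ring_1) mpoly) m"
  by (induction p rule: poly_induct)
    (auto simp: mp_const_def mult_single lookup_single distrib_left lookup_add when_def)

lemma lookup_mult_single:
  "lookup (single t a * p) m = (if \<exists>m'. m = t + m' then a * lookup p (m - t) else 0)"
  for p :: "('v, 'a::comm_ring_1) mpoly"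
proof (induction p rule: poly_induct)
  case (add q r)
  then show ?case by (simp add: distrib_left lookup_add)
next
  case (single m')
  have "t + m' = m \<longleftrightarrow> (\<exists>m'. m = t + m') \<and> m' = m - t" by auto
  then show ?case by (auto simp: mult_single lookup_single when_def)
qed auto

lemma lookup_mult_var:
  "lookup (mp_var v * p) m = (if lookup m v > 0 then lookup p (m - single v 1) else 0)"
  for p :: "('v, 'a::comm_ring_1) mpoly"
proof -
  have "(\<exists>m'. m = single v 1 + m') \<longleftrightarrow> lookup m v > 0"
    using mon_minus_single[of m v] by (metis add.commute lookup_add lookup_single_eq add_gr_0 zero_less_one)
  then show ?thesis by (simp add: mp_var_def lookup_mult_single)
qed

lemma lookup_mult_0: "lookup (p * q) 0 = lookup p 0 * lookup (q :: ('v, 'a::comm_ring_1) mpoly) 0"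
proof (induction p rule: poly_induct)
  case (add q r)
  then show ?case by (simp add: distrib_right lookup_add)
next
  case (single m)
  have "(\<exists>m'. 0 = m + m') \<longleftrightarrow> m = 0"
    by (metis add.right_neutral add_is_0 mon_deg_add mon_deg_eq_0_iff)
  then show ?case by (auto simp: lookup_mult_single lookup_single when_def)
qed simp

lemma mpoly_eval_superset:
  assumes "c 0 = 0" "finite A" "keys p \<subseteq> A"
  shows "mpoly_eval c g p = (\<Sum>m\<in>A. c (lookup p m) * (\<Prod>v\<in>keys m. g v ^ lookup m v))"
  unfolding mpoly_eval_def
  by (rule sum.mono_neutral_left) (use assms in \<open>auto simp: in_keys_iff\<close>)

lemma prod_power_add:
  "(\<Prod>v\<in>keys (m + m'). g v ^ lookup (m + m') v) =
   (\<Prod>v\<in>keys m. g v ^ lookup m v) * (\<Prod>v\<in>keys m'. g v ^ lookup m' v)"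
  for g :: "'v \<Rightarrow> 'b::comm_ring_1"
proof -
  let ?A = "keys m \<union> keys m'"
  have *: "(\<Prod>v\<in>keys k. g v ^ lookup k v) = (\<Prod>v\<in>?A. g v ^ lookup k v)" if "keys k \<subseteq> ?A" for k
    by (rule prod.mono_neutral_left) (use that in \<open>auto simp: in_keys_iff\<close>)
  show ?thesis
    by (subst (1 2 3) *) (auto simp: keys_add_nat lookup_add power_add prod.distrib)
qed

text \<open>A homomorphism from the coefficients, to be extended to polynomials by substituting values for the
variables.\<close>
locale coefficient_hom =
  fixes c :: "'a::comm_ring_1 \<Rightarrow> 'b::comm_ring_1"
  assumes zero [simp]: "c 0 = 0" and one [simp]: "c 1 = 1"
    and add: "\<And>a b. c (a + b) = c a + c b" and mult: "\<And>a b. c (a * b) = c a * c b"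
begin

lemma eval_zero [simp]: "mpoly_eval c g 0 = 0"
  by (simp add: mpoly_eval_def)

lemma eval_single: "mpoly_eval c g (single m a) = c a * (\<Prod>v\<in>keys m. g v ^ lookup m v)"
  by (subst mpoly_eval_superset[of _ "{m}"]) auto

lemma eval_add: "mpoly_eval c g (p + q) = mpoly_eval c g p + mpoly_eval c g q"
  by (subst (1 2 3) mpoly_eval_superset[where A = "keys p \<union> keys q"])
    (use keys_add[of p q] in \<open>auto simp: lookup_add add distrib_right sum.distrib\<close>)

lemma eval_mult: "mpoly_eval c g (p * q) = mpoly_eval c g p * mpoly_eval c g q"
proof (induction p rule: poly_induct)
  case (single m)
  show ?case
  proof (induction q rule: poly_induct)
    case (single m')
    show ?case by (simp add: mult_single eval_single prod_power_add mult mult_ac)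
  qed (auto simp: distrib_left eval_add)
qed (auto simp: distrib_right eval_add)

lemma eval_one [simp]: "mpoly_eval c g 1 = 1"
  using eval_single[of g 0 1] by simp

lemma eval_const [simp]: "mpoly_eval c g (mp_const a) = c a"
  by (simp add: mp_const_def eval_single)

lemma eval_var [simp]: "mpoly_eval c g (mp_var v) = g v"
  by (simp add: mp_var_def eval_single)

lemma eval_uminus: "mpoly_eval c g (- p) = - mpoly_eval c g p"
  using eval_add[of g p "- p"] by (simp add: eq_neg_iff_add_eq_0 add.commute)

lemma eval_diff: "mpoly_eval c g (p - q) = mpoly_eval c g p - mpoly_eval c g q"
  using eval_add[of g p "- q"] by (simp add: eval_uminus)

end

text \<open>The ideal generated by a set of variables, described by its monomials: a polynomial belongs to it if
every term is divisible by one of the variables.\<close>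
definition var_ideal :: "'v set \<Rightarrow> ('v, 'a::zero) mpoly set" where
  "var_ideal A = {p. \<forall>m\<in>keys p. \<exists>a\<in>A. lookup m a > 0}"

text \<open>Dividing by one variable at a time: the terms divisible by \<open>a\<close> are collected first, the remaining terms
are divisible by another variable. This choice of quotients keeps them in the given polynomial ring and
homogeneous of one degree less.\<close>
lemma var_ideal_division:
  fixes p :: "('v, 'a::comm_ring_1) mpoly"
  assumes "finite A" and "p \<in> var_ideal A"
  obtains q where "p = (\<Sum>a\<in>A. q a * mp_var a)"
    "\<And>V a. p \<in> PV V \<Longrightarrow> q a \<in> PV V" "\<And>k a. homogeneous (k + 1) p \<Longrightarrow> homogeneous k (q a)"
proof -
  have "\<exists>q. p = (\<Sum>a\<in>A. q a * mp_var a) \<and> (\<forall>V a. p \<in> PV V \<longrightarrow> q a \<in> PV V) \<and>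
         (\<forall>k a. homogeneous (k + 1) p \<longrightarrow> homogeneous k (q a))"
    using assms
  proof (induction A arbitrary: p rule: finite_induct)
    case empty
    then have "p = 0" by (auto simp: var_ideal_def)
    then show ?case by (intro exI[of _ "\<lambda>_. 0"]) auto
  next
    case (insert b A)
    have inj: "inj (\<lambda>m. m + single b (1::nat))" by (rule injI) simp
    define r where "r = Poly_Mapping.map_key (\<lambda>m. m + single b 1) p"
    have lookup_r: "lookup r m = lookup p (m + single b 1)" for m
      unfolding r_def by (subst map_key.rep_eq[OF inj]) simp
    define p' where "p' = p - mp_var b * r"
    have lookup_p': "lookup p' m = (if lookup m b > 0 then 0 else lookup p m)" for m
    proof (cases "lookup m b > 0")
      case True
      then show ?thesis
        using mon_minus_single[OF True] by (simp add: p'_def lookup_minus lookup_mult_var lookup_r)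
    qed (simp add: p'_def lookup_minus lookup_mult_var)
    have "p' \<in> var_ideal A"
      unfolding var_ideal_def
    proof (intro CollectI ballI)
      fix m assume "m \<in> keys p'"
      then have "lookup m b = 0" "m \<in> keys p" by (auto simp: in_keys_iff lookup_p' split: if_splits)
      then obtain a where "a \<in> insert b A" "lookup m a > 0"
        using insert.prems by (auto simp: var_ideal_def)
      with \<open>lookup m b = 0\<close> show "\<exists>a\<in>A. lookup m a > 0" by auto
    qed
    from insert.IH[OF this] obtain q where q: "p' = (\<Sum>a\<in>A. q a * mp_var a)"
      "\<And>V a. p' \<in> PV V \<Longrightarrow> q a \<in> PV V" "\<And>k a. homogeneous (k + 1) p' \<Longrightarrow> homogeneous k (q a)"
      by blast
    have r_PV: "r \<in> PV V" if "p \<in> PV V" for V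
      using that by (auto simp: PV_def in_keys_iff lookup_r subset_iff)
    have p'_PV: "p' \<in> PV V" if "p \<in> PV V" for V
      using that by (auto simp: PV_def in_keys_iff lookup_p' subset_iff)
    have r_hom: "homogeneous k r" if "homogeneous (k + 1) p" for k
      using that by (force simp: homogeneous_def in_keys_iff lookup_r)
    have p'_hom: "homogeneous k p'" if "homogeneous k p" for k
      using that by (auto simp: homogeneous_def in_keys_iff lookup_p' split: if_splits)
    have "p = (\<Sum>a\<in>insert b A. (q(b := r)) a * mp_var a)"
    proof -
      have "(\<Sum>a\<in>A. (q(b := r)) a * mp_var a) = (\<Sum>a\<in>A. q a * mp_var a)"
        by (rule sum.cong) (use insert.hyps in auto)
      moreover have "p = r * mp_var b + p'" by (simp add: p'_def mult.commute)
      ultimately show ?thesis using q(1) insert.hyps by simp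
    qed
    moreover have "(q(b := r)) a \<in> PV V" if "p \<in> PV V" for V a
      using q(2) r_PV p'_PV that by simp
    moreover have "homogeneous k ((q(b := r)) a)" if "homogeneous (k + 1) p" for k a
      using q(3) r_hom p'_hom that by simp
    ultimately show ?case by blast
  qed
  then show ?thesis using that by metis
qed

text \<open>An ideal generated by variables is prime: multiplying by a variable outside \<open>A\<close> does not create factors
from \<open>A\<close>.\<close>
lemma var_ideal_mult_var_cancel:
  assumes "mp_var b * p \<in> var_ideal A" "b \<notin> A"
  shows "p \<in> var_ideal (A :: 'v set)"
  unfolding var_ideal_def
proof (intro CollectI ballI)
  fix m assume "m \<in> keys p"
  then have "m + single b 1 \<in> keys (mp_var b * p)"
    by (simp add: in_keys_iff lookup_mult_var lookup_add)
  then obtain a where "a \<in> A" "0 < lookup (m + single b 1) a"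
    using assms by (auto simp: var_ideal_def)
  moreover have "a \<noteq> b" using \<open>a \<in> A\<close> assms by blast
  ultimately show "\<exists>a\<in>A. 0 < lookup m a" by (auto simp: lookup_add lookup_single)
qed

lemma var_ideal_add: "p \<in> var_ideal A \<Longrightarrow> q \<in> var_ideal A \<Longrightarrow> p + q \<in> var_ideal A"
  using keys_add[of p q] by (auto simp: var_ideal_def)

lemma var_ideal_sum: "(\<And>i. i \<in> I \<Longrightarrow> f i \<in> var_ideal A) \<Longrightarrow> (\<Sum>i\<in>I. f i) \<in> var_ideal A"
  by (induction I rule: infinite_finite_induct) (auto simp: var_ideal_add, simp_all add: var_ideal_def)

lemma var_ideal_uminus: "p \<in> var_ideal A \<Longrightarrow> - p \<in> var_ideal (A :: 'v set)"
  for p :: "('v, 'a::comm_ring_1) mpoly"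
  by (simp add: var_ideal_def)

lemma var_ideal_multiple:
  fixes p :: "('v, 'a::comm_ring_1) mpoly"
  assumes "p \<in> var_ideal A"
  shows "q * p \<in> var_ideal A"
  unfolding var_ideal_def
proof (intro CollectI ballI)
  fix m assume "m \<in> keys (q * p)"
  then obtain m1 m2 where "m = m1 + m2" "m2 \<in> keys p" using keys_mult[of q p] by blast
  moreover from this obtain a where "a \<in> A" "lookup m2 a > 0"
    using assms by (auto simp: var_ideal_def)
  ultimately show "\<exists>a\<in>A. lookup m a > 0" by (auto simp: lookup_add intro!: bexI[of _ a])
qed

lemma var_ideal_var: "a \<in> A \<Longrightarrow> mp_var a \<in> var_ideal A"
  by (auto simp: var_ideal_def mp_var_def intro!: bexI[of _ a])

text \<open>Any subring of the coefficients is admitted, because the symmetric algebra is formed over polynomials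
whose coefficients themselves lie in a polynomial ring in finitely many variables.\<close>
lemma cring_mpoly_ring:
  fixes A :: "'a::comm_ring_1 set"
  assumes A: "0 \<in> A" "1 \<in> A" "\<And>a b. a \<in> A \<Longrightarrow> b \<in> A \<Longrightarrow> a + b \<in> A"
    "\<And>a b. a \<in> A \<Longrightarrow> b \<in> A \<Longrightarrow> a * b \<in> A" "\<And>a. a \<in> A \<Longrightarrow> - a \<in> A"
  shows "cring (mpoly_ring A (V :: 'b set))" (is "cring ?R")
    and "\<And>p q. p \<in> carrier (mpoly_ring A V) \<Longrightarrow> q \<in> carrier (mpoly_ring A V) \<Longrightarrow>
           p \<ominus>\<^bsub>mpoly_ring A V\<^esub> q = p - q"
proof -
  have closed_sum: "(\<Sum>i\<in>I. f i) \<in> X"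
    if "0 \<in> X" "\<And>p q. p \<in> X \<Longrightarrow> q \<in> X \<Longrightarrow> p + q \<in> X" "\<And>i. i \<in> I \<Longrightarrow> f i \<in> X"
    for X :: "('b, 'a) mpoly set" and I :: "('b \<Rightarrow>\<^sub>0 nat) set" and f
    using that by (induction I rule: infinite_finite_induct) auto
  have carr: "p \<in> carrier ?R \<longleftrightarrow> (\<forall>m. lookup p m \<in> A) \<and> p \<in> PV V" for p
    by (auto simp: mpoly_ring_def PV_def)
  have add: "p + q \<in> carrier ?R" if "p \<in> carrier ?R" "q \<in> carrier ?R" for p q
    using that by (auto simp: carr lookup_add intro: A)
  have neg: "- p \<in> carrier ?R" if "p \<in> carrier ?R" for p
    using that by (auto simp: carr intro: A)
  have single: "single m a \<in> carrier ?R" if "m \<in> monomials V" "a \<in> A" for m a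
    using that A by (auto simp: carr PV_def lookup_single when_def)
  have zero: "0 \<in> carrier ?R" and one: "1 \<in> carrier ?R"
    using single[of 0 0] single[of 0 1] A by auto
  have mult: "p * q \<in> carrier ?R" if "p \<in> carrier ?R" "q \<in> carrier ?R" for p q
  proof -
    have "single m a * q \<in> carrier ?R" if "m \<in> monomials V" "a \<in> A" for m a
      using that \<open>q \<in> carrier ?R\<close> A
      by (auto simp: carr lookup_mult_single intro!: PV_mult PV_single)
    then have "(\<Sum>m\<in>keys p. single m (lookup p m) * q) \<in> carrier ?R"
      using \<open>p \<in> carrier ?R\<close> by (intro closed_sum[of "carrier ?R", OF zero add]) (auto simp: carr PV_def)
    then show ?thesis by (subst poly_sum_monomials[of p]) (simp add: sum_distrib_right)
  qed
  have ops: "(\<oplus>\<^bsub>?R\<^esub>) = (+)" "(\<otimes>\<^bsub>?R\<^esub>) = (*)" "\<zero>\<^bsub>?R\<^esub> = 0" "\<one>\<^bsub>?R\<^esub> = 1"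
    by (simp_all add: mpoly_ring_def)
  show cr: "cring ?R"
  proof (rule cringI)
    show "abelian_group ?R"
      by (rule abelian_groupI)
        (auto simp: ops zero add_ac add intro: bexI[OF _ neg])
    show "comm_monoid ?R"
      by (rule comm_monoidI) (auto simp: ops one mult mult_ac)
  qed (auto simp: ops distrib_right)
  fix p q assume pq: "p \<in> carrier ?R" "q \<in> carrier ?R"
  interpret cring ?R by (rule cr)
  have "\<ominus>\<^bsub>?R\<^esub> q = - q"
    using minus_equality[of "- q" q] pq neg by (simp add: ops)
  then show "p \<ominus>\<^bsub>?R\<^esub> q = p - q" by (simp add: a_minus_def ops)
qed

section \<open>Linear resolutions from colon ideals generated by variables\<close>

text \<open>The free module with basis \<open>I\<close>; outside \<open>I\<close> the value zero makes the coordinate function unique.\<close>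
definition vecs :: "'v set \<Rightarrow> 'i set \<Rightarrow> ('i \<Rightarrow> ('v, 'a::comm_ring_1) mpoly) set" where
  "vecs V I = {f. (\<forall>i\<in>I. f i \<in> PV V) \<and> (\<forall>i. i \<notin> I \<longrightarrow> f i = 0)}"

lemma vecs_PV: "f \<in> vecs V I \<Longrightarrow> f i \<in> PV V"
  by (cases "i \<in> I") (auto simp: vecs_def)
lemma vecs_outside: "f \<in> vecs V I \<Longrightarrow> i \<notin> I \<Longrightarrow> f i = 0"
  by (simp add: vecs_def)
lemma vecs_zero [simp]: "(\<lambda>i. 0) \<in> vecs V I" by (simp add: vecs_def)
lemma vecs_add: "f \<in> vecs V I \<Longrightarrow> g \<in> vecs V I \<Longrightarrow> (\<lambda>i. f i + g i) \<in> vecs V I"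
  by (auto simp: vecs_def)
lemma vecs_diff: "f \<in> vecs V I \<Longrightarrow> g \<in> vecs V I \<Longrightarrow> (\<lambda>i. f i - g i) \<in> vecs V I"
  by (auto simp: vecs_def)
lemma vecs_uminus: "f \<in> vecs V I \<Longrightarrow> (\<lambda>i. - f i) \<in> vecs V I"
  by (auto simp: vecs_def)
lemma vecs_smult: "s \<in> PV V \<Longrightarrow> f \<in> vecs V I \<Longrightarrow> (\<lambda>i. s * f i) \<in> vecs V I"
  by (auto simp: vecs_def)
lemma vecs_basis_vec: "i \<in> I \<Longrightarrow> basis_vec i \<in> vecs V I"
  by (auto simp: vecs_def basis_vec_def)

lemma carrier_free_module: "carrier (free_module V I d) = vecs V I"
  by (simp add: free_module_def vecs_def carrier_mpoly_ring)

lemma component_free_module: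
  "component (free_module V I d) k = {f \<in> vecs V I. \<forall>i\<in>I. homogeneous (k - d i) (f i)}"
  by (auto simp: free_module_def vecs_def carrier_mpoly_ring)

lemma free_module_ops:
  "add (free_module V I d) = (\<lambda>f g i. f i + g i)" "zero (free_module V I d) = (\<lambda>i. 0)"
  "smult (free_module V I d) = (\<lambda>s f i. s * f i)"
  by (simp_all add: free_module_def)

text \<open>The linear map from the free module of rank \<open>r\<close> that sends the basis vectors to \<open>z 0, z 1, \<dots>\<close>.\<close>
definition comb :: "nat \<Rightarrow> (nat \<Rightarrow> 'i \<Rightarrow> 'a) \<Rightarrow> (nat \<Rightarrow> 'a) \<Rightarrow> 'i \<Rightarrow> 'a::comm_ring_1" where
  "comb r z s = (\<lambda>i. \<Sum>j<r. s j * z j i)"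

lemma comb_add: "comb r z (\<lambda>j. s j + t j) = (\<lambda>i. comb r z s i + comb r z t i)"
  by (simp add: comb_def distrib_right sum.distrib)
lemma comb_diff: "comb r z (\<lambda>j. s j - t j) = (\<lambda>i. comb r z s i - comb r z t i)"
  by (simp add: comb_def left_diff_distrib sum_subtractf)
lemma comb_smult: "comb r z (\<lambda>j. c * s j) = (\<lambda>i. c * comb r z s i)"
  by (simp add: comb_def sum_distrib_left mult.assoc)

lemma comb_basis_vec: "k < r \<Longrightarrow> comb r z (basis_vec k) = z k"
  by (simp add: comb_def basis_vec_def if_distrib[of "\<lambda>x. x * _"] sum.delta cong: if_cong)

lemma sum_lessThan_add: "(\<Sum>j<m + n. f j) = (\<Sum>j<m. f j) + (\<Sum>t<n. f (m + t))"
  for f :: "nat \<Rightarrow> 'a::comm_monoid_add"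
  by (induction n) (auto simp: add_ac)

definition is_submodule :: "'v set \<Rightarrow> ('i \<Rightarrow> ('v, 'a::comm_ring_1) mpoly) set \<Rightarrow> bool" where
  "is_submodule V K \<longleftrightarrow> (\<lambda>i. 0) \<in> K \<and> (\<forall>h\<in>K. \<forall>g\<in>K. (\<lambda>i. h i + g i) \<in> K) \<and>
     (\<forall>s\<in>PV V. \<forall>h\<in>K. (\<lambda>i. s * h i) \<in> K)"

lemma is_submodule_add: "is_submodule V K \<Longrightarrow> h \<in> K \<Longrightarrow> g \<in> K \<Longrightarrow> (\<lambda>i. h i + g i) \<in> K"
  by (simp add: is_submodule_def)
lemma is_submodule_smult: "is_submodule V K \<Longrightarrow> s \<in> PV V \<Longrightarrow> h \<in> K \<Longrightarrow> (\<lambda>i. s * h i) \<in> K"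
  by (simp add: is_submodule_def)

lemma is_submodule_sum:
  assumes "is_submodule V K" "\<And>j. j \<in> X \<Longrightarrow> f j \<in> K"
  shows "(\<lambda>i. \<Sum>j\<in>X. f j i) \<in> K"
  using assms by (induction X rule: infinite_finite_induct) (auto simp: is_submodule_def)

lemma is_submodule_comb:
  assumes "is_submodule V K" "\<And>j. j < r \<Longrightarrow> z j \<in> K" "\<And>j. j < r \<Longrightarrow> s j \<in> PV V"
  shows "comb r z s \<in> K"
  unfolding comb_def
  by (rule is_submodule_sum) (use assms in \<open>auto simp: is_submodule_def\<close>)

lemma is_submodule_diff:
  assumes "is_submodule V K" "h \<in> K" "g \<in> K"
  shows "(\<lambda>i. h i - g i) \<in> K"
proof -
  from is_submodule_add[OF assms(1,2) is_submodule_smult[OF assms(1) PV_uminus[OF PV_one] assms(3)]]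
  show ?thesis by simp
qed

text \<open>Let \<open>N\<close> be the quotient of the free module of rank \<open>r\<close> by \<open>K\<close>, generated by the images \<open>u 0, u 1, \<dots>\<close> of the basis.
An element of \<open>K\<close> supported in the first \<open>k + 1\<close> coordinates expresses that its coordinate \<open>k\<close> maps \<open>u k\<close> into the
submodule generated by the earlier \<open>u l\<close>. The condition thus says that the colon ideal of the first \<open>k\<close>
generators by \<open>u k\<close> is generated by the variables \<open>As k\<close>, and that the relations witnessing this can be taken
linear. The lists, rather than sets, fix an order of the variables that is used for the syzygies.\<close>
definition variable_colons :: "'v set \<Rightarrow> nat \<Rightarrow> (nat \<Rightarrow> 'v list) \<Rightarrow>
    (nat \<Rightarrow> ('v, 'a::comm_ring_1) mpoly) set \<Rightarrow> bool" where
  "variable_colons V r As K \<longleftrightarrow> K \<subseteq> vecs V {..<r} \<and> is_submodule V K \<and>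
     (\<forall>k<r. distinct (As k) \<and> set (As k) \<subseteq> V \<and>
        (\<forall>h\<in>K. (\<forall>l>k. h l = 0) \<longrightarrow> h k \<in> var_ideal (set (As k))) \<and>
        (\<forall>a\<in>set (As k). \<exists>h\<in>K. h k = mp_var a \<and> (\<forall>l>k. h l = 0) \<and> (\<forall>l. homogeneous 1 (h l))))"

definition relations :: "'v set \<Rightarrow> nat \<Rightarrow> (nat \<Rightarrow> 'i \<Rightarrow> ('v, 'a::comm_ring_1) mpoly) \<Rightarrow>
    (nat \<Rightarrow> ('v, 'a) mpoly) set" where
  "relations V r z = {s \<in> vecs V {..<r}. comb r z s = (\<lambda>i. 0)}"

lemma is_submodule_relations: "is_submodule V (relations V r z)"
  unfolding is_submodule_def relations_def
  by (auto simp: vecs_add vecs_smult comb_add comb_smult) (simp add: comb_def)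

text \<open>The relations in the first \<open>k\<close> coordinates are generated by the linear relations attached to the pairs
\<open>(l, a)\<close> with \<open>l < k\<close> and \<open>a\<close> in \<open>As l\<close>. In the step to \<open>k + 1\<close> the generators \<open>w t\<close> for the variables \<open>a t\<close> of \<open>As k\<close> are
added. A syzygy whose last coordinate belongs to \<open>w t\<close> gives, in coordinate \<open>k\<close>, a relation between the
variables \<open>a 0, \<dots>, a t\<close>, so its last coordinate lies in the ideal of \<open>a 0, \<dots>, a (t - 1)\<close>. Conversely the Koszul
relation \<open>a u * w t - a t * w u\<close> vanishes in coordinate \<open>k\<close>, is therefore a combination of earlier generators, and
yields a linear syzygy with \<open>a u\<close> at \<open>w t\<close>. Hence the colon ideal at \<open>w t\<close> is generated by \<open>a 0, \<dots>, a (t - 1)\<close>.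
The degree statement is what makes the coefficients of that combination linear.\<close>
lemma variable_colons_syzygies_aux:
  fixes K :: "(nat \<Rightarrow> ('v, 'a::comm_ring_1) mpoly) set"
  assumes K: "variable_colons V r As K" and "k \<le> r"
  shows "\<exists>r' z As'. (\<forall>j<r'. z j \<in> K \<and> (\<forall>l\<ge>k. z j l = 0) \<and> (\<forall>l. homogeneous 1 (z j l))) \<and>
     (\<forall>h\<in>K. (\<forall>l\<ge>k. h l = 0) \<longrightarrow> (\<exists>s\<in>vecs V {..<r'}. h = comb r' z s \<and>
        (\<forall>e. (\<forall>l. homogeneous (e + 1) (h l)) \<longrightarrow> (\<forall>j. homogeneous e (s j))))) \<and>
     variable_colons V r' As' (relations V r' z)"
  using \<open>k \<le> r\<close>
proof (induction k)
  case 0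
  have "variable_colons V 0 (\<lambda>_. []) (relations V 0 z)" for z :: "nat \<Rightarrow> nat \<Rightarrow> ('v, 'a) mpoly"
    by (auto simp: variable_colons_def is_submodule_relations, simp add: relations_def)
  then show ?case
    by (intro exI[of _ 0] exI[of _ "\<lambda>_. []"] exI)
      (auto simp: comb_def fun_eq_iff intro!: bexI[of _ "\<lambda>_. 0"])
next
  case (Suc k)
  have sub: "is_submodule V K" and KV: "K \<subseteq> vecs V {..<r}" and "k < r"
    using K Suc.prems by (auto simp: variable_colons_def)
  have dist: "distinct (As k)" and AsV: "set (As k) \<subseteq> V"
    and colon: "\<And>h. h \<in> K \<Longrightarrow> (\<And>l. l > k \<Longrightarrow> h l = 0) \<Longrightarrow> h k \<in> var_ideal (set (As k))"
    and wit: "\<And>a. a \<in> set (As k) \<Longrightarrow> \<exists>h\<in>K. h k = mp_var a \<and> (\<forall>l>k. h l = 0) \<and> (\<forall>l. homogeneous 1 (h l))"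
    using K \<open>k < r\<close> unfolding variable_colons_def by blast+
  have "k \<le> r" using Suc.prems by simp
  from Suc.IH[OF this] obtain r' z As' where
    raw: "\<forall>j<r'. z j \<in> K \<and> (\<forall>l\<ge>k. z j l = 0) \<and> (\<forall>l. homogeneous 1 (z j l))"
    "\<forall>h\<in>K. (\<forall>l\<ge>k. h l = 0) \<longrightarrow> (\<exists>s\<in>vecs V {..<r'}. h = comb r' z s \<and>
        (\<forall>e. (\<forall>l. homogeneous (e + 1) (h l)) \<longrightarrow> (\<forall>j. homogeneous e (s j))))"
    and vc: "variable_colons V r' As' (relations V r' z)"
    by (elim exE conjE) (rule that)
  have z: "\<And>j. j < r' \<Longrightarrow> z j \<in> K" "\<And>j l. j < r' \<Longrightarrow> k \<le> l \<Longrightarrow> z j l = 0"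
       "\<And>j l. j < r' \<Longrightarrow> homogeneous 1 (z j l)"
    using raw(1) by blast+
  have gen: "\<exists>s\<in>vecs V {..<r'}. h = comb r' z s \<and>
        (\<forall>e. (\<forall>l. homogeneous (e + 1) (h l)) \<longrightarrow> (\<forall>j. homogeneous e (s j)))"
    if "h \<in> K" "\<And>l. k \<le> l \<Longrightarrow> h l = 0" for h
    using raw(2) that by blast
  define q where "q = length (As k)"
  define a where "a t = As k ! t" for t
  have a_set: "a t \<in> set (As k)" if "t < q" for t using that by (simp add: a_def q_def)
  have "\<exists>w. \<forall>t<q. w t \<in> K \<and> w t k = mp_var (a t) \<and> (\<forall>l>k. w t l = 0) \<and> (\<forall>l. homogeneous 1 (w t l))"
    by (rule choice_iff'[THEN iffD1]) (use wit a_set in blast)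
  then obtain w where w: "\<And>t. t < q \<Longrightarrow> w t \<in> K" "\<And>t. t < q \<Longrightarrow> w t k = mp_var (a t)"
    "\<And>t l. t < q \<Longrightarrow> k < l \<Longrightarrow> w t l = 0" "\<And>t l. t < q \<Longrightarrow> homogeneous 1 (w t l)"
    by blast
  define z' where "z' j = (if j < r' then z j else w (j - r'))" for j
  define As'' where "As'' j = (if j < r' then As' j else take (j - r') (As k))" for j
  have comb_z': "comb (r' + q) z' s i = comb r' z s i + (\<Sum>t<q. s (r' + t) * w t i)" for s i
    by (simp add: comb_def sum_lessThan_add z'_def)
  have sum_set: "(\<Sum>x\<in>set (As k). f x) = (\<Sum>t<q. f (a t))" for f :: "'v \<Rightarrow> ('v, 'a) mpoly"
    using sum.reindex_bij_betw[OF bij_betw_nth[OF dist refl refl], of f]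
    by (simp add: a_def q_def)
  have gens: "z' j \<in> K \<and> (\<forall>l\<ge>Suc k. z' j l = 0) \<and> (\<forall>l. homogeneous 1 (z' j l))" if "j < r' + q" for j
    using that z w by (auto simp: z'_def)
  have gen': "\<exists>s\<in>vecs V {..<r' + q}. h = comb (r' + q) z' s \<and>
        (\<forall>e. (\<forall>l. homogeneous (e + 1) (h l)) \<longrightarrow> (\<forall>j. homogeneous e (s j)))"
    if h: "h \<in> K" and h0: "\<And>l. Suc k \<le> l \<Longrightarrow> h l = 0" for h
  proof -
    have "h k \<in> var_ideal (set (As k))" using colon[OF h] h0 by simp
    then obtain Q where Q: "h k = (\<Sum>x\<in>set (As k). Q x * mp_var x)"
      "\<And>V x. h k \<in> PV V \<Longrightarrow> Q x \<in> PV V" "\<And>e x. homogeneous (e + 1) (h k) \<Longrightarrow> homogeneous e (Q x)"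
      using var_ideal_division[OF finite_set] by metis
    have QV: "Q x \<in> PV V" for x using Q(2) vecs_PV[of h V] KV h by blast
    \<comment> \<open>Subtracting multiples of the new generators removes coordinate \<open>k\<close>.\<close>
    define h' where "h' = (\<lambda>i. h i - (\<Sum>t<q. Q (a t) * w t i))"
    have "(\<lambda>i. \<Sum>t<q. Q (a t) * w t i) \<in> K"
      using is_submodule_comb[OF sub, of q w "\<lambda>t. Q (a t)"] w(1) QV by (simp add: comb_def)
    from is_submodule_diff[OF sub h this] have h'K: "h' \<in> K" by (simp add: h'_def)
    have h'0: "h' l = 0" if "k \<le> l" for l
    proof (cases "l = k")
      case True then show ?thesis using Q(1) w(2) by (simp add: h'_def sum_set)
    next
      case False then show ?thesis using that h0[of l] w(3) by (simp add: h'_def)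
    qed
    obtain s where s: "s \<in> vecs V {..<r'}" "h' = comb r' z s"
      "\<forall>e. (\<forall>l. homogeneous (e + 1) (h' l)) \<longrightarrow> (\<forall>j. homogeneous e (s j))"
      using gen[OF h'K h'0] by blast
    define s' where "s' j = (if j < r' then s j else if j < r' + q then Q (a (j - r')) else 0)" for j
    have "s' \<in> vecs V {..<r' + q}"
      using s(1) QV by (auto simp: vecs_def s'_def)
    moreover have "h = comb (r' + q) z' s'"
    proof
      fix i
      have "comb r' z s' = comb r' z s" by (simp add: comb_def s'_def)
      then have "comb (r' + q) z' s' i = h' i + (\<Sum>t<q. Q (a t) * w t i)"
        by (simp add: comb_z' s(2)) (simp add: s'_def)
      then show "h i = comb (r' + q) z' s' i" by (simp add: h'_def)
    qed
    moreover have "homogeneous e (s' j)" if hom: "\<And>l. homogeneous (e + 1) (h l)" for e j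
    proof -
      have Qe: "homogeneous e (Q x)" for x using Q(3) hom by blast
      have "homogeneous (e + 1) (h' l)" for l
        unfolding h'_def
        by (intro homogeneous_diff hom homogeneous_sum homogeneous_mult Qe w(4)) simp
      then show ?thesis using s(3) Qe by (auto simp: s'_def)
    qed
    ultimately show ?thesis by blast
  qed
  have zk: "comb r' z s k = 0" for s using z(2) by (simp add: comb_def)
  have "variable_colons V (r' + q) As'' (relations V (r' + q) z')"
    unfolding variable_colons_def
  proof (intro conjI is_submodule_relations allI impI)
    show "relations V (r' + q) z' \<subseteq> vecs V {..<r' + q}" by (auto simp: relations_def)
    fix j assume j: "j < r' + q"
    show "distinct (As'' j)"
      using vc j dist by (auto simp: As''_def variable_colons_def)
    show "set (As'' j) \<subseteq> V"
      using vc j AsV set_take_subset[of "j - r'" "As k"] by (auto simp: As''_def variable_colons_def)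
    show "\<forall>s\<in>relations V (r' + q) z'. (\<forall>l>j. s l = 0) \<longrightarrow> s j \<in> var_ideal (set (As'' j))"
    proof (intro ballI impI)
      fix s assume s: "s \<in> relations V (r' + q) z'" and s0: "\<forall>l>j. s l = 0"
      then have sV: "s \<in> vecs V {..<r' + q}" and rel: "comb (r' + q) z' s = (\<lambda>i. 0)"
        by (auto simp: relations_def)
      show "s j \<in> var_ideal (set (As'' j))"
      proof (cases "j < r'")
        case True
        then have "comb (r' + q) z' s = comb r' z s" using s0 by (auto simp: comb_z' fun_eq_iff)
        moreover have "s \<in> vecs V {..<r'}" using sV s0 True by (auto simp: vecs_def)
        ultimately have "s \<in> relations V r' z" using rel by (simp add: relations_def)
        then show ?thesis using vc True s0 by (auto simp: variable_colons_def As''_def)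
      next
        case False
        define t where "t = j - r'"
        have t: "j = r' + t" "t < q" using False j by (auto simp: t_def)
        have "0 = (\<Sum>t'<q. s (r' + t') * mp_var (a t'))"
          using fun_cong[OF rel, of k] w(2) by (simp add: comb_z' zk)
        also have "\<dots> = (\<Sum>t'<Suc t. s (r' + t') * mp_var (a t'))"
          by (rule sum.mono_neutral_right) (use t s0 in auto)
        finally have "mp_var (a t) * s j = - (\<Sum>t'<t. s (r' + t') * mp_var (a t'))"
          by (simp add: t(1) mult.commute eq_neg_iff_add_eq_0 add.commute)
        also have "\<dots> \<in> var_ideal (set (take t (As k)))"
          by (intro var_ideal_uminus var_ideal_sum var_ideal_multiple var_ideal_var)
            (use t in \<open>auto simp: a_def q_def in_set_conv_nth\<close>)
        finally have "s j \<in> var_ideal (set (take t (As k)))"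
          by (rule var_ideal_mult_var_cancel)
            (use t dist in \<open>auto simp: a_def q_def in_set_conv_nth nth_eq_iff_index_eq\<close>)
        then show ?thesis using t by (simp add: As''_def)
      qed
    qed
    show "\<forall>x\<in>set (As'' j). \<exists>h\<in>relations V (r' + q) z'. h j = mp_var x \<and> (\<forall>l>j. h l = 0) \<and>
            (\<forall>l. homogeneous 1 (h l))"
    proof
      fix x assume x: "x \<in> set (As'' j)"
      show "\<exists>h\<in>relations V (r' + q) z'. h j = mp_var x \<and> (\<forall>l>j. h l = 0) \<and>
            (\<forall>l. homogeneous 1 (h l))"
      proof (cases "j < r'")
        case True
        then have "x \<in> set (As' j)" using x by (simp add: As''_def)
        then obtain h where h: "h \<in> relations V r' z" "h j = mp_var x" "\<forall>l>j. h l = 0"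
          "\<forall>l. homogeneous 1 (h l)"
          using vc True unfolding variable_colons_def by blast
        have hV: "h \<in> vecs V {..<r'}" using h by (simp add: relations_def)
        then have "comb (r' + q) z' h = comb r' z h"
          by (auto simp: comb_z' fun_eq_iff vecs_def)
        then have "h \<in> relations V (r' + q) z'" using h hV by (auto simp: relations_def vecs_def)
        then show ?thesis using h by blast
      next
        case False
        define t where "t = j - r'"
        have t: "j = r' + t" "t < q" using False j by (auto simp: t_def)
        obtain u where u: "u < t" "x = a u"
          using x t by (auto simp: As''_def in_set_conv_nth a_def)
        have uq: "u < q" using u t by simp
        \<comment> \<open>The Koszul relation between \<open>a u\<close> and \<open>a t\<close>; it has degree two, so its coefficients \<open>s\<close> are linear.\<close>
        define g where "g = (\<lambda>i. mp_var (a u) * w t i - mp_var (a t) * w u i)"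
        have aV: "mp_var (a t') \<in> PV V" if "t' < q" for t' using a_set[OF that] AsV by (intro PV_var) blast
        have "g \<in> K" unfolding g_def
          by (rule is_submodule_diff[OF sub is_submodule_smult[OF sub] is_submodule_smult[OF sub]])
            (use aV t uq w(1) in auto)
        moreover have "g l = 0" if "k \<le> l" for l
          using that w(2,3) t uq by (cases "l = k") (auto simp: g_def mult.commute)
        ultimately obtain s where s: "s \<in> vecs V {..<r'}" "g = comb r' z s"
          "\<forall>e. (\<forall>l. homogeneous (e + 1) (g l)) \<longrightarrow> (\<forall>j. homogeneous e (s j))"
          using gen by blast
        have "homogeneous (1 + 1) (g l)" for l
          unfolding g_def by (intro homogeneous_diff homogeneous_mult homogeneous_var w(4) t uq)
        then have s1: "homogeneous 1 (s l)" for l using s(3) by blast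
        define h where "h l = (if l < r' then - s l else if l = r' + t then mp_var (a u)
            else if l = r' + u then - mp_var (a t) else 0)" for l
        have "h \<in> vecs V {..<r' + q}"
          using s(1) aV t uq by (auto simp: vecs_def h_def)
        moreover have "comb (r' + q) z' h = (\<lambda>i. 0)"
        proof
          fix i
          have "comb r' z h = (\<lambda>i. - g i)" by (auto simp: s(2) comb_def h_def sum_negf)
          moreover have "(\<Sum>t'<q. h (r' + t') * w t' i) = (\<Sum>t'\<in>{t, u}. h (r' + t') * w t' i)"
            by (rule sum.mono_neutral_right) (use t uq in \<open>auto simp: h_def\<close>)
          moreover have "\<dots> = g i" using u by (simp add: h_def g_def)
          ultimately show "comb (r' + q) z' h i = 0" by (simp add: comb_z')
        qed
        moreover have "h j = mp_var x" "\<forall>l>j. h l = 0" "\<forall>l. homogeneous 1 (h l)"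
          using t u s1 by (auto simp: h_def)
        ultimately show ?thesis unfolding relations_def by blast
      qed
    qed
  qed
  with gens gen' show ?case
    by (intro exI[of _ "r' + q"] exI[of _ z'] exI[of _ As'']) (simp add: Suc_le_eq)
qed

text \<open>The property passes to the first syzygy module, with generators of degree one higher. It can therefore
be iterated without end.\<close>
lemma variable_colons_syzygies:
  fixes K :: "(nat \<Rightarrow> ('v, 'a::comm_ring_1) mpoly) set"
  assumes "variable_colons V r As K"
  obtains r' z As' where "\<And>j. j < r' \<Longrightarrow> z j \<in> K" "\<And>j l. j < r' \<Longrightarrow> homogeneous 1 (z j l)"
    "K = comb r' z ` vecs V {..<r'}" "variable_colons V r' As' (relations V r' z)"
proof -
  have KV: "K \<subseteq> vecs V {..<r}" and sub: "is_submodule V K"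
    using assms by (auto simp: variable_colons_def)
  from variable_colons_syzygies_aux[OF assms order_refl] obtain r' z As' where
    z: "\<forall>j<r'. z j \<in> K \<and> (\<forall>l\<ge>r. z j l = 0) \<and> (\<forall>l. homogeneous 1 (z j l))"
    and gen: "\<forall>h\<in>K. (\<forall>l\<ge>r. h l = 0) \<longrightarrow> (\<exists>s\<in>vecs V {..<r'}. h = comb r' z s \<and>
        (\<forall>e. (\<forall>l. homogeneous (e + 1) (h l)) \<longrightarrow> (\<forall>j. homogeneous e (s j))))"
    and vc: "variable_colons V r' As' (relations V r' z)"
    by (elim exE conjE) (rule that)
  have "K \<subseteq> comb r' z ` vecs V {..<r'}"
  proof
    fix h assume h: "h \<in> K"
    then have "\<forall>l\<ge>r. h l = 0" using KV vecs_outside[of h V "{..<r}"] by auto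
    with gen h show "h \<in> comb r' z ` vecs V {..<r'}" by blast
  qed
  moreover have "comb r' z s \<in> K" if "s \<in> vecs V {..<r'}" for s
    by (rule is_submodule_comb[OF sub]) (use z vecs_PV[OF that] in auto)
  ultimately have "K = comb r' z ` vecs V {..<r'}" by blast
  with that[of r' z As'] z vc show ?thesis by blast
qed

lemma graded_hom_comb:
  assumes "\<And>j. j < r' \<Longrightarrow> z j \<in> vecs V {..<r}" "\<And>j l. j < r' \<Longrightarrow> homogeneous 1 (z j l)"
  shows "graded_hom (mpoly_ring UNIV V) (free_module V {..<r'} (\<lambda>_. d + 1))
           (free_module V {..<r} (\<lambda>_. d)) (comb r' z)"
proof -
  have sub: "is_submodule V (vecs V {..<r})"
    by (auto simp: is_submodule_def vecs_add vecs_smult)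
  have closed: "comb r' z s \<in> vecs V {..<r}" if "s \<in> vecs V {..<r'}" for s
    by (rule is_submodule_comb[OF sub]) (use assms vecs_PV[OF that] in auto)
  have "homogeneous (k - d) (comb r' z s l)" if "\<forall>j<r'. homogeneous (k - (d + 1)) (s j)" for k s l
  proof -
    have "homogeneous ((k - (d + 1)) + 1) (s j * z j l)" if "j < r'" for j
      using \<open>\<forall>j<r'. _ j\<close> assms(2) that by (intro homogeneous_mult) auto
    then show ?thesis unfolding comb_def by (intro homogeneous_sum) simp
  qed
  then show ?thesis
    using closed unfolding graded_hom_def
    by (auto simp: hom_def free_module_ops carrier_free_module component_free_module
        comb_add comb_smult)
qed

text \<open>Taking syzygies again and again gives a resolution all of whose maps have linear entries. Such a
resolution is minimal, since linear entries have no constant term. The stages of the construction carry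
the rank, the kernel still to be resolved, and the generators chosen for the previous kernel.\<close>
theorem variable_colons_linear_resolution:
  fixes N :: "(('v, 'k::field) mpoly, 'm) graded_module"
  assumes vc: "variable_colons V r As K"
    and hom: "graded_hom (mpoly_ring UNIV V) (free_module V {..<r} (\<lambda>_. d)) N \<epsilon>"
    and surj: "\<epsilon> ` vecs V {..<r} = carrier N"
    and ker: "{s \<in> vecs V {..<r}. \<epsilon> s = \<zero>\<^bsub>N\<^esub>} = K"
  shows "has_linear_resolution V N"
proof -
  define next_stage where "next_stage x y \<longleftrightarrow>
     (case (x, y) of ((r, K, z), (r', K', z')) \<Rightarrow>
        (\<forall>j<r'. z' j \<in> K \<and> (\<forall>l. homogeneous 1 (z' j l))) \<and>
        K = comb r' z' ` vecs V {..<r'} \<and> K' = relations V r' z')"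
    for x y :: "nat \<times> (nat \<Rightarrow> ('v, 'k) mpoly) set \<times> (nat \<Rightarrow> nat \<Rightarrow> ('v, 'k) mpoly)"
  \<comment> \<open>The third component of stage zero is a dummy: no kernel precedes it.\<close>
  define stage where "stage i x \<longleftrightarrow> (i = 0 \<longrightarrow> x = (r, K, \<lambda>_ _. 0)) \<and>
     (\<exists>As. variable_colons V (fst x) As (fst (snd x)))"
    for i :: nat and x :: "nat \<times> (nat \<Rightarrow> ('v, 'k) mpoly) set \<times> (nat \<Rightarrow> nat \<Rightarrow> ('v, 'k) mpoly)"
  have "\<exists>f. \<forall>i. stage i (f i) \<and> next_stage (f i) (f (Suc i))"
  proof (rule dependent_nat_choice[of stage "\<lambda>_. next_stage"])
    show "\<exists>x. stage 0 x"
      using vc by (intro exI[of _ "(r, K, \<lambda>_ _. 0)"]) (auto simp: stage_def)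
    fix x i assume x: "stage i x"
    obtain r1 K1 z1 where x1: "x = (r1, K1, z1)" by (cases x)
    with x obtain As1 where "variable_colons V r1 As1 K1" by (auto simp: stage_def)
    then obtain r' z' As' where "\<And>j. j < r' \<Longrightarrow> z' j \<in> K1" "\<And>j l. j < r' \<Longrightarrow> homogeneous 1 (z' j l)"
      "K1 = comb r' z' ` vecs V {..<r'}" "variable_colons V r' As' (relations V r' z')"
      by (rule variable_colons_syzygies) (rule that)
    then show "\<exists>y. stage (Suc i) y \<and> next_stage x y"
      by (intro exI[of _ "(r', relations V r' z', z')"]) (auto simp: next_stage_def stage_def x1)
  qed
  then obtain f where stage: "\<And>i. stage i (f i)" and fS: "\<And>i. next_stage (f i) (f (Suc i))"
    by blast
  have f0: "f 0 = (r, K, \<lambda>_ _. 0)" using stage[of 0] by (simp add: stage_def)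
  define b where "b i = fst (f i)" for i
  define KK where "KK i = fst (snd (f i))" for i
  define z where "z i = snd (snd (f (Suc i)))" for i
  have KKV: "KK i \<subseteq> vecs V {..<b i}" for i
    using stage[of i] by (auto simp: stage_def variable_colons_def b_def KK_def)
  have z: "\<And>j. j < b (Suc i) \<Longrightarrow> z i j \<in> KK i" "\<And>j l. j < b (Suc i) \<Longrightarrow> homogeneous 1 (z i j l)"
    and im: "KK i = comb (b (Suc i)) (z i) ` vecs V {..<b (Suc i)}"
    and KS: "KK (Suc i) = relations V (b (Suc i)) (z i)" for i
    using fS[of i] by (auto simp: next_stage_def b_def KK_def z_def split: prod.splits)
  have zV: "z i j \<in> vecs V {..<b i}" if "j < b (Suc i)" for i j using z(1)[OF that] KKV by blast
  let ?a = "\<lambda>i j::nat. d + int i"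
  have b0: "b 0 = r" and K0: "KK 0 = K" using f0 by (auto simp: b_def KK_def)
  have ghom: "graded_hom (mpoly_ring UNIV V) (free_module V {..<b (Suc i)} (?a (Suc i)))
      (free_module V {..<b i} (?a i)) (comb (b (Suc i)) (z i))" for i
    using graded_hom_comb[of "b (Suc i)" "z i" V "b i" "d + int i"] zV z(2) by (simp add: add_ac)
  have "graded_free_resolution V N b ?a (\<lambda>i. comb (b (Suc i)) (z i)) \<epsilon>"
    unfolding graded_free_resolution_def Let_def carrier_free_module a_kernel_def kernel_def
    using hom surj ker ghom im KS b0 K0
    by (auto simp: carrier_free_module free_module_ops relations_def)
  moreover have "lookup (comb (b (Suc i)) (z i) s j) 0 = 0" for i s j
  proof -
    have "lookup (z i l j) 0 = 0" if "l < b (Suc i)" for l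
      using z(2)[OF that, of j] by (force simp: homogeneous_def in_keys_iff)
    then show ?thesis by (simp add: comb_def lookup_sum lookup_mult_0)
  qed
  ultimately have "minimal_graded_free_resolution V N b ?a (\<lambda>i. comb (b (Suc i)) (z i)) \<epsilon>"
    by (simp add: minimal_graded_free_resolution_def)
  then show ?thesis unfolding has_linear_resolution_def
    by (intro exI[of _ b] exI[of _ ?a] exI[of _ "\<lambda>i. comb (b (Suc i)) (z i)"] exI[of _ \<epsilon>] exI[of _ d]) simp
qed

section \<open>The edge module\<close>

lemma is_submodule_zero: "is_submodule V K \<Longrightarrow> (\<lambda>i. 0) \<in> K"
  by (simp add: is_submodule_def)

lemma abelian_group_free_module: "abelian_group (free_module V I d)"
  by (rule abelian_groupI)
    (auto simp: carrier_free_module free_module_ops vecs_add add_ac fun_eq_iff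
      intro!: bexI[OF _ vecs_uminus])

lemma submodule_free_module_iff:
  "submodule N (mpoly_ring UNIV V) (free_module V I d) \<longleftrightarrow> N \<subseteq> vecs V I \<and> is_submodule V N"
proof
  assume "submodule N (mpoly_ring UNIV V) (free_module V I d)"
  then interpret submodule N "mpoly_ring UNIV V" "free_module V I d" .
  have "N \<subseteq> vecs V I" using subset by (simp add: carrier_free_module)
  moreover have "is_submodule V N"
    using m_closed one_closed smult_closed
    by (auto simp: is_submodule_def free_module_ops carrier_mpoly_ring)
  ultimately show "N \<subseteq> vecs V I \<and> is_submodule V N" ..
next
  assume N: "N \<subseteq> vecs V I \<and> is_submodule V N"
  interpret M: abelian_group "free_module V I d" by (rule abelian_group_free_module)
  have inv: "inv\<^bsub>add_monoid (free_module V I d)\<^esub> f = (\<lambda>i. - f i)" if "f \<in> vecs V I" for f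
    using M.minus_equality[of "\<lambda>i. - f i" f] that
    by (simp add: carrier_free_module free_module_ops vecs_uminus a_inv_def)
  have "(\<lambda>i. - f i) \<in> N" if "f \<in> N" for f
    using is_submodule_diff[of V N "\<lambda>i. 0" f] N that by (simp add: is_submodule_def)
  then have invN: "inv\<^bsub>add_monoid (free_module V I d)\<^esub> f \<in> N" if "f \<in> N" for f
    using N that by (subst inv) auto
  show "submodule N (mpoly_ring UNIV V) (free_module V I d)"
    unfolding submodule_def submodule_axioms_def subgroup_def
    using N invN is_submodule_add[of V N] is_submodule_zero[of V N] is_submodule_smult[of V N]
    by (simp add: carrier_free_module free_module_ops carrier_mpoly_ring)
qed

text \<open>With this rewrite rule the simplifier would turn the vertex set \<open>{1..n}\<close> into \<open>{Suc 0..n}\<close>.\<close>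
declare One_nat_def [simp del]

locale edge_graph =
  fixes n :: nat and E :: "nat set set"
  assumes simple: "simple_graph n E"
begin

abbreviation "V \<equiv> {1..n}"

lemma edgeD: "{i, j} \<in> E \<Longrightarrow> i \<in> V \<and> j \<in> V \<and> i \<noteq> j"
  using simple simple_graph_irrefl[OF simple] by (auto simp: simple_graph_def)

lemma edge_commute: "{i, j} \<in> E \<longleftrightarrow> {j, i} \<in> E"
  by (simp add: insert_commute)

text \<open>A vector with one coordinate for each edge, written as an antisymmetric matrix so that no orientation
of the edges has to be chosen.\<close>
definition edge_form :: "(nat \<Rightarrow> nat \<Rightarrow> (nat, 'k::comm_ring_1) mpoly) \<Rightarrow> bool" where
  "edge_form \<eta> \<longleftrightarrow> (\<forall>i j. \<eta> i j \<in> PV V \<and> \<eta> j i = - \<eta> i j \<and> ({i, j} \<notin> E \<longrightarrow> \<eta> i j = 0))"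

lemma edge_formI:
  assumes "\<And>i j. \<eta> i j \<in> PV V" "\<And>i j. \<eta> j i = - \<eta> i j" "\<And>i j. {i, j} \<notin> E \<Longrightarrow> \<eta> i j = 0"
  shows "edge_form \<eta>"
  using assms unfolding edge_form_def by blast

lemma edge_formD:
  assumes "edge_form \<eta>"
  shows edge_form_PV: "\<eta> i j \<in> PV V" and edge_form_anti: "\<eta> j i = - \<eta> i j"
    and edge_form_zero: "{i, j} \<notin> E \<Longrightarrow> \<eta> i j = 0"
  using assms unfolding edge_form_def by blast+

lemma edge_form_smult:
  assumes "edge_form \<eta>" "s \<in> PV V"
  shows "edge_form (\<lambda>i j. s * \<eta> i j)"
proof (rule edge_formI)
  show "s * \<eta> j i = - (s * \<eta> i j)" for i j by (subst edge_form_anti[OF assms(1)]) simp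
qed (use edge_form_PV[OF assms(1)] edge_form_zero[OF assms(1)] assms(2) in auto)

lemma edge_form_sum:
  assumes "\<And>t. t \<in> T \<Longrightarrow> edge_form (\<eta> t)"
  shows "edge_form (\<lambda>i j. \<Sum>t\<in>T. \<eta> t i j)"
proof (rule edge_formI)
  show "(\<Sum>t\<in>T. \<eta> t j i) = - (\<Sum>t\<in>T. \<eta> t i j)" for i j
    unfolding sum_negf[symmetric] by (intro sum.cong refl edge_form_anti assms)
qed (use edge_form_PV[OF assms] edge_form_zero[OF assms] in \<open>auto intro!: PV_sum sum.neutral\<close>)

lemma edge_form_add:
  assumes "edge_form \<eta>" "edge_form \<theta>"
  shows "edge_form (\<lambda>i j. \<eta> i j + \<theta> i j)"
proof (rule edge_formI)
  show "\<eta> j i + \<theta> j i = - (\<eta> i j + \<theta> i j)" for i j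
    by (subst edge_form_anti[OF assms(1)], subst edge_form_anti[OF assms(2)]) simp
qed (use edge_form_PV[OF assms(1)] edge_form_zero[OF assms(1)] edge_form_PV[OF assms(2)]
    edge_form_zero[OF assms(2)] in auto)

text \<open>The map from edge vectors onto the relations of the edge module: the elementary edge form of \<open>{i, j}\<close> goes
to \<open>x\<^sub>i e\<^sub>j - x\<^sub>j e\<^sub>i\<close>. Edge forms in its kernel are the syzygies between these relations.\<close>
definition boundary :: "(nat \<Rightarrow> nat \<Rightarrow> (nat, 'k::comm_ring_1) mpoly) \<Rightarrow> nat \<Rightarrow> (nat, 'k) mpoly" where
  "boundary \<eta> = (\<lambda>l. \<Sum>i\<in>V. mp_var i * \<eta> i l)"

abbreviation relation :: "nat \<Rightarrow> nat \<Rightarrow> nat \<Rightarrow> (nat, 'k::comm_ring_1) mpoly" where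
  "relation i j \<equiv> (\<lambda>l. mp_var i * basis_vec j l - mp_var j * basis_vec i l)"

lemma boundary_add: "boundary (\<lambda>i j. \<eta> i j + \<theta> i j) = (\<lambda>l. boundary \<eta> l + boundary \<theta> l)"
  by (simp add: boundary_def distrib_left sum.distrib)

lemma boundary_smult: "boundary (\<lambda>i j. s * \<eta> i j) = (\<lambda>l. s * boundary \<eta> l)"
  by (simp add: boundary_def sum_distrib_left mult_ac)

lemma boundary_sum: "boundary (\<lambda>i j. \<Sum>t\<in>T. \<eta> t i j) = (\<lambda>l. \<Sum>t\<in>T. boundary (\<eta> t) l)"
  unfolding boundary_def sum_distrib_left by (subst sum.swap) (rule refl)

lemma boundary_vecs: "edge_form \<eta> \<Longrightarrow> boundary \<eta> \<in> vecs V V"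
proof -
  assume \<eta>: "edge_form \<eta>"
  have "\<eta> i l = 0" if "l \<notin> V" for i l
    using edge_form_zero[OF \<eta>] edgeD[of i l] that by blast
  then show ?thesis
    using edge_form_PV[OF \<eta>] by (auto simp: vecs_def boundary_def intro!: PV_sum PV_mult sum.neutral)
qed

lemma boundary_elementary:
  assumes "{i, j} \<in> E"
  defines "\<eta> \<equiv> \<lambda>p q. if p = i \<and> q = j then 1 else if p = j \<and> q = i then - 1 else 0"
  shows "edge_form \<eta>" and "boundary \<eta> = relation i j"
proof -
  have ij: "i \<noteq> j" "i \<in> V" "j \<in> V" using edgeD[OF assms(1)] by auto
  then show "edge_form \<eta>"
    using assms(1) edge_commute[THEN iffD1, OF assms(1)] by (auto simp: edge_form_def \<eta>_def)
  show "boundary \<eta> = relation i j"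
  proof
    fix l
    have "boundary \<eta> l = (\<Sum>p\<in>{i, j}. mp_var p * \<eta> p l)"
      unfolding boundary_def by (rule sum.mono_neutral_right) (use ij in \<open>auto simp: \<eta>_def\<close>)
    then show "boundary \<eta> l = relation i j l"
      using ij by (auto simp: \<eta>_def basis_vec_def)
  qed
qed

text \<open>Antisymmetry lets the sum over ordered pairs be folded onto the pairs with \<open>i < j\<close>.\<close>
lemma boundary_eq_sum_relations:
  assumes "edge_form \<eta>"
  shows "boundary \<eta> = (\<lambda>l. \<Sum>(i, j)\<in>{(i, j). i \<in> V \<and> j \<in> V \<and> i < j \<and> {i, j} \<in> E}. \<eta> i j * relation i j l)"
proof
  fix l
  let ?P = "{(i, j). i \<in> V \<and> j \<in> V \<and> i < j \<and> {i, j} \<in> E}"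
  have zero: "\<eta> i j = 0" if "{i, j} \<notin> E" for i j using edge_form_zero[OF assms that] .
  have anti: "\<eta> j i = - \<eta> i j" for i j using edge_form_anti[OF assms] .
  have out: "\<eta> i l = 0" "\<eta> l i = 0" if "l \<notin> V" for i
    using zero edgeD that by blast+
  have "(\<Sum>(i, j)\<in>?P. \<eta> i j * relation i j l)
      = (\<Sum>(i, j)\<in>V \<times> V. if i < j then \<eta> i j * relation i j l else 0)"
    by (rule sum.mono_neutral_cong_left) (auto split: if_splits, metis mult_zero_left zero)
  also have "\<dots> = (\<Sum>i\<in>V. \<Sum>j\<in>V. if i < j then \<eta> i j * relation i j l else 0)"
    by (simp add: sum.cartesian_product)
  also have "\<dots> = (\<Sum>i\<in>V. \<Sum>j\<in>V. if j = l then (if i < l then mp_var i * \<eta> i l else 0) else 0)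
      - (\<Sum>i\<in>V. \<Sum>j\<in>V. if i = l then (if l < j then mp_var j * \<eta> l j else 0) else 0)"
    unfolding sum_subtractf[symmetric]
    by (intro sum.cong refl) (auto simp: basis_vec_def mult_ac)
  also have "(\<Sum>i\<in>V. \<Sum>j\<in>V. if j = l then (if i < l then mp_var i * \<eta> i l else 0) else 0)
      = (\<Sum>i\<in>V. if i < l then mp_var i * \<eta> i l else 0)"
    by (rule sum.cong) (auto simp: sum.delta out)
  also have "(\<Sum>i\<in>V. \<Sum>j\<in>V. if i = l then (if l < j then mp_var j * \<eta> l j else 0) else 0)
      = (\<Sum>j\<in>V. if l < j then mp_var j * \<eta> l j else 0)"
    by (subst sum.swap, rule sum.cong) (auto simp: sum.delta out)
  also have "(\<Sum>i\<in>V. if i < l then mp_var i * \<eta> i l else 0)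
      - (\<Sum>j\<in>V. if l < j then mp_var j * \<eta> l j else 0) = (\<Sum>i\<in>V. mp_var i * \<eta> i l)"
    unfolding sum_subtractf[symmetric]
  proof (rule sum.cong[OF refl])
    fix i
    have "\<eta> l l = 0" using zero[of l l] edgeD[of l l] by auto
    moreover have "i = l \<or> i < l \<or> l < i \<and> \<eta> i l = - \<eta> l i" using anti[of i l] by (metis linorder_less_linear)
    ultimately show "(if i < l then mp_var i * \<eta> i l else 0) - (if l < i then mp_var i * \<eta> l i else 0)
        = mp_var i * \<eta> i l"
      by (elim disjE conjE) (simp_all)
  qed
  finally show "boundary \<eta> l = (\<Sum>(i, j)\<in>?P. \<eta> i j * relation i j l)"
    by (simp add: boundary_def)
qed

lemma is_submodule_boundaries:
  "is_submodule V (boundary ` {\<eta>. edge_form \<eta>} :: (nat \<Rightarrow> (nat, 'k::comm_ring_1) mpoly) set)"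
  (is "is_submodule V ?B")
  unfolding is_submodule_def
proof (intro conjI ballI)
  show "(\<lambda>i. 0) \<in> ?B"
    by (rule image_eqI[of _ _ "\<lambda>i j. 0"]) (auto simp: boundary_def edge_form_def)
  fix h assume "h \<in> ?B"
  then obtain \<eta> where \<eta>: "edge_form \<eta>" "h = boundary \<eta>" by blast
  show "(\<lambda>i. s * h i) \<in> ?B" if "s \<in> PV V" for s
    using \<eta> edge_form_smult[OF \<eta>(1) that] by (intro image_eqI[of _ _ "\<lambda>i j. s * \<eta> i j"])
      (auto simp: boundary_smult)
  fix g assume "g \<in> ?B"
  then obtain \<theta> where \<theta>: "edge_form \<theta>" "g = boundary \<theta>" by blast
  have "edge_form (\<lambda>i j. \<eta> i j + \<theta> i j)" using \<eta> \<theta> by (simp add: edge_form_add)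
  then show "(\<lambda>i. h i + g i) \<in> ?B"
    using \<eta> \<theta> by (intro image_eqI[of _ _ "\<lambda>i j. \<eta> i j + \<theta> i j"]) (auto simp: boundary_add)
qed

text \<open>The boundaries form a submodule, contain the generating relations, and are combinations of them.\<close>
lemma edge_relations_eq:
  "(edge_relations n E :: (nat \<Rightarrow> (nat, 'k::field) mpoly) set) = boundary ` {\<eta>. edge_form \<eta>}"
proof
  let ?B = "boundary ` {\<eta>. edge_form \<eta>} :: (nat \<Rightarrow> (nat, 'k) mpoly) set"
  note sub = is_submodule_boundaries
  have gens: "{relation i j |i j. {i, j} \<in> E} \<subseteq> ?B"
  proof clarify
    fix i j assume e: "{i, j} \<in> E"
    let ?e = "\<lambda>p q. if p = i \<and> q = j then 1 else if p = j \<and> q = i then - 1 else 0"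
    have "boundary ?e \<in> ?B" by (rule imageI) (simp add: boundary_elementary(1)[OF e])
    then show "relation i j \<in> ?B" by (simp only: boundary_elementary(2)[OF e])
  qed
  have carr: "?B \<subseteq> vecs V V"
    using boundary_vecs by auto
  show "edge_relations n E \<subseteq> ?B"
    unfolding edge_relations_def gen_submodule_def edge_cover_def submodule_free_module_iff
    by (rule Inter_lower, rule CollectI) (intro conjI carr sub gens)
  show "?B \<subseteq> edge_relations n E"
    unfolding edge_relations_def gen_submodule_def edge_cover_def submodule_free_module_iff
  proof (intro subsetI InterI)
    fix h and N :: "(nat \<Rightarrow> (nat, 'k) mpoly) set"
    assume h: "h \<in> ?B"
      and N: "N \<in> {N. (N \<subseteq> vecs V V \<and> is_submodule V N) \<and> {relation i j |i j. {i, j} \<in> E} \<subseteq> N}"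
    from h obtain \<eta> where \<eta>: "edge_form \<eta>" "h = boundary \<eta>" by blast
    have N1: "is_submodule V N" and N2: "{relation i j |i j. {i, j} \<in> E} \<subseteq> N" using N by (blast, blast)
    let ?P = "{(i, j). i \<in> V \<and> j \<in> V \<and> i < j \<and> {i, j} \<in> E}"
    have "(\<lambda>l. \<Sum>p\<in>?P. \<eta> (fst p) (snd p) * relation (fst p) (snd p) l) \<in> N"
    proof (rule is_submodule_sum[OF N1])
      fix p assume "p \<in> ?P"
      then have "{fst p, snd p} \<in> E" by auto
      then have "relation (fst p) (snd p) \<in> N" using N2 by blast
      then show "(\<lambda>l. \<eta> (fst p) (snd p) * relation (fst p) (snd p) l) \<in> N"
        by (rule is_submodule_smult[OF N1 edge_form_PV[OF \<eta>(1)]])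
    qed
    moreover have "h = (\<lambda>l. \<Sum>p\<in>?P. \<eta> (fst p) (snd p) * relation (fst p) (snd p) l)"
      unfolding \<eta>(2) boundary_eq_sum_relations[OF \<eta>(1)] by (intro ext sum.cong refl) (simp only: case_prod_beta)
    ultimately show "h \<in> N" by (simp only:)
  qed
qed

lemma is_submodule_edge_relations: "is_submodule V (edge_relations n E)"
  unfolding edge_relations_eq by (rule is_submodule_boundaries)

lemma edge_relations_vecs: "edge_relations n E \<subseteq> vecs V V"
  unfolding edge_relations_eq by (rule image_subsetI) (simp add: boundary_vecs)

lemma zero_in_edge_relations: "(\<lambda>i. 0) \<in> edge_relations n E"
  by (rule is_submodule_zero[OF is_submodule_edge_relations])

lemma add_edge_cover: "add (edge_cover n) = (\<lambda>f g i. f i + g i)"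
  by (simp add: edge_cover_def free_module_ops)

lemma smult_edge_cover: "smult (edge_cover n) = (\<lambda>s f i. s * f i)"
  by (simp add: edge_cover_def free_module_ops)

text \<open>The class of a vector in the edge module, a coset of the submodule of relations.\<close>
abbreviation cls :: "(nat \<Rightarrow> (nat, 'k::field) mpoly) \<Rightarrow> (nat \<Rightarrow> (nat, 'k) mpoly) set" where
  "cls f \<equiv> edge_relations n E +>\<^bsub>edge_cover n\<^esub> f"

lemma cls_def: "cls f = {g. (\<lambda>i. g i - f i) \<in> edge_relations n E}"
proof -
  have *: "cls f = (\<Union>h\<in>edge_relations n E. {\<lambda>i. h i + f i})"
    by (simp add: a_r_coset_def' add_edge_cover)
  show ?thesis
  proof (intro equalityI subsetI)
    fix g assume "g \<in> cls f"
    then show "g \<in> {g. (\<lambda>i. g i - f i) \<in> edge_relations n E}" unfolding * by auto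
  next
    fix g assume "g \<in> {g. (\<lambda>i. g i - f i) \<in> edge_relations n E}"
    then show "g \<in> cls f" unfolding * by (intro UN_I[of "\<lambda>i. g i - f i"]) auto
  qed
qed

lemma cls_self: "f \<in> cls f"
  by (simp add: cls_def zero_in_edge_relations)

lemma cls_eq_iff: "cls f = cls g \<longleftrightarrow> (\<lambda>i. f i - g i) \<in> edge_relations n E"
proof -
  note C = is_submodule_edge_relations
  show ?thesis
  proof
    assume "cls f = cls g"
    with cls_self[of f] have "f \<in> cls g" by simp
    then show "(\<lambda>i. f i - g i) \<in> edge_relations n E" by (simp add: cls_def)
  next
    assume fg: "(\<lambda>i. f i - g i) \<in> edge_relations n E"
    have "(\<lambda>i. h i - g i) \<in> edge_relations n E" if "(\<lambda>i. h i - f i) \<in> edge_relations n E" for h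
      using is_submodule_add[OF C that fg] by simp
    moreover have "(\<lambda>i. h i - f i) \<in> edge_relations n E" if "(\<lambda>i. h i - g i) \<in> edge_relations n E" for h
      using is_submodule_diff[OF C that fg] by simp
    ultimately show "cls f = cls g" unfolding cls_def by blast
  qed
qed

lemma cls_add: "cls f <+>\<^bsub>edge_cover n\<^esub> cls g = cls (\<lambda>i. f i + g i)"
proof (intro equalityI subsetI)
  note C = is_submodule_edge_relations
  fix h assume "h \<in> cls f <+>\<^bsub>edge_cover n\<^esub> cls g"
  then obtain a b where ab: "(\<lambda>i. a i - f i) \<in> edge_relations n E" "(\<lambda>i. b i - g i) \<in> edge_relations n E"
    "h = (\<lambda>i. a i + b i)"
    unfolding set_add_def' by (auto simp: add_edge_cover cls_def)
  from is_submodule_add[OF C ab(1,2)] show "h \<in> cls (\<lambda>i. f i + g i)"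
    by (simp add: cls_def ab(3) algebra_simps)
next
  fix h assume h: "h \<in> cls (\<lambda>i. f i + g i)"
  then have "(\<lambda>i. h i - g i) \<in> cls f" by (simp add: cls_def algebra_simps)
  moreover have "g \<in> cls g" by (rule cls_self)
  ultimately show "h \<in> cls f <+>\<^bsub>edge_cover n\<^esub> cls g"
    unfolding set_add_def' add_edge_cover
    by (intro UN_I[of "\<lambda>i. h i - g i"] UN_I[of g]) auto
qed

abbreviation edge_mod :: "((nat, 'k::field) mpoly, (nat \<Rightarrow> (nat, 'k) mpoly) set) graded_module" where
  "edge_mod \<equiv> edge_module n E"

lemma edge_module_simps:
  shows carrier_edge_module: "carrier edge_mod = cls ` vecs V V"
    and zero_edge_module: "\<zero>\<^bsub>edge_mod\<^esub> = edge_relations n E"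
    and add_edge_module: "cls f \<oplus>\<^bsub>edge_mod\<^esub> cls g = cls (\<lambda>i. f i + g i)"
    and component_edge_module: "component edge_mod k = cls ` component (edge_cover n) k"
  using cls_add
  by (auto simp: edge_module_def quotient_module_def A_RCOSETS_def' edge_cover_def carrier_free_module)

lemma smult_edge_module:
  assumes "s \<in> PV V"
  shows "s \<odot>\<^bsub>edge_mod\<^esub> cls f = cls (\<lambda>i. s * f i)"
proof -
  note C = is_submodule_edge_relations
  have "s \<odot>\<^bsub>edge_mod\<^esub> cls f = (\<Union>g\<in>cls f. cls (\<lambda>i. s * g i))"
    by (simp add: edge_module_def quotient_module_def smult_edge_cover)
  also have "\<dots> = (\<Union>g\<in>cls f. cls (\<lambda>i. s * f i))"
  proof (rule SUP_cong[OF refl])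
    fix g assume "g \<in> cls f"
    then have "(\<lambda>i. g i - f i) \<in> edge_relations n E" by (simp add: cls_def)
    from is_submodule_smult[OF C assms this] show "cls (\<lambda>i. s * g i) = cls (\<lambda>i. s * f i)"
      by (simp add: cls_eq_iff right_diff_distrib)
  qed
  also have "\<dots> = cls (\<lambda>i. s * f i)" using cls_self[of f] by (metis UN_constant empty_iff)
  finally show ?thesis .
qed

lemma cls_eq_zero_iff: "cls f = edge_relations n E \<longleftrightarrow> f \<in> edge_relations n E"
  using cls_eq_iff[of f "\<lambda>i. 0"] by (simp add: cls_def)

end

section \<open>Linear syzygies of the edge module\<close>

lemma lookup_mult_homogeneous:
  fixes h q :: "('v, 'a::comm_ring_1) mpoly"
  assumes q: "homogeneous e q" and m: "int (mon_deg m) = e"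
  shows "lookup (h * q) m = lookup h 0 * lookup q m"
proof (induction h rule: poly_induct)
  case (single t)
  have "lookup q (m - t) = 0" if "m = t + m'" "t \<noteq> 0" for m'
  proof (rule ccontr)
    assume "lookup q (m - t) \<noteq> 0"
    then have "int (mon_deg m') = e" using q that by (auto simp: homogeneous_def in_keys_iff)
    with m that show False by simp
  qed
  then show ?case by (cases "t = 0") (auto simp: lookup_mult_single lookup_single)
qed (auto simp: distrib_right lookup_add)

text \<open>Comparing the components of degree \<open>e\<close>: if a homogeneous \<open>R\<close> is a combination of elements of its own degree,
then only the constant terms of the coefficients contribute.\<close>
lemma lowest_degree_part:
  fixes h :: "'i \<Rightarrow> ('v, 'a::comm_ring_1) mpoly"
  assumes R: "R = (\<Sum>k\<in>I. h k * q k)" "homogeneous e R" and q: "\<And>k. k \<in> I \<Longrightarrow> homogeneous e (q k)"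
  shows "R = (\<Sum>k\<in>I. mp_const (lookup (h k) 0) * q k)"
proof (rule poly_mapping_eqI)
  fix m
  show "lookup R m = lookup (\<Sum>k\<in>I. mp_const (lookup (h k) 0) * q k) m"
  proof (cases "int (mon_deg m) = e")
    case True
    then show ?thesis
      unfolding R(1) lookup_sum
      by (intro sum.cong refl) (simp add: lookup_mult_homogeneous[OF q True] lookup_const_mult)
  next
    case False
    have "lookup (q k) m = 0" if "k \<in> I" for k
      using q[OF that] False by (auto simp: homogeneous_def in_keys_iff)
    moreover have "lookup R m = 0" using R(2) False by (auto simp: homogeneous_def in_keys_iff)
    ultimately show ?thesis by (simp add: lookup_sum lookup_const_mult)
  qed
qed

lemma homogeneous_0_const: "homogeneous 0 p \<Longrightarrow> p = mp_const (lookup p 0)"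
  by (rule poly_mapping_eqI) (auto simp: homogeneous_def in_keys_iff mp_const_def lookup_single when_def)

text \<open>The codomain is only given by its two operations, so that the statement applies to maps into free
modules as well as into the edge module, whose elements are cosets.\<close>
lemma linear_maps_eq_on_basis:
  fixes h g :: "(nat \<Rightarrow> ('v, 'a::comm_ring_1) mpoly) \<Rightarrow> 'm"
  assumes h: "\<And>f f'. f \<in> vecs V {..<b} \<Longrightarrow> f' \<in> vecs V {..<b} \<Longrightarrow> h (\<lambda>i. f i + f' i) = pl (h f) (h f')"
    "\<And>s f. s \<in> PV V \<Longrightarrow> f \<in> vecs V {..<b} \<Longrightarrow> h (\<lambda>i. s * f i) = smul s (h f)"
    and g: "\<And>f f'. f \<in> vecs V {..<b} \<Longrightarrow> f' \<in> vecs V {..<b} \<Longrightarrow> g (\<lambda>i. f i + f' i) = pl (g f) (g f')"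
    "\<And>s f. s \<in> PV V \<Longrightarrow> f \<in> vecs V {..<b} \<Longrightarrow> g (\<lambda>i. s * f i) = smul s (g f)"
    and eq: "h (\<lambda>_. 0) = g (\<lambda>_. 0)" "\<And>j. j < b \<Longrightarrow> h (basis_vec j) = g (basis_vec j)"
    and f: "f \<in> vecs V {..<b}"
  shows "h f = g f"
proof -
  have trunc: "h (\<lambda>j. if j < m then f j else 0) = g (\<lambda>j. if j < m then f j else 0)" if "m \<le> b" for m
    using that
  proof (induction m)
    case (Suc m)
    have *: "(\<lambda>j. if j < Suc m then f j else 0) = (\<lambda>j. (if j < m then f j else 0) + f m * basis_vec m j)"
      by (auto simp: basis_vec_def fun_eq_iff less_Suc_eq)
    have v: "(\<lambda>j. if j < m then f j else 0) \<in> vecs V {..<b}" "basis_vec m \<in> vecs V {..<b}" "f m \<in> PV V"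
      using f Suc.prems vecs_PV[OF f] by (auto simp: vecs_def basis_vec_def)
    note w = vecs_smult[OF v(3,2)]
    show ?case unfolding * h(1)[OF v(1) w] g(1)[OF v(1) w] h(2)[OF v(3,2)] g(2)[OF v(3,2)]
      using Suc eq(2)[of m] by simp
  qed (simp add: eq)
  have "(\<lambda>j. if j < b then f j else 0) = f"
    using vecs_outside[OF f] by auto
  with trunc[OF order_refl] show ?thesis by (simp only:)
qed

lemma lookup_var_0 [simp]: "lookup (mp_var v :: ('v, 'a::comm_ring_1) mpoly) 0 = 0"
proof -
  have "single v (1::nat) \<noteq> 0" by (metis mon_deg_single mon_deg_zero zero_neq_one)
  then show ?thesis by (simp add: mp_var_def lookup_single)
qed

lemma graded_hom_component: "graded_hom R M N f \<Longrightarrow> x \<in> component M k \<Longrightarrow> f x \<in> component N k"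
  unfolding graded_hom_def by blast

context edge_graph
begin

lemma edge_relations_const: "h \<in> edge_relations n E \<Longrightarrow> lookup (h l) 0 = 0"
  unfolding edge_relations_eq boundary_def
  by (auto simp: lookup_sum lookup_mult_0)

text \<open>An edge form with constant coefficients can be read off from its boundary.\<close>
lemma lookup_boundary_const:
  assumes "p \<in> V"
  shows "lookup (boundary (\<lambda>i j. mp_const (x i j)) l) (single p 1) = x p l"
proof -
  have "lookup (mp_var i * mp_const (x i l)) (single p 1) = (if i = p then x p l else 0)" for i
    by (auto simp: lookup_mult_var lookup_single mp_const_def when_def)
  then show ?thesis using assms by (simp add: boundary_def lookup_sum sum.delta)
qed

lemma relation_in_edge_relations:
  assumes "{i, j} \<in> E"
  shows "relation i j \<in> edge_relations n E"
proof -
  let ?e = "\<lambda>p q. if p = i \<and> q = j then 1 else if p = j \<and> q = i then - 1 else 0"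
  have "boundary ?e \<in> boundary ` {\<eta>. edge_form \<eta>}"
    by (rule imageI) (simp add: boundary_elementary(1)[OF assms])
  then show ?thesis by (simp only: boundary_elementary(2)[OF assms] edge_relations_eq)
qed

abbreviation elementary :: "nat \<Rightarrow> nat \<Rightarrow> nat \<Rightarrow> nat \<Rightarrow> (nat, 'k::comm_ring_1) mpoly" where
  "elementary i j \<equiv> \<lambda>p q. if p = i \<and> q = j then 1 else if p = j \<and> q = i then - 1 else 0"

text \<open>In a linear resolution \<open>F\<^sub>2 \<rightarrow> F\<^sub>1 \<rightarrow> F\<^sub>0 \<rightarrow> M\<close> the module \<open>F\<^sub>0\<close> is generated in degree 1, like \<open>M\<close> itself, and \<open>F\<^sub>1\<close> in
degree 2, like the standard relations. For degree reasons the standard presentation of \<open>M\<close> and the given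
resolution can thus be compared by matrices of constants: \<open>\<alpha>\<close> expresses the standard generators by those
of \<open>F\<^sub>0\<close>, \<open>c\<close> expresses the standard relations by those of \<open>F\<^sub>1\<close>, and \<open>\<eta>\<close> expresses the relations of \<open>F\<^sub>1\<close> by the
standard ones. A syzygy \<open>\<zeta>\<close> between standard relations is carried by \<open>c\<close> to a syzygy in \<open>F\<^sub>1\<close>, which is a
combination of the linear columns of \<open>F\<^sub>2 \<rightarrow> F\<^sub>1\<close>, and \<open>\<eta>\<close> carries these to linear syzygies \<open>lam\<close>. The composite
of \<open>c\<close> and \<open>\<eta>\<close> is the identity, because a constant edge form is determined by its boundary. The vertex \<open>v\<close>
ensures that \<open>M\<close> is not zero, which fixes the degree of the generators.\<close>
lemma linear_syzygies_generate:
  fixes \<zeta> :: "nat \<Rightarrow> nat \<Rightarrow> (nat, 'k::field) mpoly"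
  assumes lin: "has_linear_resolution V (edge_mod :: ((nat, 'k) mpoly, (nat \<Rightarrow> (nat, 'k) mpoly) set) graded_module)"
    and v: "v \<in> V" and \<zeta>: "edge_form \<zeta>" "boundary \<zeta> = (\<lambda>_. 0)"
  obtains m :: nat and s :: "nat \<Rightarrow> (nat, 'k) mpoly" and lam where
    "\<And>t. t < m \<Longrightarrow> edge_form (lam t)" "\<And>t. t < m \<Longrightarrow> boundary (lam t) = (\<lambda>_. 0)"
    "\<And>t p q. t < m \<Longrightarrow> homogeneous 1 (lam t p q)" "\<And>p q. \<zeta> p q = (\<Sum>t<m. s t * lam t p q)"
proof -
  let ?M = "edge_mod :: ((nat, 'k) mpoly, (nat \<Rightarrow> (nat, 'k) mpoly) set) graded_module"
  let ?S = "mpoly_ring UNIV V :: (nat, 'k) mpoly ring"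
  from lin obtain b a \<phi> \<epsilon> d where
    res: "graded_free_resolution V ?M b a \<phi> \<epsilon>" and a: "\<And>i j. j < b i \<Longrightarrow> a i j = d + int i"
    unfolding has_linear_resolution_def minimal_graded_free_resolution_def by blast
  let ?F = "\<lambda>i. vecs V {..<b i} :: (nat \<Rightarrow> (nat, 'k) mpoly) set"
  have \<epsilon>: "graded_hom ?S (free_module V {..<b 0} (a 0)) ?M \<epsilon>" and
    \<phi>: "\<And>i. graded_hom ?S (free_module V {..<b (Suc i)} (a (Suc i))) (free_module V {..<b i} (a i)) (\<phi> i)" and
    surj: "\<epsilon> ` ?F 0 = carrier ?M" and
    ker0: "{f \<in> ?F 0. \<epsilon> f = \<zero>\<^bsub>?M\<^esub>} = \<phi> 0 ` ?F 1" and
    ker1: "{f \<in> ?F 1. \<phi> 0 f = (\<lambda>_. 0)} = \<phi> 1 ` ?F 2"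
  proof -
    show "\<epsilon> ` ?F 0 = carrier ?M" "{f \<in> ?F 0. \<epsilon> f = \<zero>\<^bsub>?M\<^esub>} = \<phi> 0 ` ?F 1"
      using res by (simp_all add: graded_free_resolution_def Let_def carrier_free_module a_kernel_def kernel_def)
    have "a_kernel (free_module V {..<b (Suc 0)} (a (Suc 0))) (free_module V {..<b 0} (a 0)) (\<phi> 0)
        = \<phi> (Suc 0) ` carrier (free_module V {..<b (Suc (Suc 0))} (a (Suc (Suc 0))))"
      using res unfolding graded_free_resolution_def Let_def by blast
    then show "{f \<in> ?F 1. \<phi> 0 f = (\<lambda>_. 0)} = \<phi> 1 ` ?F 2"
      by (simp add: carrier_free_module a_kernel_def kernel_def free_module_ops One_nat_def numeral_2_eq_2)
  qed (use res in \<open>simp_all add: graded_free_resolution_def Let_def\<close>)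
  have bas: "basis_vec j \<in> component (free_module V {..<b i} (a i)) (d + int i)" if "j < b i" for i j
    using that vecs_basis_vec[of j "{..<b i}" V] a
    by (auto simp: component_free_module basis_vec_def)
  (* the augmentation, lifted to the standard cover of M *)
  have "\<exists>B. \<forall>j<b 0. B j \<in> vecs V V \<and> (\<forall>l. homogeneous (d - 1) (B j l)) \<and> \<epsilon> (basis_vec j) = cls (B j)"
  proof (rule choice_iff'[THEN iffD1], intro allI impI)
    fix j assume "j < b 0"
    from graded_hom_component[OF \<epsilon> bas[OF this]] have "\<epsilon> (basis_vec j) \<in> component ?M d" by simp
    then obtain f where f: "\<epsilon> (basis_vec j) = cls f" "f \<in> component (edge_cover n) d"
      by (auto simp: component_edge_module)
    then have fV: "f \<in> vecs V V" and hom: "\<forall>l\<in>V. homogeneous (d - 1) (f l)"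
      by (auto simp: edge_cover_def component_free_module)
    have "homogeneous (d - 1) (f l)" for l
      using hom vecs_outside[OF fV, of l] by (cases "l \<in> V") auto
    with f fV show "\<exists>f. f \<in> vecs V V \<and> (\<forall>l. homogeneous (d - 1) (f l)) \<and> \<epsilon> (basis_vec j) = cls f"
      by blast
  qed
  then obtain B where B: "\<And>j. j < b 0 \<Longrightarrow> B j \<in> vecs V V" "\<And>j l. j < b 0 \<Longrightarrow> homogeneous (d - 1) (B j l)"
    "\<And>j. j < b 0 \<Longrightarrow> \<epsilon> (basis_vec j) = cls (B j)" by blast
  have sub: "is_submodule V (vecs V V :: (nat \<Rightarrow> (nat, 'k) mpoly) set)"
    by (auto simp: is_submodule_def vecs_add vecs_smult)
  have eps: "\<epsilon> f = cls (comb (b 0) B f)" if f: "f \<in> ?F 0" for f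
  proof (rule linear_maps_eq_on_basis[where pl = "add ?M" and smul = "smult ?M", OF _ _ _ _ _ _ f])
    show "\<epsilon> (\<lambda>i. g i + g' i) = \<epsilon> g \<oplus>\<^bsub>?M\<^esub> \<epsilon> g'" if "g \<in> ?F 0" "g' \<in> ?F 0" for g g'
      using \<epsilon> that by (simp add: graded_hom_def hom_def carrier_free_module free_module_ops)
    show smul: "\<epsilon> (\<lambda>i. s * g i) = s \<odot>\<^bsub>?M\<^esub> \<epsilon> g" if "s \<in> PV V" "g \<in> ?F 0" for s g
      using \<epsilon> that by (simp add: graded_hom_def carrier_free_module carrier_mpoly_ring free_module_ops)
    have "\<epsilon> (\<lambda>_. 0) \<in> carrier ?M" unfolding surj[symmetric] by (rule imageI) simp
    then obtain g where "\<epsilon> (\<lambda>_. 0) = cls g" unfolding carrier_edge_module by blast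
    then have "\<epsilon> (\<lambda>_. 0) = cls (\<lambda>_. 0)"
      using smul[of 0 "\<lambda>_. 0"] smult_edge_module[of 0 g] by simp
    then show "\<epsilon> (\<lambda>_. 0) = cls (comb (b 0) B (\<lambda>_. 0))" by (simp add: comb_def)
  qed (simp_all add: add_edge_module smult_edge_module comb_add comb_smult comb_basis_vec B)
  have surjE: "\<exists>f\<in>?F 0. (\<lambda>l. comb (b 0) B f l - basis_vec i l) \<in> edge_relations n E" if "i \<in> V" for i
  proof -
    have "cls (basis_vec i) \<in> \<epsilon> ` ?F 0"
      unfolding surj carrier_edge_module by (rule imageI) (rule vecs_basis_vec[OF that])
    then obtain f where "f \<in> ?F 0" "cls (basis_vec i) = \<epsilon> f" by blast
    then have "cls (comb (b 0) B f) = cls (basis_vec i)" using eps[of f] by simp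
    with \<open>f \<in> ?F 0\<close> show ?thesis by (intro bexI[of _ f]) (simp_all only: cls_eq_iff)
  qed
  have coeff: "(\<Sum>j<b 0. lookup (f j) 0 * lookup (B j l) 0) = (if l = i then 1 else 0)"
    if "(\<lambda>l. comb (b 0) B f l - basis_vec i l) \<in> edge_relations n E" for f i l
    using edge_relations_const[OF that, of l]
    by (simp add: lookup_minus comb_def lookup_sum lookup_mult_0 basis_vec_def split: if_splits)
  have d: "d = 1"
  proof -
    obtain f where "(\<lambda>l. comb (b 0) B f l - basis_vec v l) \<in> edge_relations n E" using surjE[OF v] by blast
    from coeff[OF this, of v] have "(\<Sum>j<b 0. lookup (f j) 0 * lookup (B j v) 0) \<noteq> 0" by simp
    then obtain j where "j < b 0" "lookup (B j v) 0 \<noteq> 0"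
      by (rule sum.not_neutral_contains_not_neutral) auto
    moreover from this have "0 \<in> keys (B j v)" by (simp add: in_keys_iff)
    ultimately have "int (mon_deg (0 :: nat \<Rightarrow>\<^sub>0 nat)) = d - 1"
      using B(2)[of j v] unfolding homogeneous_def by blast
    then show ?thesis by simp
  qed
  have B_const: "B j l = mp_const (lookup (B j l) 0)" if "j < b 0" for j l
    using B(2)[OF that, of l] d by (intro homogeneous_0_const) simp
  define \<alpha> where
    "\<alpha> i = (SOME c. \<forall>l. (\<Sum>j<b 0. c j * lookup (B j l) 0) = (if l = i then 1 else 0))" for i
  have \<alpha>: "(\<Sum>j<b 0. \<alpha> i j * lookup (B j l) 0) = (if l = i then 1 else 0)" if "i \<in> V" for i l
  proof -
    from surjE[OF that] obtain f where "(\<lambda>l. comb (b 0) B f l - basis_vec i l) \<in> edge_relations n E" by blast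
    from coeff[OF this]
    have "\<exists>c. \<forall>l. (\<Sum>j<b 0. c j * lookup (B j l) 0) = (if l = i then 1 else 0)"
      by (intro exI[of _ "\<lambda>j. lookup (f j) 0"]) simp
    from someI_ex[OF this] show ?thesis unfolding \<alpha>_def by blast
  qed
  define e :: "nat \<Rightarrow> nat \<Rightarrow> (nat, 'k) mpoly" where "e i = (\<lambda>j. if j < b 0 then mp_const (\<alpha> i j) else 0)" for i
  have eV: "e i \<in> ?F 0" for i by (auto simp: e_def vecs_def)
  have Be: "comb (b 0) B (e i) = basis_vec i" if "i \<in> V" for i
  proof
    fix l
    have "comb (b 0) B (e i) l = (\<Sum>j<b 0. mp_const (\<alpha> i j * lookup (B j l) 0))"
      unfolding comb_def by (intro sum.cong refl) (subst B_const, auto simp: e_def mp_const_mult)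
    then show "comb (b 0) B (e i) l = basis_vec i l"
      using \<alpha>[OF that, of l] by (simp add: mp_const_sum[symmetric] basis_vec_def)
  qed
  define D where "D = (\<lambda>k. \<phi> 0 (basis_vec k))"
  define Q where "Q = (\<lambda>t. \<phi> 1 (basis_vec t))"
  have phi_props: "\<phi> i (basis_vec k) \<in> ?F i \<and> (\<forall>l. homogeneous 1 (\<phi> i (basis_vec k) l))"
    if "k < b (Suc i)" for i k
  proof -
    have "\<phi> i (basis_vec k) \<in> component (free_module V {..<b i} (a i)) (d + int (Suc i))"
      by (rule graded_hom_component[OF \<phi> bas[OF that]])
    then have 1: "\<phi> i (basis_vec k) \<in> ?F i" "\<forall>l<b i. homogeneous 1 (\<phi> i (basis_vec k) l)"
      using a by (auto simp: component_free_module)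
    moreover have "homogeneous 1 (\<phi> i (basis_vec k) l)" for l
      using 1 vecs_outside[OF 1(1), of l] by (cases "l < b i") auto
    ultimately show ?thesis by blast
  qed
  have phi: "\<phi> i f = comb (b (Suc i)) (\<lambda>k. \<phi> i (basis_vec k)) f" if f: "f \<in> ?F (Suc i)" for i f
  proof (rule linear_maps_eq_on_basis[where pl = "\<lambda>f g i. f i + g i" and smul = "\<lambda>s f i. s * f i", OF _ _ _ _ _ _ f])
    show "\<phi> i (\<lambda>l. g l + g' l) = (\<lambda>l. \<phi> i g l + \<phi> i g' l)" if "g \<in> ?F (Suc i)" "g' \<in> ?F (Suc i)" for g g'
      using \<phi>[of i] that by (simp add: graded_hom_def hom_def carrier_free_module free_module_ops)
    show smul: "\<phi> i (\<lambda>l. s * g l) = (\<lambda>l. s * \<phi> i g l)" if "s \<in> PV V" "g \<in> ?F (Suc i)" for s g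
      using \<phi>[of i] that by (simp add: graded_hom_def carrier_free_module carrier_mpoly_ring free_module_ops)
    show "\<phi> i (\<lambda>_. 0) = comb (b (Suc i)) (\<lambda>k. \<phi> i (basis_vec k)) (\<lambda>_. 0)"
      using smul[of 0 "\<lambda>_. 0"] by (simp add: comb_def)
  qed (simp_all add: comb_add comb_smult comb_basis_vec)
  have phi0: "\<phi> 0 f = comb (b 1) D f" if "f \<in> ?F 1" for f
    using phi[of f 0] that by (simp add: D_def One_nat_def)
  have phi1: "\<phi> 1 f = comb (b 2) Q f" if "f \<in> ?F 2" for f
    using phi[of f 1] that by (simp add: Q_def numeral_2_eq_2 One_nat_def)
  have D: "D k \<in> ?F 0" "homogeneous 1 (D k l)" if "k < b 1" for k l
    using phi_props[of k 0] that by (auto simp: D_def One_nat_def)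
  have Q: "Q t \<in> ?F 1" "homogeneous 1 (Q t k)" if "t < b 2" for t k
    using phi_props[of t 1] that by (auto simp: Q_def numeral_2_eq_2 One_nat_def)
  (* lifting of the relations of M to the first module of the resolution, by constants *)
  define r where "r i j = (\<lambda>l. mp_var i * e j l - mp_var j * e i l)" for i j
  have lift: "\<exists>c. \<forall>l. r i j l = (\<Sum>k<b 1. mp_const (c k) * D k l)" if ij: "{i, j} \<in> E" for i j
  proof -
    have ijV: "i \<in> V" "j \<in> V" using edgeD[OF ij] by auto
    have rV: "r i j \<in> ?F 0" unfolding r_def
      by (intro vecs_diff vecs_smult eV) (use ijV in auto)
    have "comb (b 0) B (r i j) = relation i j"
      unfolding r_def by (simp add: comb_diff comb_smult Be[OF ijV(1)] Be[OF ijV(2)])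
    also have "relation i j \<in> edge_relations n E" by (rule relation_in_edge_relations[OF ij])
    finally have "\<epsilon> (r i j) = \<zero>\<^bsub>?M\<^esub>"
      using eps[OF rV] by (simp add: cls_eq_zero_iff zero_edge_module)
    then have "r i j \<in> \<phi> 0 ` ?F 1" using ker0 rV by blast
    then obtain h where h: "h \<in> ?F 1" "r i j = comb (b 1) D h" using phi0 by auto
    have hom: "homogeneous 1 (r i j l)" for l
      using homogeneous_mult[OF homogeneous_var homogeneous_const]
      by (auto simp: r_def e_def intro!: homogeneous_diff)
    have "r i j l = (\<Sum>k<b 1. mp_const (lookup (h k) 0) * D k l)" for l
      by (rule lowest_degree_part[OF _ hom]) (use h D(2) in \<open>auto simp: comb_def\<close>)
    then show ?thesis by (intro exI[of _ "\<lambda>k. lookup (h k) 0"]) simp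
  qed
  define c where "c i j = (SOME c. \<forall>l. r i j l = (\<Sum>k<b 1. mp_const (c k) * D k l))" for i j
  have c: "r i j l = (\<Sum>k<b 1. mp_const (c i j k) * D k l)" if "{i, j} \<in> E" for i j l
    using someI_ex[OF lift[OF that]] unfolding c_def by blast
  have lift': "\<exists>x. edge_form (\<lambda>p q. mp_const (x p q)) \<and> boundary (\<lambda>p q. mp_const (x p q)) = comb (b 0) B (D k)"
    if k: "k < b 1" for k
  proof -
    have "D k \<in> \<phi> 0 ` ?F 1" unfolding D_def by (rule imageI) (use k in \<open>auto intro: vecs_basis_vec\<close>)
    then have "\<epsilon> (D k) = \<zero>\<^bsub>?M\<^esub>" using ker0 by blast
    then have "comb (b 0) B (D k) \<in> edge_relations n E"
      using eps D(1)[OF k] by (simp add: cls_eq_zero_iff zero_edge_module)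
    then obtain \<theta> where \<theta>: "edge_form \<theta>" "comb (b 0) B (D k) = boundary \<theta>"
      unfolding edge_relations_eq by blast
    let ?x = "\<lambda>p q. lookup (\<theta> p q) 0"
    have "edge_form (\<lambda>p q. mp_const (?x p q))"
    proof (rule edge_formI)
      show "mp_const (?x q p) = - mp_const (?x p q)" for p q
        by (subst edge_form_anti[OF \<theta>(1)]) (simp add: mp_const_uminus)
    qed (simp_all add: edge_form_zero[OF \<theta>(1)])
    moreover have "comb (b 0) B (D k) l = boundary (\<lambda>p q. mp_const (?x p q)) l" for l
    proof -
      have "homogeneous (1 + 0) (comb (b 0) B (D k) l)"
        unfolding comb_def using B(2) D(2)[OF k] d by (intro homogeneous_sum homogeneous_mult) auto
      then have hom: "homogeneous 1 (comb (b 0) B (D k) l)" by simp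
      have "comb (b 0) B (D k) l = (\<Sum>p\<in>V. mp_const (?x p l) * mp_var p)"
        by (rule lowest_degree_part[OF _ hom]) (auto simp: \<theta>(2) boundary_def mult.commute)
      then show ?thesis by (simp add: boundary_def mult.commute)
    qed
    ultimately show ?thesis by (intro exI[of _ ?x]) auto
  qed
  define x :: "nat \<Rightarrow> nat \<Rightarrow> nat \<Rightarrow> 'k" where "x k = (SOME x. edge_form (\<lambda>p q. mp_const (x p q)) \<and>
      boundary (\<lambda>p q. mp_const (x p q)) = comb (b 0) B (D k))" for k
  have x: "edge_form (\<lambda>p q. mp_const (x k p q))"
    "boundary (\<lambda>p q. mp_const (x k p q)) = comb (b 0) B (D k)" if "k < b 1" for k
    using someI_ex[OF lift'[OF that]] unfolding x_def by blast+
  define \<eta> :: "nat \<Rightarrow> nat \<Rightarrow> nat \<Rightarrow> (nat, 'k) mpoly" where "\<eta> k = (\<lambda>p q. mp_const (x k p q))" for k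
  have \<eta>: "edge_form (\<eta> k)" "boundary (\<eta> k) = comb (b 0) B (D k)" if "k < b 1" for k
    using x that by (auto simp: \<eta>_def)
  have c\<eta>: "(\<Sum>k<b 1. mp_const (c i j k) * \<eta> k p q) = elementary i j p q" if ij: "{i, j} \<in> E" for i j p q
  proof -
    have ijV: "i \<in> V" "j \<in> V" using edgeD[OF ij] by auto
    let ?X = "\<lambda>p q. \<Sum>k<b 1. mp_const (c i j k) * \<eta> k p q"
    let ?x = "\<lambda>p q. \<Sum>k<b 1. c i j k * x k p q"
    let ?el = "\<lambda>p q. if p = i \<and> q = j then 1 else if p = j \<and> q = i then - 1 else 0 :: 'k"
    have X: "?X = (\<lambda>p q. mp_const (?x p q))" by (simp add: \<eta>_def mp_const_mult mp_const_sum)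
    have el: "elementary i j = (\<lambda>p q. mp_const (?el p q))" by (auto simp: fun_eq_iff mp_const_uminus)
    have form: "edge_form ?X" by (intro edge_form_sum edge_form_smult \<eta>) auto
    have "boundary ?X = (\<lambda>l. \<Sum>k<b 1. mp_const (c i j k) * comb (b 0) B (D k) l)"
      unfolding boundary_sum boundary_smult by (intro ext sum.cong refl) (simp add: \<eta>)
    also have "\<dots> = comb (b 0) B (\<lambda>l. \<Sum>k<b 1. mp_const (c i j k) * D k l)"
    proof
      fix l
      show "(\<Sum>k<b 1. mp_const (c i j k) * comb (b 0) B (D k) l) =
          comb (b 0) B (\<lambda>l. \<Sum>k<b 1. mp_const (c i j k) * D k l) l"
        unfolding comb_def sum_distrib_left sum_distrib_right
        by (subst sum.swap) (simp add: mult.assoc)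
    qed
    also have "(\<lambda>l. \<Sum>k<b 1. mp_const (c i j k) * D k l) = r i j" using c[OF ij] by auto
    also have "comb (b 0) B (r i j) = relation i j"
      unfolding r_def by (simp add: comb_diff comb_smult Be[OF ijV(1)] Be[OF ijV(2)])
    finally have "boundary ?X = relation i j" .
    from this boundary_elementary(2)[OF ij, symmetric] have eq: "boundary ?X = boundary (elementary i j)"
      by (rule trans)
    show ?thesis
    proof (cases "p \<in> V")
      case True
      have "?x p q = ?el p q"
        using arg_cong[OF fun_cong[OF eq, of q], of "\<lambda>h. lookup h (single p 1)"]
        unfolding X el lookup_boundary_const[OF True] .
      then show ?thesis using fun_cong[OF fun_cong[OF X], of p q] fun_cong[OF fun_cong[OF el], of p q] by simp
    next
      case False
      then have "{p, q} \<notin> E" using edgeD by blast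
      then show ?thesis using edge_form_zero[OF form, of p q] edge_form_zero[OF boundary_elementary(1)[OF ij], of p q]
        by simp
    qed
  qed
  (* the given syzygy, lifted to the resolution *)
  let ?P = "{(i, j). i \<in> V \<and> j \<in> V \<and> i < j \<and> {i, j} \<in> E}"
  have finP: "finite ?P" by (rule finite_subset[of _ "V \<times> V"]) auto
  have PE: "{fst p, snd p} \<in> E" if "p \<in> ?P" for p using that by auto
  define y where "y = (\<lambda>k. if k < b 1 then \<Sum>p\<in>?P. \<zeta> (fst p) (snd p) * mp_const (c (fst p) (snd p) k) else 0)"
  have yV: "y \<in> ?F 1"
    using edge_form_PV[OF \<zeta>(1)] by (auto simp: y_def vecs_def intro!: PV_sum)
  have bd: "boundary \<zeta> t = (\<Sum>p\<in>?P. \<zeta> (fst p) (snd p) * relation (fst p) (snd p) t)" for t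
    unfolding boundary_eq_sum_relations[OF \<zeta>(1)] by (intro sum.cong refl) (simp only: case_prod_beta)
  have "comb (b 1) D y = (\<lambda>_. 0)"
  proof
    fix l
    have "comb (b 1) D y l = (\<Sum>p\<in>?P. \<zeta> (fst p) (snd p) * (\<Sum>k<b 1. mp_const (c (fst p) (snd p) k) * D k l))"
      unfolding comb_def y_def by (simp add: sum_distrib_right sum_distrib_left mult.assoc) (subst sum.swap, rule refl)
    also have "\<dots> = (\<Sum>p\<in>?P. \<zeta> (fst p) (snd p) * r (fst p) (snd p) l)"
      by (intro sum.cong refl) (use c PE in simp)
    also have "\<dots> = (\<Sum>p\<in>?P. \<zeta> (fst p) (snd p) * (\<Sum>t\<in>V. relation (fst p) (snd p) t * e t l))"
    proof (intro sum.cong refl)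
      fix p assume "p \<in> ?P"
      then have pV: "fst p \<in> V" "snd p \<in> V" by auto
      have "(\<Sum>t\<in>V. basis_vec k t * e t l) = e k l" if "k \<in> V" for k
        using that by (simp add: basis_vec_def if_distrib[of "\<lambda>x. x * _"] sum.delta cong: if_cong)
      with pV show "\<zeta> (fst p) (snd p) * r (fst p) (snd p) l
          = \<zeta> (fst p) (snd p) * (\<Sum>t\<in>V. relation (fst p) (snd p) t * e t l)"
        by (simp add: r_def left_diff_distrib sum_subtractf mult.assoc sum_distrib_left[symmetric])
    qed
    also have "\<dots> = (\<Sum>t\<in>V. boundary \<zeta> t * e t l)"
      unfolding bd sum_distrib_left sum_distrib_right by (subst sum.swap) (simp add: mult.assoc)
    finally show "comb (b 1) D y l = 0" by (simp add: \<zeta>(2))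
  qed
  then have "y \<in> \<phi> 1 ` ?F 2" using ker1 yV phi0 by auto
  then obtain s where s: "s \<in> ?F 2" "y = comb (b 2) Q s" using phi1 by auto
  define lam where "lam t = (\<lambda>p q. \<Sum>k<b 1. Q t k * \<eta> k p q)" for t
  show ?thesis
  proof (rule that[of "b 2" lam s])
    fix t assume t: "t < b 2"
    show "edge_form (lam t)"
      unfolding lam_def by (intro edge_form_sum edge_form_smult \<eta>) (use vecs_PV[OF Q(1)[OF t]] in auto)
    have "homogeneous (1 + 0) (lam t p q)" for p q
      unfolding lam_def \<eta>_def by (intro homogeneous_sum homogeneous_mult Q(2) t homogeneous_const)
    then show "homogeneous 1 (lam t p q)" for p q by simp
    have "Q t \<in> \<phi> 1 ` ?F 2" unfolding Q_def by (rule imageI) (use t in \<open>auto intro: vecs_basis_vec\<close>)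
    then have "\<phi> 0 (Q t) = (\<lambda>_. 0)" using ker1 by blast
    then have "comb (b 1) D (Q t) = (\<lambda>_. 0)" using phi0[OF Q(1)[OF t]] by simp
    moreover have "boundary (lam t) l = comb (b 0) B (comb (b 1) D (Q t)) l" for l
    proof -
      have "boundary (lam t) l = (\<Sum>k<b 1. Q t k * comb (b 0) B (D k) l)"
        unfolding lam_def boundary_sum boundary_smult by (intro sum.cong refl) (simp add: \<eta>)
      also have "\<dots> = comb (b 0) B (comb (b 1) D (Q t)) l"
        unfolding comb_def sum_distrib_left sum_distrib_right by (subst sum.swap) (simp add: mult.assoc)
      finally show ?thesis .
    qed
    ultimately show "boundary (lam t) = (\<lambda>_. 0)" by (auto simp: comb_def)
  next
    fix p q
    have "(\<Sum>t<b 2. s t * lam t p q) = (\<Sum>k<b 1. y k * \<eta> k p q)"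
      unfolding lam_def s(2) comb_def sum_distrib_left sum_distrib_right
      by (subst sum.swap) (simp add: mult.assoc)
    also have "\<dots> = (\<Sum>e\<in>?P. \<zeta> (fst e) (snd e) * (\<Sum>k<b 1. mp_const (c (fst e) (snd e) k) * \<eta> k p q))"
      unfolding y_def by (simp add: sum_distrib_right sum_distrib_left mult.assoc) (subst sum.swap, rule refl)
    also have "\<dots> = (\<Sum>e\<in>?P. \<zeta> (fst e) (snd e) * elementary (fst e) (snd e) p q)"
      by (intro sum.cong refl) (use c\<eta> PE in simp)
    also have "\<dots> = \<zeta> p q"
    proof -
      have neutral: "(\<Sum>e\<in>?P. \<zeta> (fst e) (snd e) * elementary (fst e) (snd e) p q)
        = (\<Sum>e\<in>?P \<inter> {(p, q), (q, p)}. \<zeta> (fst e) (snd e) * elementary (fst e) (snd e) p q)"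
      proof (rule sum.mono_neutral_right[OF finP])
        show "?P \<inter> {(p, q), (q, p)} \<subseteq> ?P" by (rule Int_lower1)
        show "\<forall>e\<in>?P - ?P \<inter> {(p, q), (q, p)}. \<zeta> (fst e) (snd e) * elementary (fst e) (snd e) p q = 0"
        proof
          fix e assume "e \<in> ?P - ?P \<inter> {(p, q), (q, p)}"
          then have "e \<noteq> (p, q)" "e \<noteq> (q, p)" by blast+
          then have "\<not> (p = fst e \<and> q = snd e)" "\<not> (p = snd e \<and> q = fst e)" by (auto simp: prod_eq_iff)
          then show "\<zeta> (fst e) (snd e) * elementary (fst e) (snd e) p q = 0" by (simp only: if_False mult_zero_right)
        qed
      qed
      have zz: "\<zeta> p q = 0" if "{p, q} \<notin> E" using edge_form_zero[OF \<zeta>(1) that] .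
      consider "{p, q} \<notin> E" | "{p, q} \<in> E" "p < q" | "{p, q} \<in> E" "q < p"
        using edgeD[of p q] by (metis linorder_less_linear)
      then show ?thesis
      proof cases
        case 1
        then have "?P \<inter> {(p, q), (q, p)} = {}" by (auto simp: insert_commute)
        then show ?thesis unfolding neutral using zz 1 by simp
      next
        case 2
        then have "?P \<inter> {(p, q), (q, p)} = {(p, q)}" using edgeD[OF 2(1)] by auto
        then show ?thesis unfolding neutral by simp
      next
        case 3
        then have "?P \<inter> {(p, q), (q, p)} = {(q, p)}" using edgeD[OF 3(1)] by (auto simp: insert_commute)
        then show ?thesis unfolding neutral using 3 edge_form_anti[OF \<zeta>(1), of q p] by simp
      qed
    qed
    finally show "\<zeta> p q = (\<Sum>t<b 2. s t * lam t p q)" by simp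
  qed
qed

end

section \<open>Induced cycles obstruct linear resolutions\<close>

context edge_graph
begin

text \<open>Used for the flow around a cycle: every vertex is entered as often as it is left.\<close>
lemma sum_cyclic_shift:
  fixes f :: "nat \<Rightarrow> 'a::comm_monoid_add"
  shows "(\<Sum>k<l. f (Suc k mod l)) = (\<Sum>k<l. f k)"
proof (cases l)
  case (Suc m)
  have "(\<Sum>k<l. f (Suc k mod l)) = (\<Sum>k<m. f (Suc k)) + f 0"
    by (simp add: Suc)
  also have "\<dots> = (\<Sum>k<l. f k)"
    unfolding Suc sum.lessThan_Suc_shift by (simp add: add.commute)
  finally show ?thesis .
qed simp

lemma induced_cycle_adjacent:
  assumes "induced_cycle n E vs" "i < length vs" "j < length vs" "i \<noteq> j"
  shows "{vs ! i, vs ! j} \<in> E \<longleftrightarrow>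
    j = Suc i \<or> i = Suc j \<or> i = 0 \<and> Suc j = length vs \<or> j = 0 \<and> Suc i = length vs"
proof (cases "i < j")
  case True
  then have "{vs ! i, vs ! j} \<in> E \<longleftrightarrow> j = Suc i \<or> i = 0 \<and> Suc j = length vs"
    using assms unfolding induced_cycle_def by blast
  with True show ?thesis by auto
next
  case False
  then have "j < i" using assms(4) by simp
  then have "{vs ! j, vs ! i} \<in> E \<longleftrightarrow> i = Suc j \<or> j = 0 \<and> Suc i = length vs"
    using assms unfolding induced_cycle_def by blast
  moreover have "{vs ! i, vs ! j} = {vs ! j, vs ! i}" by (rule insert_commute)
  ultimately show ?thesis using False assms(4) by auto
qed

text \<open>Three pairwise adjacent positions on a cycle force its length to be three.\<close>
lemma induced_cycle_triangle_free:
  assumes cyc: "induced_cycle n E vs" "4 \<le> length vs" and "p \<in> set vs" "q \<in> set vs" "c \<in> set vs"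
    and E: "{p, q} \<in> E" "{q, c} \<in> E" "{p, c} \<in> E"
  shows False
proof -
  obtain i j k where ijk: "i < length vs" "j < length vs" "k < length vs" "p = vs ! i" "q = vs ! j" "c = vs ! k"
    using assms by (metis in_set_conv_nth)
  have ne: "i \<noteq> j" "j \<noteq> k" "i \<noteq> k" using edgeD[OF E(1)] edgeD[OF E(2)] edgeD[OF E(3)] ijk by auto
  have "j = Suc i \<or> i = Suc j \<or> i = 0 \<and> Suc j = length vs \<or> j = 0 \<and> Suc i = length vs"
    using induced_cycle_adjacent[OF cyc(1) ijk(1,2) ne(1)] E(1) ijk by blast
  moreover have "k = Suc j \<or> j = Suc k \<or> j = 0 \<and> Suc k = length vs \<or> k = 0 \<and> Suc j = length vs"
    using induced_cycle_adjacent[OF cyc(1) ijk(2,3) ne(2)] E(2) ijk by blast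
  moreover have "k = Suc i \<or> i = Suc k \<or> i = 0 \<and> Suc k = length vs \<or> k = 0 \<and> Suc i = length vs"
    using induced_cycle_adjacent[OF cyc(1) ijk(1,3) ne(3)] E(3) ijk by blast
  ultimately show False using cyc(2) ne by linarith
qed

text \<open>Look at the coefficient of \<open>x\<^sub>p x\<^sub>c\<close> in \<open>\<Sum>\<^sub>i x\<^sub>i lam i q = 0\<close>: only \<open>i = p\<close> and \<open>i = c\<close> can contribute, and \<open>lam c q\<close>
vanishes.\<close>
lemma linear_syzygy_coefficient:
  fixes lam :: "nat \<Rightarrow> nat \<Rightarrow> (nat, 'k::comm_ring_1) mpoly"
  assumes form: "edge_form lam" and bd: "boundary lam = (\<lambda>_. 0)"
    and V: "p \<in> V" "c \<in> V" and nonadj: "{c, q} \<notin> E"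
  shows "lookup (lam p q) (single c 1) = 0"
proof -
  let ?m = "single p 1 + single c 1 :: nat \<Rightarrow>\<^sub>0 nat"
  have minus: "?m - single p 1 = single c 1" "?m - single c 1 = single p 1" by simp_all
  have "0 = lookup (boundary lam q) ?m" by (simp add: bd)
  also have "\<dots> = (\<Sum>i\<in>V. if 0 < lookup ?m i then lookup (lam i q) (?m - single i 1) else 0)"
    by (simp add: boundary_def lookup_sum lookup_mult_var)
  also have "\<dots> = (\<Sum>i\<in>{p, c}. if 0 < lookup ?m i then lookup (lam i q) (?m - single i 1) else 0)"
    by (rule sum.mono_neutral_right) (use V in \<open>auto simp: lookup_add lookup_single when_def\<close>)
  also have "\<dots> = lookup (lam p q) (single c 1)"
  proof (cases "p = c")
    case True
    then show ?thesis using minus by (simp add: lookup_add)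
  next
    case False
    have "lam c q = 0" using edge_form_zero[OF form nonadj] .
    with False show ?thesis using minus by (simp add: lookup_add)
  qed
  finally show ?thesis by simp
qed

text \<open>By the preceding lemma and antisymmetry, a variable \<open>x\<^sub>c\<close> can occur in \<open>lam p q\<close> only if \<open>c\<close> is adjacent to both
\<open>p\<close> and \<open>q\<close>. On an induced cycle of length at least four no such \<open>c\<close> exists.\<close>
lemma linear_syzygy_outside_cycle:
  fixes lam :: "nat \<Rightarrow> nat \<Rightarrow> (nat, 'k::comm_ring_1) mpoly"
  assumes cyc: "induced_cycle n E vs" "4 \<le> length vs" and pq: "p \<in> set vs" "q \<in> set vs"
    and form: "edge_form lam" and bd: "boundary lam = (\<lambda>_. 0)" and hom: "homogeneous 1 (lam p q)"
  shows "lam p q \<in> var_ideal (- set vs)"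
proof (cases "{p, q} \<in> E")
  case False
  then show ?thesis using edge_form_zero[OF form] by (simp add: var_ideal_def)
next
  case True
  have vsV: "set vs \<subseteq> V" using cyc by (simp add: induced_cycle_def)
  show ?thesis
    unfolding var_ideal_def
  proof (intro CollectI ballI)
    fix m assume m: "m \<in> keys (lam p q)"
    then have "int (mon_deg m) = 1" using hom unfolding homogeneous_def by blast
    then have "mon_deg m = Suc 0" by simp
    then obtain c where c: "m = single c 1" using mon_deg_eq_1 by blast
    have "c \<notin> set vs"
    proof
      assume cW: "c \<in> set vs"
      then have cV: "c \<in> V" and pV: "p \<in> V" and qV: "q \<in> V" using vsV pq by auto
      have nz: "lookup (lam p q) (single c 1) \<noteq> 0" using m c by (simp add: in_keys_iff)
      have "{c, q} \<in> E" using linear_syzygy_coefficient[OF form bd pV cV] nz by blast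
      moreover have "{c, p} \<in> E"
      proof (rule ccontr)
        assume "{c, p} \<notin> E"
        from linear_syzygy_coefficient[OF form bd qV cV this]
        have "lookup (lam p q) (single c 1) = 0" by (subst edge_form_anti[OF form]) simp
        with nz show False by simp
      qed
      ultimately show False
        using induced_cycle_triangle_free[OF cyc pq cW True] by (simp add: insert_commute)
    qed
    then show "\<exists>a\<in>- set vs. 0 < lookup m a" using c by (intro bexI[of _ c]) auto
  qed
qed

text \<open>Going once around an induced cycle gives an integral flow \<open>\<sigma>\<close> on the edges. Multiplying its value at \<open>{p, q}\<close>
with the product of the other variables of the cycle gives a syzygy \<open>\<zeta>\<close>: all terms of its boundary at \<open>q\<close>
become the same monomial, with coefficients adding up to the net flow at \<open>q\<close>. If linear syzygies
generated, \<open>\<zeta>\<close> would have coefficients in the ideal of the variables outside the cycle, but they are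
nonzero monomials in the variables of the cycle.\<close>
theorem linear_resolution_chordal:
  assumes lin: "has_linear_resolution V (edge_mod :: ((nat, 'k::field) mpoly, (nat \<Rightarrow> (nat, 'k) mpoly) set) graded_module)"
  shows "chordal n E"
  unfolding chordal_def
proof
  assume "\<exists>vs. induced_cycle n E vs \<and> 4 \<le> length vs"
  then obtain vs where cyc: "induced_cycle n E vs" "4 \<le> length vs" by blast
  let ?l = "length vs"
  let ?W = "set vs"
  have dist: "distinct vs" and WV: "?W \<subseteq> V" using cyc by (auto simp: induced_cycle_def)
  let ?s = "\<lambda>k. vs ! (Suc k mod ?l)"
  have l: "0 < ?l" using cyc(2) by linarith
  have sW: "?s k \<in> ?W" for k using l by (intro nth_mem) simp
  have edge: "{vs ! k, ?s k} \<in> E" if "k < ?l" for k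
  proof (cases "Suc k = ?l")
    case True
    then show ?thesis using induced_cycle_adjacent[OF cyc(1) that l] cyc(2) by auto
  next
    case False
    then have "Suc k < ?l" using that by simp
    then show ?thesis using induced_cycle_adjacent[OF cyc(1) that, of "Suc k"] by simp
  qed
  \<comment> \<open>One unit along every oriented edge of the cycle, and minus one unit in the opposite direction.\<close>
  define \<sigma> :: "nat \<Rightarrow> nat \<Rightarrow> 'k" where
    "\<sigma> p q = (\<Sum>k<?l. of_bool (vs ! k = p \<and> ?s k = q) - of_bool (vs ! k = q \<and> ?s k = p))" for p q
  have \<sigma>_anti: "\<sigma> q p = - \<sigma> p q" for p q
    unfolding \<sigma>_def sum_negf[symmetric] by (intro sum.cong refl) simp
  have \<sigma>_zero: "\<sigma> p q = 0" if "{p, q} \<notin> E" for p q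
    unfolding \<sigma>_def
  proof (intro sum.neutral ballI)
    fix k assume "k \<in> {..<?l}"
    then have "{vs ! k, ?s k} \<in> E" using edge by simp
    with that have "\<not> (vs ! k = p \<and> ?s k = q)" "\<not> (vs ! k = q \<and> ?s k = p)"
      by (auto simp: insert_commute)
    then show "of_bool (vs ! k = p \<and> ?s k = q) - of_bool (vs ! k = q \<and> ?s k = p) = (0 :: 'k)"
      by (simp only: of_bool_eq(1) diff_self)
  qed
  have \<sigma>_W: "\<sigma> p q = 0" if "p \<notin> ?W \<or> q \<notin> ?W" for p q
    unfolding \<sigma>_def
  proof (intro sum.neutral ballI)
    fix k assume "k \<in> {..<?l}"
    then have "vs ! k \<in> ?W" by simp
    with that sW[of k] have "\<not> (vs ! k = p \<and> ?s k = q)" "\<not> (vs ! k = q \<and> ?s k = p)" by blast+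
    then show "of_bool (vs ! k = p \<and> ?s k = q) - of_bool (vs ! k = q \<and> ?s k = p) = (0 :: 'k)"
      by (simp only: of_bool_eq(1) diff_self)
  qed
  have \<sigma>_flow: "(\<Sum>p\<in>V. \<sigma> p q) = 0" for q
  proof -
    have one: "(\<Sum>p\<in>V. of_bool (x = p \<and> P)) = (of_bool P :: 'k)" if "x \<in> V" for x P
      using that by (cases P) (simp_all add: of_bool_def sum.delta)
    have one': "(\<Sum>p\<in>V. of_bool (P \<and> x = p)) = (of_bool P :: 'k)" if "x \<in> V" for x P
      using that by (cases P) (simp_all add: of_bool_def sum.delta)
    have "(\<Sum>p\<in>V. \<sigma> p q) =
        (\<Sum>k<?l. (\<Sum>p\<in>V. of_bool (vs ! k = p \<and> ?s k = q)) - (\<Sum>p\<in>V. of_bool (vs ! k = q \<and> ?s k = p)))"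
      unfolding \<sigma>_def by (subst sum.swap) (simp only: sum_subtractf)
    also have "\<dots> = (\<Sum>k<?l. of_bool (?s k = q) - of_bool (vs ! k = q))"
    proof (intro sum.cong refl)
      fix k assume "k \<in> {..<?l}"
      then have "vs ! k \<in> V" "?s k \<in> V" using WV sW[of k] nth_mem by blast+
      then show "(\<Sum>p\<in>V. of_bool (vs ! k = p \<and> ?s k = q)) - (\<Sum>p\<in>V. of_bool (vs ! k = q \<and> ?s k = p))
          = (of_bool (?s k = q) - of_bool (vs ! k = q) :: 'k)"
        by (simp only: one one')
    qed
    also have "\<dots> = 0"
      unfolding sum_subtractf using sum_cyclic_shift[of "\<lambda>k. of_bool (vs ! k = q) :: 'k" ?l] by simp
    finally show ?thesis .
  qed
  define \<zeta> :: "nat \<Rightarrow> nat \<Rightarrow> (nat, 'k) mpoly" where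
    "\<zeta> p q = mp_const (\<sigma> p q) * (\<Prod>v\<in>?W - {p, q}. mp_var v)" for p q
  have prodV: "(\<Prod>v\<in>X. mp_var v) \<in> PV V" if "X \<subseteq> V" for X
    using that by (induction X rule: infinite_finite_induct) auto
  have form: "edge_form \<zeta>"
  proof (rule edge_formI)
    show "\<zeta> p q \<in> PV V" for p q
      unfolding \<zeta>_def using WV by (intro PV_mult PV_const prodV) auto
    show "\<zeta> q p = - \<zeta> p q" for p q
      unfolding \<zeta>_def by (subst \<sigma>_anti) (simp add: mp_const_uminus insert_commute)
    show "\<zeta> p q = 0" if "{p, q} \<notin> E" for p q
      using \<sigma>_zero[OF that] by (simp add: \<zeta>_def)
  qed
  have bd: "boundary \<zeta> = (\<lambda>_. 0)"
  proof
    fix q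
    have "mp_var p * \<zeta> p q = mp_const (\<sigma> p q) * (\<Prod>v\<in>?W - {q}. mp_var v)" for p
    proof (cases "\<sigma> p q = 0")
      case False
      have "{p, q} \<in> E" using False \<sigma>_zero by blast
      then have "p \<noteq> q" using edgeD by blast
      moreover have "p \<in> ?W" using False \<sigma>_W by blast
      ultimately have *: "?W - {q} = insert p (?W - {p, q})" "p \<notin> ?W - {p, q}" by auto
      show ?thesis unfolding *(1) \<zeta>_def by (simp add: mult_ac)
    qed (simp add: \<zeta>_def)
    then have "boundary \<zeta> q = mp_const (\<Sum>p\<in>V. \<sigma> p q) * (\<Prod>v\<in>?W - {q}. mp_var v)"
      by (simp add: boundary_def mp_const_sum sum_distrib_right)
    then show "boundary \<zeta> q = 0" by (simp only: \<sigma>_flow) simp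
  qed
  let ?p = "vs ! 0" and ?q = "vs ! 1"
  have pqW: "?p \<in> ?W" "?q \<in> ?W" using cyc(2) by (auto intro!: nth_mem)
  have "\<sigma> ?p ?q = (\<Sum>k<?l. if k = 0 then 1 else 0)"
    unfolding \<sigma>_def
  proof (intro sum.cong refl)
    fix k assume "k \<in> {..<?l}"
    then have k: "k < ?l" by simp
    have eq: "vs ! i = vs ! j \<longleftrightarrow> i = j" if "i < ?l" "j < ?l" for i j
      using nth_eq_iff_index_eq[OF dist that] .
    have 1: "vs ! k = ?p \<longleftrightarrow> k = 0" "vs ! k = ?q \<longleftrightarrow> k = 1" "?s k = ?q \<longleftrightarrow> Suc k mod ?l = 1"
      "?s k = ?p \<longleftrightarrow> Suc k mod ?l = 0"
      using k cyc(2) l by (auto intro!: eq)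
    have 2: "Suc 0 mod ?l = 1" "Suc 1 mod ?l = 2" using cyc(2) by (auto simp: One_nat_def)
    show "of_bool (vs ! k = ?p \<and> ?s k = ?q) - of_bool (vs ! k = ?q \<and> ?s k = ?p) = (if k = 0 then 1 else 0 :: 'k)"
      unfolding 1 using 2 by auto
  qed
  then have "\<sigma> ?p ?q = 1" using l by (simp add: sum.delta)
  then have "\<zeta> ?p ?q = (\<Prod>v\<in>?W - {?p, ?q}. mp_var v)" by (simp add: \<zeta>_def)
  moreover have "mp_var v \<noteq> (0 :: (nat, 'k) mpoly)" for v :: nat
    by (metis mp_var_def lookup_single_eq lookup_zero zero_neq_one)
  ultimately have nonzero: "\<zeta> ?p ?q \<noteq> 0" by simp
  have "?p \<in> V" using pqW WV by blast
  obtain m :: nat and s lam where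
    lam: "\<And>t. t < m \<Longrightarrow> edge_form (lam t)" "\<And>t. t < m \<Longrightarrow> boundary (lam t) = (\<lambda>_. 0)"
    "\<And>t p q. t < m \<Longrightarrow> homogeneous 1 (lam t p q)" "\<And>p q. \<zeta> p q = (\<Sum>t<m. s t * lam t p q)"
    by (rule linear_syzygies_generate[OF lin \<open>?p \<in> V\<close> form bd]) (rule that)
  have "lam t ?p ?q \<in> var_ideal (- ?W)" if "t < m" for t
    by (rule linear_syzygy_outside_cycle[OF cyc pqW lam(1,2,3)[OF that]])
  then have "\<zeta> ?p ?q \<in> var_ideal (- ?W)"
    unfolding lam(4) by (intro var_ideal_sum var_ideal_multiple) auto
  moreover have "(\<Prod>v\<in>X. mp_var v) \<in> (PV ?W :: (nat, 'k) mpoly set)" if "X \<subseteq> ?W" for X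
    using that by (induction X rule: infinite_finite_induct) auto
  then have "\<zeta> ?p ?q \<in> PV ?W" unfolding \<zeta>_def by (intro PV_mult PV_const) blast
  ultimately have contra: False if \<mu>: "\<mu> \<in> keys (\<zeta> ?p ?q)" for \<mu>
  proof -
    have "\<exists>a\<in>- ?W. 0 < lookup \<mu> a"
      using \<open>\<zeta> ?p ?q \<in> var_ideal (- ?W)\<close> \<mu> by (simp add: var_ideal_def)
    moreover have "keys \<mu> \<subseteq> ?W"
      using \<open>\<zeta> ?p ?q \<in> PV ?W\<close> \<mu> by (auto simp: PV_def monomials_def)
    ultimately show False by (metis ComplD gr_implies_not0 in_keys_iff subsetD)
  qed
  then have "keys (\<zeta> ?p ?q) = {}" by blast
  with nonzero show False by simp
qed

end

section \<open>Monomials modulo exchanges along edges\<close>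

text \<open>A monomial in \<open>x\<close> and \<open>y\<close> is a pair of a monomial in \<open>x\<close> and one in \<open>y\<close>, which are recovered by \<open>xpart\<close> and \<open>ypart\<close>.\<close>
lift_definition join :: "('a \<Rightarrow>\<^sub>0 nat) \<Rightarrow> ('b \<Rightarrow>\<^sub>0 nat) \<Rightarrow> ('a + 'b \<Rightarrow>\<^sub>0 nat)"
  is "\<lambda>u w. case_sum u w"
proof -
  fix u :: "'a \<Rightarrow> nat" and w :: "'b \<Rightarrow> nat"
  assume "finite {k. u k \<noteq> 0}" "finite {k. w k \<noteq> 0}"
  then have "finite (Inl ` {k. u k \<noteq> 0} \<union> Inr ` {k. w k \<noteq> 0})" by simp
  moreover have "{k. case_sum u w k \<noteq> 0} \<subseteq> Inl ` {k. u k \<noteq> 0} \<union> Inr ` {k. w k \<noteq> 0}"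
  proof
    fix k assume "k \<in> {k. case_sum u w k \<noteq> 0}"
    then show "k \<in> Inl ` {k. u k \<noteq> 0} \<union> Inr ` {k. w k \<noteq> 0}" by (cases k) auto
  qed
  ultimately show "finite {k. case_sum u w k \<noteq> 0}" by (rule finite_subset[rotated])
qed

definition xpart :: "('a + 'b \<Rightarrow>\<^sub>0 nat) \<Rightarrow> ('a \<Rightarrow>\<^sub>0 nat)" where
  "xpart m = Poly_Mapping.map_key Inl m"
definition ypart :: "('a + 'b \<Rightarrow>\<^sub>0 nat) \<Rightarrow> ('b \<Rightarrow>\<^sub>0 nat)" where
  "ypart m = Poly_Mapping.map_key Inr m"

lemma lookup_join [simp]: "lookup (join u w) (Inl i) = lookup u i" "lookup (join u w) (Inr j) = lookup w j"
  by (simp_all add: join.rep_eq)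
lemma lookup_xpart [simp]: "lookup (xpart m) i = lookup m (Inl i)"
  unfolding xpart_def by (subst map_key.rep_eq) (auto simp: inj_def)
lemma lookup_ypart [simp]: "lookup (ypart m) j = lookup m (Inr j)"
  unfolding ypart_def by (subst map_key.rep_eq) (auto simp: inj_def)

lemma sum_mon_eqI:
  fixes m m' :: "'a + 'b \<Rightarrow>\<^sub>0 'c::zero"
  assumes "\<And>i. lookup m (Inl i) = lookup m' (Inl i)" "\<And>j. lookup m (Inr j) = lookup m' (Inr j)"
  shows "m = m'"
proof (rule poly_mapping_eqI)
  fix k show "lookup m k = lookup m' k" by (cases k) (use assms in auto)
qed

lemma xpart_join [simp]: "xpart (join u w) = u" by (rule poly_mapping_eqI) simp
lemma ypart_join [simp]: "ypart (join u w) = w" by (rule poly_mapping_eqI) simp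
lemma join_parts [simp]: "join (xpart m) (ypart m) = m" by (rule sum_mon_eqI) auto
lemma join_add: "join (u + u') (w + w') = join u w + join u' w'"
  by (rule sum_mon_eqI) (auto simp: lookup_add)
lemma xpart_add: "xpart (m + m') = xpart m + xpart m'" by (rule poly_mapping_eqI) (simp add: lookup_add)
lemma ypart_add: "ypart (m + m') = ypart m + ypart m'" by (rule poly_mapping_eqI) (simp add: lookup_add)
lemma join_eq_iff: "join u w = m \<longleftrightarrow> u = xpart m \<and> w = ypart m" by auto
lemma join_0_0 [simp]: "join 0 0 = 0" by (rule sum_mon_eqI) auto
lemma ypart_0 [simp]: "ypart 0 = 0" by (rule poly_mapping_eqI) simp

abbreviation xm :: "nat \<Rightarrow> nat + nat \<Rightarrow>\<^sub>0 nat" where "xm i \<equiv> single (Inl i) 1"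
abbreviation ym :: "nat \<Rightarrow> nat + nat \<Rightarrow>\<^sub>0 nat" where "ym i \<equiv> single (Inr i) 1"

lemma xpart_single [simp]: "xpart (xm i) = single i 1" "xpart (ym i) = 0"
  by (rule poly_mapping_eqI; simp add: lookup_single when_def)+
lemma ypart_single [simp]: "ypart (xm i) = 0" "ypart (ym i) = single i 1"
  by (rule poly_mapping_eqI; simp add: lookup_single when_def)+

lemma monomials_iff: "m \<in> monomials W \<longleftrightarrow> (\<forall>k. lookup m k \<noteq> 0 \<longrightarrow> k \<in> W)"
  by (auto simp: monomials_def in_keys_iff)

lemma monomials_xy_iff: "m \<in> monomials (xy_vars n) \<longleftrightarrow> xpart m \<in> monomials {1..n} \<and> ypart m \<in> monomials {1..n}"
proof -
  have "Inl i \<in> xy_vars n \<longleftrightarrow> i \<in> {1..n}" "Inr i \<in> xy_vars n \<longleftrightarrow> i \<in> {1..n}" for i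
    by (auto simp: xy_vars_def)
  then show ?thesis unfolding monomials_iff split_sum_all lookup_xpart lookup_ypart by (simp only:)
qed

text \<open>The degree counting \<open>x\<^sub>i\<close> and \<open>y\<^sub>i\<close> together at each vertex \<open>i\<close>, which exchanges preserve.\<close>
definition multideg :: "(nat + nat \<Rightarrow>\<^sub>0 nat) \<Rightarrow> nat \<Rightarrow> nat" where
  "multideg m i = lookup m (Inl i) + lookup m (Inr i)"
definition support :: "(nat + nat \<Rightarrow>\<^sub>0 nat) \<Rightarrow> nat set" where
  "support m = {i. multideg m i \<noteq> 0}"

lemma finite_support [simp]: "finite (support m)"
proof -
  have "support m \<subseteq> keys (xpart m) \<union> keys (ypart m)"
    by (auto simp: support_def multideg_def in_keys_iff)
  then show ?thesis by (rule finite_subset) simp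
qed

lemma multideg_add: "multideg (m + m') i = multideg m i + multideg m' i"
  by (simp add: multideg_def lookup_add)
lemma multideg_single [simp]: "multideg (xm i) j = of_bool (i = j)" "multideg (ym i) j = of_bool (i = j)"
  by (auto simp: multideg_def lookup_single when_def)

lemma mon_split_single: "0 < lookup m v \<Longrightarrow> \<exists>t. m = t + single v (1::nat)"
  using mon_minus_single by metis

context edge_graph
begin

text \<open>The relation generated by exchanging an \<open>x\<close> and a \<open>y\<close> along an edge; the generators \<open>x\<^sub>i y\<^sub>j - x\<^sub>j y\<^sub>i\<close> of the
defining ideal identify exactly equivalent monomials.\<close>
inductive equivalent :: "(nat + nat \<Rightarrow>\<^sub>0 nat) \<Rightarrow> (nat + nat \<Rightarrow>\<^sub>0 nat) \<Rightarrow> bool" (infix "\<approx>" 50) where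
  refl: "m \<approx> m"
| step: "m \<approx> t + xm i + ym j \<Longrightarrow> {i, j} \<in> E \<Longrightarrow> m \<approx> t + xm j + ym i"

lemma equivalent_trans: "m \<approx> m' \<Longrightarrow> m' \<approx> m'' \<Longrightarrow> m \<approx> m''"
  by (rotate_tac, induction rule: equivalent.induct) (auto intro: equivalent.intros)

lemma equivalent_move: "{i, j} \<in> E \<Longrightarrow> t + xm i + ym j \<approx> t + xm j + ym i"
  by (rule equivalent.step[OF equivalent.refl])

lemma equivalent_sym: "m \<approx> m' \<Longrightarrow> m' \<approx> m"
proof (induction rule: equivalent.induct)
  case (step m t i j)
  have "t + xm j + ym i \<approx> t + xm i + ym j"
    using step by (intro equivalent_move) (simp add: insert_commute)
  then show ?case using step equivalent_trans by blast
qed (rule equivalent.refl)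

lemma equivalent_add: "m \<approx> m' \<Longrightarrow> t + m \<approx> t + m'"
proof (induction rule: equivalent.induct)
  case (step m t' i j)
  then have "t + m \<approx> (t + t') + xm i + ym j" by (simp add: add.assoc)
  from equivalent.step[OF this step(2)] show ?case by (simp add: add.assoc)
qed (rule equivalent.refl)

lemma equivalent_multideg: "m \<approx> m' \<Longrightarrow> multideg m' = multideg m"
proof (induction rule: equivalent.induct)
  case (step m t i j)
  have "multideg (t + xm j + ym i) = multideg (t + xm i + ym j)"
    by (auto simp: multideg_add fun_eq_iff)
  with step.IH show ?case by simp
qed simp

lemma equivalent_support: "m \<approx> m' \<Longrightarrow> support m' = support m"
  by (simp add: support_def equivalent_multideg)

lemma support_monomials: "m \<in> monomials (xy_vars n) \<longleftrightarrow> support m \<subseteq> V"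
proof -
  have "support m \<subseteq> V \<longleftrightarrow> (\<forall>k. lookup m (Inl k) + lookup m (Inr k) \<noteq> 0 \<longrightarrow> k \<in> V)"
    unfolding support_def multideg_def by blast
  then show ?thesis
    unfolding monomials_xy_iff
    unfolding monomials_iff lookup_xpart lookup_ypart add_is_0 by metis
qed

lemma equivalent_monomials: "m \<approx> m' \<Longrightarrow> m' \<in> monomials (xy_vars n) \<longleftrightarrow> m \<in> monomials (xy_vars n)"
  by (simp add: support_monomials equivalent_support)

text \<open>Induction along the path. Every vertex \<open>k\<close> before the last one carries an \<open>x\<close> or a \<open>y\<close>. If it carries a \<open>y\<close>,
first exchange \<open>x\<^sub>i\<close> with that \<open>y\<^sub>k\<close> by induction and then \<open>x\<^sub>k\<close> with \<open>y\<^sub>j\<close> along the last edge. If it carries an \<open>x\<close>,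
do these in the opposite order. The support does not change, so the path stays available.\<close>
lemma equivalent_swap:
  assumes "(i, j) \<in> (edges_in E (support (t + xm i + ym j)))\<^sup>*"
  shows "t + xm i + ym j \<approx> t + xm j + ym i"
proof -
  have "t + xm i + ym j \<approx> t + xm j + ym i"
    if "(i, j) \<in> (edges_in E D)\<^sup>*" "D = support (t + xm i + ym j)" for D
    using that
  proof (induction arbitrary: t rule: rtrancl_induct)
    case base
    show ?case by (rule equivalent.refl)
  next
    case (step k j)
    have kD: "k \<in> D" and kj: "{k, j} \<in> E" using step.hyps by (auto simp: edges_in_def)
    have "k \<noteq> j" using edgeD[OF kj] by blast
    show ?case
    proof (cases "k = i")
      case True
      then show ?thesis using equivalent_move kj by simp
    next
      case False
      then have "0 < lookup t (Inl k) \<or> 0 < lookup t (Inr k)"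
        using kD step.prems \<open>k \<noteq> j\<close> by (auto simp: support_def multideg_def lookup_add lookup_single)
      then consider t' where "t = t' + ym k" | t' where "t = t' + xm k"
        using mon_split_single[of t "Inl k"] mon_split_single[of t "Inr k"] by blast
      then show ?thesis
      proof cases
        case 1
        have "(t' + ym j) + xm i + ym k \<approx> (t' + ym j) + xm k + ym i"
          by (rule step.IH) (simp add: step.prems 1 add_ac)
        moreover have "(t' + ym i) + xm k + ym j \<approx> (t' + ym i) + xm j + ym k"
          by (rule equivalent_move[OF kj])
        ultimately show ?thesis using equivalent_trans by (simp add: 1 add_ac)
      next
        case 2
        have "(t' + xm i) + xm k + ym j \<approx> (t' + xm i) + xm j + ym k"
          by (rule equivalent_move[OF kj])
        moreover have "(t' + xm j) + xm i + ym k \<approx> (t' + xm j) + xm k + ym i"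
        proof (rule step.IH)
          have "multideg ((t' + xm j) + xm i + ym k) = multideg (t + xm i + ym j)"
            by (auto simp: 2 multideg_add fun_eq_iff)
          then show "D = support ((t' + xm j) + xm i + ym k)" by (simp add: step.prems support_def)
        qed
        ultimately show ?thesis using equivalent_trans by (simp add: 2 add_ac)
      qed
    qed
  qed
  with assms show ?thesis by blast
qed

text \<open>Exchanges along edges between vertices of the support stay inside its connected components, so the
number of \<open>x\<close>'s in each component is invariant.\<close>
lemma equivalent_component_sum:
  assumes "m \<approx> m'"
  shows "(\<Sum>k\<in>{k. (i, k) \<in> (edges_in E (support m))\<^sup>*} \<inter> support m. lookup m' (Inl k))
       = (\<Sum>k\<in>{k. (i, k) \<in> (edges_in E (support m))\<^sup>*} \<inter> support m. lookup m (Inl k))"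
  using assms
proof (induction rule: equivalent.induct)
  case (step m t p q)
  let ?D = "support m"
  let ?C = "{k. (i, k) \<in> (edges_in E ?D)\<^sup>*} \<inter> ?D"
  have supp: "?D = support (t + xm p + ym q)" using equivalent_support[OF step(1)] by simp
  have pq: "p \<in> ?D" "q \<in> ?D" unfolding supp by (simp_all add: support_def multideg_add)
  then have e: "(p, q) \<in> edges_in E ?D" "(q, p) \<in> edges_in E ?D"
    using step(2) by (auto simp: edges_in_def insert_commute)
  then have "p \<in> ?C \<longleftrightarrow> q \<in> ?C" using pq by (auto intro: rtrancl_into_rtrancl)
  moreover have "(\<Sum>k\<in>?C. lookup (xm a) (Inl k)) = of_bool (a \<in> ?C)" for a
    by (simp add: lookup_single when_def sum.delta)
  ultimately have "(\<Sum>k\<in>?C. lookup (t + xm q + ym p) (Inl k)) = (\<Sum>k\<in>?C. lookup (t + xm p + ym q) (Inl k))"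
    by (simp add: lookup_add sum.distrib lookup_single)
  with step.IH show ?case by simp
qed simp

text \<open>A bad monomial is one that is not in normal form: some \<open>x\<^sub>i\<close> and \<open>y\<^sub>j\<close> in it with \<open>i\<close> before \<open>j\<close> can be exchanged.\<close>
definition bad :: "(nat \<Rightarrow> nat) \<Rightarrow> (nat + nat \<Rightarrow>\<^sub>0 nat) \<Rightarrow> bool" where
  "bad \<rho> m \<longleftrightarrow> (\<exists>i j. \<rho> i < \<rho> j \<and> 0 < lookup m (Inl i) \<and> 0 < lookup m (Inr j) \<and>
     (i, j) \<in> (edges_in E (support m))\<^sup>*)"

text \<open>Consider the first vertex \<open>i\<close> at which the \<open>x\<close>-exponents differ, and let \<open>a\<close> be the monomial with more \<open>x\<^sub>i\<close>. As
\<open>a\<close> is not bad, it has no \<open>y\<^sub>k\<close> at any later vertex \<open>k\<close> of the component of \<open>i\<close>, so there it has as many \<open>x\<^sub>k\<close> as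
the multidegree permits. Hence \<open>a\<close> has more \<open>x\<close>'s in this component in total, contrary to invariance.\<close>
lemma nonbad_unique:
  assumes eq: "m \<approx> m'" and nb: "\<not> bad \<rho> m" "\<not> bad \<rho> m'" and inj: "inj_on \<rho> V"
    and mV: "m \<in> monomials (xy_vars n)"
  shows "m = m'"
proof (rule ccontr)
  assume ne: "m \<noteq> m'"
  let ?D = "support m"
  have D': "support m' = ?D" by (rule equivalent_support[OF eq])
  have md: "lookup m (Inl i) + lookup m (Inr i) = lookup m' (Inl i) + lookup m' (Inr i)" for i
    using fun_cong[OF equivalent_multideg[OF eq], of i] by (simp add: multideg_def)
  define X where "X = {i. lookup m (Inl i) \<noteq> lookup m' (Inl i)}"
  have XD: "X \<subseteq> ?D"
  proof
    fix k assume "k \<in> X"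
    then show "k \<in> ?D" using md[of k] by (auto simp: X_def support_def multideg_def)
  qed
  then have XV: "X \<subseteq> V" using mV by (simp add: support_monomials)
  have "X \<noteq> {}"
  proof
    assume "X = {}"
    then have 1: "lookup m (Inl i) = lookup m' (Inl i)" for i by (simp add: X_def)
    have 2: "lookup m (Inr i) = lookup m' (Inr i)" for i using 1[of i] md[of i] by simp
    from 1 2 have "m = m'" by (rule sum_mon_eqI)
    with ne show False ..
  qed
  then obtain i where i: "i \<in> X" and least: "\<And>k. k \<in> X \<Longrightarrow> \<rho> i \<le> \<rho> k"
    using ex_has_least_nat[of "\<lambda>i. i \<in> X" _ \<rho>] by blast
  let ?C = "{k. (i, k) \<in> (edges_in E ?D)\<^sup>*} \<inter> ?D"
  have sum_eq: "(\<Sum>k\<in>?C. lookup m' (Inl k)) = (\<Sum>k\<in>?C. lookup m (Inl k))"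
    by (rule equivalent_component_sum[OF eq])
  have no: False if gt: "lookup b (Inl i) < lookup a (Inl i)" and nb: "\<not> bad \<rho> a" and supp: "support a = ?D"
    and md: "\<And>k. lookup a (Inl k) + lookup a (Inr k) = lookup b (Inl k) + lookup b (Inr k)"
    and X: "X = {k. lookup a (Inl k) \<noteq> lookup b (Inl k)}"
    and sum_eq: "(\<Sum>k\<in>?C. lookup b (Inl k)) = (\<Sum>k\<in>?C. lookup a (Inl k))" for a b
  proof -
    have "lookup b (Inl k) \<le> lookup a (Inl k)" if k: "k \<in> ?C" for k
    proof (cases "\<rho> i < \<rho> k")
      case True
      then have "lookup a (Inr k) = 0"
        using nb gt k supp unfolding bad_def by (metis (no_types, lifting) Int_iff mem_Collect_eq gr0I not_less_zero)
      then show ?thesis using md[of k] by simp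
    next
      case False
      show ?thesis
      proof (cases "k \<in> X")
        case True
        with least False have "\<rho> i = \<rho> k" by (meson le_antisym linorder_not_less)
        then have "i = k" using inj i True XV by (auto dest: inj_onD)
        then show ?thesis using gt by simp
      next
        case False
        then show ?thesis by (simp add: X)
      qed
    qed
    moreover have "i \<in> ?C" using i XD by auto
    moreover have "finite ?C" by simp
    ultimately have "(\<Sum>k\<in>?C. lookup b (Inl k)) < (\<Sum>k\<in>?C. lookup a (Inl k))"
      using gt by (intro sum_strict_mono_ex1) auto
    with sum_eq show False by simp
  qed
  have "lookup m (Inl i) < lookup m' (Inl i) \<or> lookup m' (Inl i) < lookup m (Inl i)"
    using i by (auto simp: X_def)
  then show False
  proof
    assume "lookup m' (Inl i) < lookup m (Inl i)"
    from no[OF this nb(1) _ md _ sum_eq] show False by (simp add: X_def)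
  next
    assume "lookup m (Inl i) < lookup m' (Inl i)"
    moreover have "X = {k. lookup m' (Inl k) \<noteq> lookup m (Inl k)}" unfolding X_def by metis
    ultimately show False using no[OF _ nb(2) D' md[symmetric] _ sum_eq[symmetric]] by blast
  qed
qed

text \<open>The exchanges that replace a \<open>y\<close> by the \<open>y\<close> of an earlier vertex, and hence lower the weight of the \<open>y\<close>-part
with respect to \<open>\<rho>\<close>.\<close>
definition down :: "(nat \<Rightarrow> nat) \<Rightarrow> (nat + nat \<Rightarrow>\<^sub>0 nat) rel" where
  "down \<rho> = {(t + xm i + ym j, t + xm j + ym i) |t i j. \<rho> i < \<rho> j \<and> t + xm i + ym j \<approx> t + xm j + ym i}"

definition yweight :: "(nat \<Rightarrow> nat) \<Rightarrow> (nat \<Rightarrow>\<^sub>0 nat) \<Rightarrow> nat" where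
  "yweight \<rho> w = (\<Sum>i\<in>keys w. \<rho> i * lookup w i)"

lemma yweight_add: "yweight \<rho> (w + w') = yweight \<rho> w + yweight \<rho> w'"
proof -
  have *: "yweight \<rho> v = (\<Sum>i\<in>keys w \<union> keys w'. \<rho> i * lookup v i)" if "keys v \<subseteq> keys w \<union> keys w'" for v
    unfolding yweight_def by (rule sum.mono_neutral_left) (use that in \<open>auto simp: in_keys_iff\<close>)
  show ?thesis
    by (subst (1 2 3) *) (auto simp: keys_add_nat lookup_add distrib_left sum.distrib)
qed

lemma yweight_single [simp]: "yweight \<rho> (single i 1) = \<rho> i"
  by (simp add: yweight_def)

lemma down_yweight: "(m, m') \<in> down \<rho> \<Longrightarrow> yweight \<rho> (ypart m') < yweight \<rho> (ypart m)"
  by (auto simp: down_def ypart_add yweight_add)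

lemma down_equivalent: "(m, m') \<in> down \<rho> \<Longrightarrow> m \<approx> m'"
  by (auto simp: down_def)

lemma bad_down:
  assumes "bad \<rho> m"
  obtains m' where "(m, m') \<in> down \<rho>"
proof -
  obtain i j where ij: "\<rho> i < \<rho> j" "0 < lookup m (Inl i)" "0 < lookup m (Inr j)"
    "(i, j) \<in> (edges_in E (support m))\<^sup>*"
    using assms unfolding bad_def by blast
  obtain t1 where t1: "m = t1 + ym j" using mon_split_single[OF ij(3)] by blast
  then have "0 < lookup t1 (Inl i)" using ij(2) by (simp add: lookup_add lookup_single)
  from mon_split_single[OF this] obtain t where "t1 = t + xm i" by blast
  with t1 have m: "m = t + xm i + ym j" by simp
  have "t + xm i + ym j \<approx> t + xm j + ym i" by (rule equivalent_swap) (use ij(4) m in simp)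
  then have "(m, t + xm j + ym i) \<in> down \<rho>" using ij(1) m unfolding down_def by blast
  then show ?thesis by (rule that)
qed

text \<open>A bad monomial admits a downward exchange, which lowers the weight, so the process ends at a monomial
that is not bad. By uniqueness it is \<open>m\<close>.\<close>
lemma down_reaches_nonbad:
  assumes "m' \<approx> m" and nb: "\<not> bad \<rho> m" and inj: "inj_on \<rho> V" and mV: "m \<in> monomials (xy_vars n)"
  shows "(m', m) \<in> (down \<rho>)\<^sup>*"
  using assms(1)
proof (induction "yweight \<rho> (ypart m')" arbitrary: m' rule: less_induct)
  case less
  show ?case
  proof (cases "bad \<rho> m'")
    case True
    then obtain m'' where m'': "(m', m'') \<in> down \<rho>" by (rule bad_down)
    have "m'' \<approx> m" using down_equivalent[OF m''] less.prems equivalent_sym equivalent_trans by blast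
    from less.hyps[OF down_yweight[OF m''] this] m'' show ?thesis by (rule converse_rtrancl_into_rtrancl[rotated])
  next
    case False
    have "m = m'" by (rule nonbad_unique[OF equivalent_sym[OF less.prems] nb False inj mV])
    then show ?thesis by simp
  qed
qed

lemma nonbad_min_yweight:
  assumes "m' \<approx> m" "\<not> bad \<rho> m" "inj_on \<rho> V" "m \<in> monomials (xy_vars n)" "m' \<noteq> m"
  shows "yweight \<rho> (ypart m) < yweight \<rho> (ypart m')"
proof -
  have "(m', m) \<in> (down \<rho>)\<^sup>*" by (rule down_reaches_nonbad[OF assms(1-4)])
  then have "m' = m \<or> yweight \<rho> (ypart m) < yweight \<rho> (ypart m')"
  proof (induction rule: converse_rtrancl_induct)
    case (step y z)
    then show ?case using down_yweight[OF step(1)] by auto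
  qed simp
  with assms(5) show ?thesis by blast
qed

text \<open>Choose a shortest path from an \<open>x\<^sub>i\<close> to a \<open>y\<^sub>j\<close> with \<open>i\<close> before \<open>j\<close> among all pairs that make \<open>m\<close> bad. If an interior
vertex came after \<open>j\<close>, the two path neighbours of the latest one would be adjacent by the elimination
property, giving a shorter path. So all interior vertices come before \<open>j\<close>. None of them carries an \<open>x\<close>, as
otherwise the path could start there. Hence they all carry a \<open>y\<close>, and the whole path lies in the support of
\<open>x\<^sub>i\<close> times the \<open>y\<close>-part of \<open>m\<close>.\<close>
lemma bad_linear_divisor:
  assumes \<rho>: "elimination_order E V \<rho>" and "bad \<rho> m" and mV: "m \<in> monomials (xy_vars n)"
  obtains i where "0 < lookup m (Inl i)" "bad \<rho> (xm i + join 0 (ypart m))"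
proof -
  let ?R = "edges_in E (support m)"
  define P where
    "P l \<longleftrightarrow> (\<exists>i j. \<rho> i < \<rho> j \<and> 0 < lookup m (Inl i) \<and> 0 < lookup m (Inr j) \<and> (i, j) \<in> ?R ^^ l)" for l
  have "\<exists>l. P l" using \<open>bad \<rho> m\<close> unfolding bad_def P_def rtrancl_power by blast
  define l where "l = (LEAST l. P l)"
  have l: "P l" unfolding l_def using \<open>\<exists>l. P l\<close> by (rule LeastI_ex)
  have least: "l \<le> k" if "P k" for k unfolding l_def using that by (rule Least_le)
  from l obtain i j where ij: "\<rho> i < \<rho> j" "0 < lookup m (Inl i)" "0 < lookup m (Inr j)" "(i, j) \<in> ?R ^^ l"
    unfolding P_def by blast
  then obtain f where f: "f 0 = i" "f l = j" and step: "\<And>k. k < l \<Longrightarrow> (f k, f (Suc k)) \<in> ?R"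
    unfolding relpow_fun_conv by blast
  note sub = relpow_along_fun[of l f ?R, OF step]
  have DV: "support m \<subseteq> V" using mV by (simp add: support_monomials)
  have fD: "f k \<in> support m" if "k \<le> l" "0 < l" for k
    using that step[of k] step[of "k - 1"] by (cases "k < l") (auto simp: edges_in_def)
  have shortcut: False if "a < c" "c \<le> l" "k < c - a" "(f a, f c) \<in> ?R ^^ k" for a c k
  proof -
    have "(i, f a) \<in> ?R ^^ a" "(f c, j) \<in> ?R ^^ (l - c)"
      using sub[of 0 a] sub[of c l] that f by auto
    then have "(i, j) \<in> ?R ^^ (a + k + (l - c))" using that(4) unfolding relpow_add by blast
    with ij have "P (a + k + (l - c))" unfolding P_def by blast
    from least[OF this] that show False by linarith
  qed
  have inj: "inj_on \<rho> V" using \<rho> by (simp add: elimination_order_def)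
  have below: "\<rho> (f k) < \<rho> j" if k: "0 < k" "k < l" for k
  proof (rule ccontr)
    assume "\<not> \<rho> (f k) < \<rho> j"
    define Y where "Y = {k. 0 < k \<and> k < l}"
    have "finite Y" "k \<in> Y" using k by (auto simp: Y_def)
    then have "Max ((\<lambda>k. \<rho> (f k)) ` Y) \<in> (\<lambda>k. \<rho> (f k)) ` Y" by (intro Max_in) auto
    then obtain a where a: "a \<in> Y" and Max_a: "Max ((\<lambda>k. \<rho> (f k)) ` Y) = \<rho> (f a)" by blast
    have max: "\<rho> (f c) \<le> \<rho> (f a)" if "c \<in> Y" for c
      unfolding Max_a[symmetric] using \<open>finite Y\<close> that by (intro Max_ge) auto
    have al: "0 < a" "a < l" using a by (auto simp: Y_def)
    have top: "\<rho> j \<le> \<rho> (f a)" using max[OF \<open>k \<in> Y\<close>] \<open>\<not> \<rho> (f k) < \<rho> j\<close> by linarith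
    have "f a \<noteq> j" using shortcut[of a l 0] al f by auto
    have "0 < l" using al by linarith
    have aV: "f c \<in> V" if "c \<le> l" for c using fD[OF that \<open>0 < l\<close>] DV by blast
    have "\<rho> (f c) \<le> \<rho> (f a)" if "c \<le> l" for c
    proof (cases "c \<in> Y")
      case True then show ?thesis by (rule max)
    next
      case False
      then have "c = 0 \<or> c = l" using that by (auto simp: Y_def)
      then show ?thesis using top ij(1) f by auto
    qed
    then have less: "\<rho> (f c) < \<rho> (f a)" if "c \<le> l" "f c \<noteq> f a" for c
      using that inj aV[OF that(1)] aV[of a] al by (metis inj_onD le_neq_implies_less less_imp_le)
    have e1: "(f (a - 1), f a) \<in> ?R" and e2: "(f a, f (Suc a)) \<in> ?R"
      using step[of "a - 1"] step[of a] al by auto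
    have E12: "{f (a - 1), f a} \<in> E" "{f a, f (Suc a)} \<in> E"
      using e1 e2 by (simp_all add: edges_in_def)
    have ne1: "f (a - 1) \<noteq> f a" "f (Suc a) \<noteq> f a"
      using edgeD[OF E12(1)] edgeD[OF E12(2)] by auto
    show False
    proof (cases "f (a - 1) = f (Suc a)")
      case True
      show False by (rule shortcut[of "a - 1" "Suc a" 0]) (use True al in auto)
    next
      case False
      have "{f (a - 1), f (Suc a)} \<in> E"
      proof -
        have "\<rho> (f (a - 1)) < \<rho> (f a)" "\<rho> (f (Suc a)) < \<rho> (f a)"
          using less[of "a - 1"] less[of "Suc a"] ne1 al by auto
        moreover have "{f (a - 1), f a} \<in> E" "{f (Suc a), f a} \<in> E"
          using E12 by (simp_all add: insert_commute)
        moreover have "f (a - 1) \<in> V" "f (Suc a) \<in> V" "f a \<in> V" using aV al by auto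
        ultimately show ?thesis using \<rho> False unfolding elimination_order_def by blast
      qed
      then have "(f (a - 1), f (Suc a)) \<in> ?R" using e1 e2 by (auto simp: edges_in_def)
      then have "(f (a - 1), f (Suc a)) \<in> ?R ^^ 1" by simp
      then show False by (rule shortcut[of "a - 1" "Suc a" 1, rotated 3]) (use al in auto)
    qed
  qed
  have interior: "0 < lookup m (Inr (f k))" if k: "0 < k" "k \<le> l" for k
  proof (cases "k = l")
    case True
    then show ?thesis using f ij by simp
  next
    case False
    then have kl: "k < l" using k by simp
    have "lookup m (Inl (f k)) = 0"
    proof (rule ccontr)
      assume "lookup m (Inl (f k)) \<noteq> 0"
      then have "0 < lookup m (Inl (f k))" by simp
      moreover have "(f k, j) \<in> ?R ^^ (l - k)" using sub[of k l] kl f by simp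
      ultimately have "P (l - k)" using below[OF k(1) kl] ij(3) unfolding P_def by blast
      from least[OF this] k kl show False by linarith
    qed
    moreover have "f k \<in> support m" using fD[of k] kl by simp
    ultimately show ?thesis by (simp add: support_def multideg_def)
  qed
  let ?m' = "xm i + join 0 (ypart m)"
  have "f k \<in> support ?m'" if "k \<le> l" for k
    using interior[of k] that f by (cases "k = 0") (auto simp: support_def multideg_def lookup_add)
  then have "(f k, f (Suc k)) \<in> edges_in E (support ?m')" if "k < l" for k
    using step[OF that] that by (auto simp: edges_in_def)
  then have "(i, j) \<in> edges_in E (support ?m') ^^ l"
    unfolding relpow_fun_conv using f by blast
  then have "(i, j) \<in> (edges_in E (support ?m'))\<^sup>*" by (rule relpow_imp_rtrancl)
  then have "bad \<rho> ?m'" unfolding bad_def using ij by (intro exI[of _ i] exI[of _ j]) (auto simp: lookup_add)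
  then show ?thesis using that ij by blast
qed

end

section \<open>The defining ideal of the symmetric algebra\<close>

text \<open>A polynomial ring is generated by constants and variables. Stated for the carriers of subrings of
coefficients and subsets of variables, so that all intermediate values stay inside.\<close>
lemma mpoly_ring_induct [consumes 1, case_names const var add mult]:
  fixes p :: "('v, 'a::comm_ring_1) mpoly"
  assumes p: "p \<in> carrier (mpoly_ring A W)"
    and A0: "0 \<in> A" and const: "\<And>a. a \<in> A \<Longrightarrow> P (mp_const a)" and var: "\<And>v. v \<in> W \<Longrightarrow> P (mp_var v)"
    and add: "\<And>q r. P q \<Longrightarrow> P r \<Longrightarrow> P (q + r)" and mult: "\<And>q r. P q \<Longrightarrow> P r \<Longrightarrow> P (q * r)"
  shows "P p"
proof -
  have mon: "P (single m a)" if "a \<in> A" "m \<in> monomials W" for a m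
    using that(2)
  proof (induction "mon_deg m" arbitrary: m)
    case 0
    then show ?case using const[OF that(1)] by (simp add: mp_const_def)
  next
    case (Suc d)
    then have "m \<noteq> 0" by auto
    then obtain v where "lookup m v \<noteq> 0" by (metis lookup_zero poly_mapping_eqI)
    then obtain t where t: "m = t + single v 1" using mon_split_single[of m v] by auto
    have "t \<in> monomials W" "single v 1 \<in> monomials W" using Suc(3) t by simp_all
    moreover have "d = mon_deg t" using Suc(2) t by simp
    moreover have "v \<in> W" using \<open>single v 1 \<in> monomials W\<close> by (simp add: monomials_def)
    ultimately have "P (single t a)" "P (mp_var v)" using Suc(1) var by auto
    from mult[OF this] show ?case by (simp add: t mp_var_def mult_single)
  qed
  show ?thesis
  proof (induction p rule: poly_induct)
    case zero
    then show ?case using const[OF A0] by simp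
  next
    case (single m)
    then show ?case using p by (intro mon) (auto simp: mpoly_ring_def)
  qed (rule add)
qed

text \<open>The polynomial \<open>s(x) y\<^sup>w\<close>; for \<open>w = 0\<close> this is the inclusion of \<open>K[x]\<close> into \<open>K[x, y]\<close>.\<close>
definition emb :: "(nat \<Rightarrow>\<^sub>0 nat) \<Rightarrow> (nat, 'k::comm_ring_1) mpoly \<Rightarrow> (nat + nat, 'k) mpoly" where
  "emb w s = (\<Sum>u\<in>keys s. single (join u w) (lookup s u))"

lemma lookup_emb: "lookup (emb w s) m = (if ypart m = w then lookup s (xpart m) else 0)"
proof -
  have "lookup (emb w s) m = (\<Sum>u\<in>keys s. if u = xpart m \<and> ypart m = w then lookup s u else 0)"
    unfolding emb_def lookup_sum by (intro sum.cong refl) (auto simp: lookup_single when_def join_eq_iff)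
  also have "\<dots> = (if ypart m = w then lookup s (xpart m) else 0)"
    by (auto simp: sum.delta in_keys_iff)
  finally show ?thesis .
qed

lemma emb_zero [simp]: "emb w 0 = 0" by (simp add: emb_def)
lemma emb_add: "emb w (s + t) = emb w s + emb w t"
  by (rule poly_mapping_eqI) (simp add: lookup_emb lookup_add)
lemma emb_diff: "emb w (s - t) = emb w s - emb w t"
  by (rule poly_mapping_eqI) (simp add: lookup_emb lookup_minus)
lemma emb_single: "emb w (single u a) = single (join u w) a"
  by (rule poly_mapping_eqI) (auto simp: lookup_emb lookup_single when_def join_eq_iff)
lemma emb_mult: "emb w s * emb w' t = emb (w + w') (s * t)"
proof (induction s rule: poly_induct)
  case (single u)
  show ?case
  proof (induction t rule: poly_induct)
    case (single u') show ?case by (simp add: emb_single mult_single join_add)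
  qed (simp_all add: distrib_left emb_add)
qed (simp_all add: distrib_right emb_add)

lemma emb_one: "emb 0 1 = 1"
  using emb_single[of 0 0 1] by simp
lemma emb_const: "emb 0 (mp_const a) = mp_const a"
  by (simp add: mp_const_def emb_single)
lemma join_singles [simp]: "join (single i 1) 0 = xm i" "join 0 (single i 1) = ym i"
  by (simp_all add: join_eq_iff)
lemma emb_var: "emb 0 (mp_var i) = mp_var (Inl i)"
  by (simp add: mp_var_def emb_single)

lemma coefficient_hom_emb: "coefficient_hom (emb 0)"
  by unfold_locales (simp_all add: emb_one emb_add emb_mult)

lemma emb_eq_mult: "emb w s = emb 0 s * emb w 1" by (simp add: emb_mult)

lemma emb_PV: "s \<in> PV {1..n} \<Longrightarrow> w \<in> monomials {1..n} \<Longrightarrow> emb w s \<in> PV (xy_vars n)"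
  by (auto simp: PV_def in_keys_iff lookup_emb monomials_xy_iff split: if_splits)

text \<open>The coefficient of \<open>y\<^sup>w\<close>, a polynomial in \<open>x\<close>.\<close>
definition ycoeff :: "(nat \<Rightarrow>\<^sub>0 nat) \<Rightarrow> (nat + nat, 'k::comm_ring_1) mpoly \<Rightarrow> (nat, 'k) mpoly" where
  "ycoeff w q = Poly_Mapping.map_key (\<lambda>u. join u w) q"

lemma lookup_ycoeff [simp]: "lookup (ycoeff w q) u = lookup q (join u w)"
proof -
  have "inj (\<lambda>u. join u w)" by (rule injI) (metis xpart_join)
  then show ?thesis unfolding ycoeff_def by (subst map_key.rep_eq) auto
qed

lemma ycoeff_zero [simp]: "ycoeff w 0 = 0" by (rule poly_mapping_eqI) simp
lemma ycoeff_add: "ycoeff w (p + q) = ycoeff w p + ycoeff w q" by (rule poly_mapping_eqI) (simp add: lookup_add)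
lemma ycoeff_diff: "ycoeff w (p - q) = ycoeff w p - ycoeff w q" by (rule poly_mapping_eqI) (simp add: lookup_minus)
lemma ycoeff_single: "ycoeff w (single m a) = (if ypart m = w then single (xpart m) a else 0)"
  by (rule poly_mapping_eqI) (auto simp: lookup_single when_def join_eq_iff)
lemma ycoeff_emb: "ycoeff w (emb w' s) = (if w = w' then s else 0)"
  by (rule poly_mapping_eqI) (auto simp: lookup_emb)
lemma ycoeff_mult: "ycoeff w (emb 0 s * q) = s * ycoeff w q"
proof (induction s rule: poly_induct)
  case (single u)
  show ?case
  proof (induction q rule: poly_induct)
    case (single m) show ?case by (simp add: emb_single mult_single ycoeff_single ypart_add xpart_add)
  qed (simp_all add: distrib_left ycoeff_add)
qed (simp_all add: distrib_right ycoeff_add emb_add)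
lemma ycoeff_PV: "q \<in> PV (xy_vars n) \<Longrightarrow> ycoeff w q \<in> PV {1..n}"
  by (auto simp: PV_def in_keys_iff monomials_xy_iff subset_iff) 

context edge_graph
begin

definition class_sum :: "(nat + nat, 'k::field) mpoly \<Rightarrow> (nat + nat \<Rightarrow>\<^sub>0 nat) \<Rightarrow> 'k" where
  "class_sum p m = (\<Sum>m'\<in>{m' \<in> keys p. m \<approx> m'}. lookup p m')"

text \<open>The span of the differences of equivalent monomials. Describing it by vanishing sums over classes makes
membership a property of the coefficients.\<close>
definition binomial_ideal :: "(nat + nat, 'k::field) mpoly set" where
  "binomial_ideal = {p. \<forall>m. class_sum p m = 0}"

lemma class_sum_superset:
  assumes "finite A" "keys p \<subseteq> A"
  shows "class_sum p m = (\<Sum>m'\<in>{m' \<in> A. m \<approx> m'}. lookup p m')"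
  unfolding class_sum_def by (rule sum.mono_neutral_left) (use assms in \<open>auto simp: in_keys_iff\<close>)

lemma class_sum_add: "class_sum (p + q) m = class_sum p m + class_sum q m"
  by (subst (1 2 3) class_sum_superset[where A = "keys p \<union> keys q"])
    (use keys_add[of p q] in \<open>auto simp: lookup_add sum.distrib\<close>)

lemma class_sum_uminus: "class_sum (- p) m = - class_sum p m"
  by (simp add: class_sum_def sum_negf)

lemma class_sum_single: "class_sum (single m' a) m = (if m \<approx> m' then a else 0)"
  by (subst class_sum_superset[of "{m'}"]) (auto simp: Collect_conv_if)

lemma binomial_ideal_zero: "0 \<in> binomial_ideal" by (simp add: binomial_ideal_def class_sum_def)
lemma binomial_ideal_add: "p \<in> binomial_ideal \<Longrightarrow> q \<in> binomial_ideal \<Longrightarrow> p + q \<in> binomial_ideal"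
  by (simp add: binomial_ideal_def class_sum_add)
lemma binomial_ideal_uminus: "p \<in> binomial_ideal \<Longrightarrow> - p \<in> binomial_ideal"
  by (simp add: binomial_ideal_def class_sum_uminus)
lemma binomial_ideal_diff: "p \<in> binomial_ideal \<Longrightarrow> q \<in> binomial_ideal \<Longrightarrow> p - q \<in> binomial_ideal"
  using binomial_ideal_add[of p "- q"] binomial_ideal_uminus[of q] by simp

lemma equivalent_iff: "m \<approx> m' \<Longrightarrow> k \<approx> m \<longleftrightarrow> k \<approx> m'"
  using equivalent_trans equivalent_sym by blast

lemma binomial_in_binomial_ideal: "m \<approx> m' \<Longrightarrow> single m a - single m' a \<in> binomial_ideal"
  using equivalent_iff[of m m'] class_sum_add[of "single m a" "- single m' a"]
  by (simp add: binomial_ideal_def class_sum_uminus class_sum_single)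

text \<open>If \<open>m\<close> were the only term of \<open>p\<close> in its class, the sum over the class would be its coefficient.\<close>
lemma binomial_ideal_other_term:
  assumes "p \<in> binomial_ideal" "m \<in> keys p"
  obtains m' where "m' \<in> keys p" "m' \<noteq> m" "m \<approx> m'"
proof -
  have "\<exists>m'\<in>keys p. m' \<noteq> m \<and> m \<approx> m'"
  proof (rule ccontr)
    assume "\<not> ?thesis"
    then have "{m' \<in> keys p. m \<approx> m'} = {m}" using assms(2) equivalent.refl by auto
    then have "class_sum p m = lookup p m" by (simp add: class_sum_def)
    with assms show False by (simp add: binomial_ideal_def in_keys_iff)
  qed
  then show ?thesis using that by blast
qed

text \<open>Removing a term with the help of another term of its class lowers the number of terms. Keeping track
of the monomials of \<open>p\<close> allows the induction to be restricted to variables in a given set.\<close>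
lemma binomial_ideal_induct [consumes 1, case_names zero binomial add]:
  assumes "p \<in> binomial_ideal" and "P 0"
    and "\<And>m m' a. m \<in> keys p \<Longrightarrow> m \<approx> m' \<Longrightarrow> P (single m a - single m' a)"
    and "\<And>q r. P q \<Longrightarrow> P r \<Longrightarrow> P (q + r)"
  shows "P p"
proof -
  have "P q" if "q \<in> binomial_ideal" "keys q \<subseteq> keys p" for q
    using that
  proof (induction "card (keys q)" arbitrary: q rule: less_induct)
    case less
    show ?case
    proof (cases "keys q = {}")
      case True
      then have "q = 0" by simp
      then show ?thesis using assms(2) by simp
    next
      case False
      then obtain m where m: "m \<in> keys q" by blast
      obtain m' where m': "m' \<in> keys q" "m' \<noteq> m" "m \<approx> m'"
        using binomial_ideal_other_term[OF less.prems(1) m] by blast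
      let ?b = "single m (lookup q m) - single m' (lookup q m)"
      have sub: "keys (q - ?b) \<subseteq> keys q - {m}"
        using m' by (auto simp: in_keys_iff lookup_minus lookup_single when_def split: if_splits)
      then have "card (keys (q - ?b)) < card (keys q)"
        by (intro psubset_card_mono) (use m in auto)
      moreover have "q - ?b \<in> binomial_ideal"
        by (rule binomial_ideal_diff[OF less.prems(1) binomial_in_binomial_ideal[OF m'(3)]])
      moreover have "keys (q - ?b) \<subseteq> keys p" using sub less.prems by blast
      ultimately have "P (q - ?b)" using less.hyps by blast
      moreover have "P ?b" by (rule assms(3)[OF _ m'(3)]) (use m less.prems in blast)
      ultimately have "P ((q - ?b) + ?b)" by (rule assms(4))
      then show ?thesis by simp
    qed
  qed
  from this[OF assms(1) order_refl] show ?thesis .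
qed

lemma binomial_ideal_mult: "p \<in> binomial_ideal \<Longrightarrow> q * p \<in> binomial_ideal"
proof (induction q rule: poly_induct)
  case (single t)
  show ?case using single(2)
  proof (induction p rule: binomial_ideal_induct)
    case (binomial m m' a)
    then show ?case
      using binomial_in_binomial_ideal[OF equivalent_add[OF binomial(2)]]
      by (simp add: right_diff_distrib mult_single)
  qed (simp_all add: distrib_left binomial_ideal_add binomial_ideal_zero)
qed (simp_all add: distrib_right binomial_ideal_add binomial_ideal_zero)

lemma binomial_ideal_mult_right: "p \<in> binomial_ideal \<Longrightarrow> p * q \<in> binomial_ideal"
  using binomial_ideal_mult[of p q] by (simp add: mult.commute)

abbreviation S where "S \<equiv> mpoly_ring UNIV V"
abbreviation M :: "((nat, 'k::field) mpoly, (nat \<Rightarrow> (nat, 'k) mpoly) set) graded_module" where "M \<equiv> edge_mod"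
abbreviation cover where "cover \<equiv> sym_cover S M"
abbreviation relids where "relids \<equiv> sym_ideal S M"

definition rep :: "(nat \<Rightarrow> (nat, 'k::field) mpoly) set \<Rightarrow> nat \<Rightarrow> (nat, 'k) mpoly" where
  "rep X = (SOME f. f \<in> vecs V V \<and> X = cls f)"

text \<open>A representing vector for an element of the edge module.\<close>
lemma rep:
  assumes "X \<in> carrier M"
  shows "rep X \<in> vecs V V" "cls (rep X) = X"
proof -
  have "\<exists>f. f \<in> vecs V V \<and> X = cls f" using assms by (auto simp: carrier_edge_module)
  from someI_ex[OF this] show "rep X \<in> vecs V V" "cls (rep X) = X" by (simp_all add: rep_def)
qed

text \<open>The vector \<open>f\<close> as the linear form \<open>\<Sum>\<^sub>i f\<^sub>i(x) y\<^sub>i\<close>, under which the relations \<open>x\<^sub>i e\<^sub>j - x\<^sub>j e\<^sub>i\<close> become \<open>x\<^sub>i y\<^sub>j - x\<^sub>j y\<^sub>i\<close>.\<close>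
definition vecpoly :: "(nat \<Rightarrow> (nat, 'k::field) mpoly) \<Rightarrow> (nat + nat, 'k) mpoly" where
  "vecpoly f = (\<Sum>i\<in>V. emb (single i 1) (f i))"

lemma vecpoly_zero: "vecpoly (\<lambda>i. 0) = 0"
  by (simp add: vecpoly_def)
lemma vecpoly_add: "vecpoly (\<lambda>i. f i + g i) = vecpoly f + vecpoly g"
  by (simp add: vecpoly_def emb_add sum.distrib)
lemma vecpoly_diff: "vecpoly (\<lambda>i. f i - g i) = vecpoly f - vecpoly g"
  by (simp add: vecpoly_def emb_diff sum_subtractf)
lemma vecpoly_smult: "vecpoly (\<lambda>i. s * f i) = emb 0 s * vecpoly f"
  by (simp add: vecpoly_def emb_mult sum_distrib_left)
lemma vecpoly_basis: "i \<in> V \<Longrightarrow> vecpoly (basis_vec i) = mp_var (Inr i)"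
proof -
  assume i: "i \<in> V"
  have "vecpoly (basis_vec i) = (\<Sum>j\<in>V. if j = i then emb (single j 1) 1 else 0 :: (nat + nat, 'a) mpoly)"
    unfolding vecpoly_def by (intro sum.cong refl) (auto simp: basis_vec_def)
  also have "\<dots> = emb (single i 1) 1" using i by (simp add: sum.delta)
  also have "\<dots> = mp_var (Inr i)"
    using emb_single[of "single i 1" 0 1] by (simp add: mp_var_def)
  finally show ?thesis .
qed
lemma vecpoly_PV: "f \<in> vecs V V \<Longrightarrow> vecpoly f \<in> PV (xy_vars n)"
  unfolding vecpoly_def
  by (intro PV_sum emb_PV) (auto simp: vecs_PV monomials_def)

lemma edge_relations_minimal:
  assumes "N \<subseteq> vecs V V" "is_submodule V N" "\<And>i j. {i, j} \<in> E \<Longrightarrow> relation i j \<in> N"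
  shows "edge_relations n E \<subseteq> N"
  unfolding edge_relations_def gen_submodule_def edge_cover_def submodule_free_module_iff
  by (rule Inter_lower, rule CollectI) (use assms in blast)

lemma vecpoly_relation: "{i, j} \<in> E \<Longrightarrow>
  vecpoly (relation i j) = single (xm i + ym j) 1 - single (xm j + ym i) 1"
  using edgeD[of i j]
  by (simp add: vecpoly_diff vecpoly_smult vecpoly_basis mp_var_def emb_single mult_single)

lemma vecpoly_edge_relations: "h \<in> edge_relations n E \<Longrightarrow> vecpoly h \<in> binomial_ideal"
proof -
  have "edge_relations n E \<subseteq> {h \<in> vecs V V. vecpoly h \<in> binomial_ideal}"
  proof (rule edge_relations_minimal)
    show "is_submodule V {h \<in> vecs V V. vecpoly h \<in> binomial_ideal}"
      by (auto simp: is_submodule_def vecs_add vecs_smult vecpoly_add vecpoly_smult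
          binomial_ideal_add binomial_ideal_mult binomial_ideal_zero vecpoly_zero)
    fix i j assume ij: "{i, j} \<in> E"
    have "xm i + ym j \<approx> xm j + ym i" using equivalent_move[OF ij, of 0] by simp
    then show "relation i j \<in> {h \<in> vecs V V. vecpoly h \<in> binomial_ideal}"
      using relation_in_edge_relations[OF ij] edge_relations_vecs
      by (auto simp: vecpoly_relation[OF ij] binomial_in_binomial_ideal)
  qed blast
  then show "h \<in> edge_relations n E \<Longrightarrow> vecpoly h \<in> binomial_ideal" by blast
qed

lemma vecpoly_cong: "cls f = cls g \<Longrightarrow> vecpoly f - vecpoly g \<in> binomial_ideal"
  using vecpoly_edge_relations[of "\<lambda>i. f i - g i"] by (simp add: cls_eq_iff vecpoly_diff)

lemma coeff_carrier: "carrier S = PV V" by (rule carrier_mpoly_ring)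

lemma cring_cover: "cring cover"
  unfolding sym_cover_def coeff_carrier by (rule cring_mpoly_ring(1)) auto

lemma cover_minus:
  assumes "p \<in> carrier cover" "q \<in> carrier cover"
  shows "p \<ominus>\<^bsub>cover\<^esub> q = p - q"
  using assms unfolding sym_cover_def coeff_carrier by (intro cring_mpoly_ring(2)) auto

lemma cover_carrier: "p \<in> carrier cover \<longleftrightarrow> (\<forall>m. lookup p m \<in> PV V) \<and> keys p \<subseteq> monomials (carrier M)"
  unfolding sym_cover_def coeff_carrier
  unfolding mpoly_ring_def by auto

lemma cover_ops:
  "add cover = (+)" "mult cover = (*)" "zero cover = 0" "one cover = 1"
  by (simp_all add: sym_cover_def mpoly_ring_def)

lemma cover_closed:
  "p \<in> carrier cover \<Longrightarrow> q \<in> carrier cover \<Longrightarrow> p + q \<in> carrier cover"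
  "p \<in> carrier cover \<Longrightarrow> q \<in> carrier cover \<Longrightarrow> p * q \<in> carrier cover"
  "p \<in> carrier cover \<Longrightarrow> q \<in> carrier cover \<Longrightarrow> p - q \<in> carrier cover"
  "0 \<in> carrier cover" "1 \<in> carrier cover"
proof -
  interpret cring cover by (rule cring_cover)
  show "p \<in> carrier cover \<Longrightarrow> q \<in> carrier cover \<Longrightarrow> p + q \<in> carrier cover"
    using add.m_closed by (simp add: cover_ops)
  show "p \<in> carrier cover \<Longrightarrow> q \<in> carrier cover \<Longrightarrow> p * q \<in> carrier cover"
    using m_closed by (simp add: cover_ops)
  show "p \<in> carrier cover \<Longrightarrow> q \<in> carrier cover \<Longrightarrow> p - q \<in> carrier cover"
    using minus_closed[of p q] by (simp add: cover_minus)
  show "0 \<in> carrier cover" "1 \<in> carrier cover" using zero_closed one_closed by (simp_all add: cover_ops)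
qed

lemma cover_const: "s \<in> PV V \<Longrightarrow> mp_const s \<in> carrier cover"
  by (simp add: cover_carrier mp_const_def lookup_single when_def)
lemma cover_var: "X \<in> carrier M \<Longrightarrow> mp_var X \<in> carrier cover"
  by (simp add: cover_carrier mp_var_def lookup_single when_def monomials_def)

lemma cover_induct [consumes 1, case_names const var add mult]:
  assumes "p \<in> carrier cover" "\<And>s. s \<in> PV V \<Longrightarrow> P (mp_const s)" "\<And>X. X \<in> carrier M \<Longrightarrow> P (mp_var X)"
    and "\<And>q r. P q \<Longrightarrow> P r \<Longrightarrow> P (q + r)" and "\<And>q r. P q \<Longrightarrow> P r \<Longrightarrow> P (q * r)"
  shows "P p"
  by (rule mpoly_ring_induct[of p "PV V" "carrier M"])
    (use assms in \<open>auto simp: sym_cover_def coeff_carrier\<close>)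

lemma edge_module_closed:
  "X \<in> carrier M \<Longrightarrow> Y \<in> carrier M \<Longrightarrow> X \<oplus>\<^bsub>M\<^esub> Y \<in> carrier M"
  "s \<in> PV V \<Longrightarrow> X \<in> carrier M \<Longrightarrow> s \<odot>\<^bsub>M\<^esub> X \<in> carrier M"
  by (auto simp: carrier_edge_module add_edge_module smult_edge_module intro!: imageI vecs_add vecs_smult)

lemma sym_relations_carrier: "sym_relations S M \<subseteq> carrier cover"
  unfolding sym_relations_def coeff_carrier
  by (auto intro!: cover_closed cover_var cover_const edge_module_closed)

lemma ideal_relids: "ideal relids cover"
proof -
  interpret cring cover by (rule cring_cover)
  show ?thesis unfolding sym_ideal_def by (rule genideal_ideal[OF sym_relations_carrier])
qed

lemma relids_add: "p \<in> relids \<Longrightarrow> q \<in> relids \<Longrightarrow> p + q \<in> relids"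
  using additive_subgroup.a_closed[OF ideal.axioms(1)[OF ideal_relids]] by (simp add: cover_ops)
lemma relids_mult: "p \<in> relids \<Longrightarrow> q \<in> carrier cover \<Longrightarrow> q * p \<in> relids"
  using ideal.I_l_closed[OF ideal_relids] by (simp add: cover_ops)
lemma relids_zero: "0 \<in> relids"
  using additive_subgroup.zero_closed[OF ideal.axioms(1)[OF ideal_relids]] by (simp add: cover_ops)
lemma relids_uminus: "p \<in> relids \<Longrightarrow> - p \<in> relids"
proof -
  assume p: "p \<in> relids"
  have "0 - 1 \<in> carrier cover" by (intro cover_closed)
  from relids_mult[OF p this] show ?thesis by simp
qed
lemma relids_diff: "p \<in> relids \<Longrightarrow> q \<in> relids \<Longrightarrow> p - q \<in> relids"
  using relids_add[of p "- q"] relids_uminus[of q] by simp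
lemma relids_relation:
  "X \<in> carrier M \<Longrightarrow> Y \<in> carrier M \<Longrightarrow> mp_var (X \<oplus>\<^bsub>M\<^esub> Y) - mp_var X - mp_var Y \<in> relids"
  "s \<in> PV V \<Longrightarrow> X \<in> carrier M \<Longrightarrow> mp_var (s \<odot>\<^bsub>M\<^esub> X) - mp_const s * mp_var X \<in> relids"
proof -
  interpret cring cover by (rule cring_cover)
  have "sym_relations S M \<subseteq> relids"
    unfolding sym_ideal_def by (rule genideal_self[OF sym_relations_carrier])
  then show "X \<in> carrier M \<Longrightarrow> Y \<in> carrier M \<Longrightarrow> mp_var (X \<oplus>\<^bsub>M\<^esub> Y) - mp_var X - mp_var Y \<in> relids"
    "s \<in> PV V \<Longrightarrow> X \<in> carrier M \<Longrightarrow> mp_var (s \<odot>\<^bsub>M\<^esub> X) - mp_const s * mp_var X \<in> relids"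
    unfolding sym_relations_def coeff_carrier by blast+
qed

text \<open>The symmetric algebra is presented with one indeterminate for every element \<open>X\<close> of the edge module. This
map eliminates the superfluous ones: it replaces \<open>X\<close> by the linear form in \<open>y\<close> of a representing vector. The
next definition goes in the opposite direction and sends \<open>y\<^sub>i\<close> to the indeterminate of the generator \<open>f\<^sub>i\<close>. Modulo
the respective ideals both are inverse to each other, which identifies the symmetric algebra with the
quotient of \<open>K[x, y]\<close> by the binomial ideal.\<close>
definition \<Theta> :: "((nat \<Rightarrow> (nat, 'k::field) mpoly) set, (nat, 'k) mpoly) mpoly \<Rightarrow> (nat + nat, 'k) mpoly" where
  "\<Theta> = mpoly_eval (emb 0) (\<lambda>X. vecpoly (rep X))"

lemma \<Theta>_simps:
  "\<Theta> 0 = 0" "\<Theta> (p + q) = \<Theta> p + \<Theta> q" "\<Theta> (p * q) = \<Theta> p * \<Theta> q" "\<Theta> (p - q) = \<Theta> p - \<Theta> q"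
  "\<Theta> (mp_const s) = emb 0 s" "\<Theta> (mp_var X) = vecpoly (rep X)"
  by (simp_all add: \<Theta>_def coefficient_hom.eval_add[OF coefficient_hom_emb]
      coefficient_hom.eval_mult[OF coefficient_hom_emb] coefficient_hom.eval_diff[OF coefficient_hom_emb]
      coefficient_hom.eval_const[OF coefficient_hom_emb] coefficient_hom.eval_var[OF coefficient_hom_emb]
      coefficient_hom.eval_zero[OF coefficient_hom_emb])

lemma \<Theta>_PV: "p \<in> carrier cover \<Longrightarrow> \<Theta> p \<in> PV (xy_vars n)"
  by (induction p rule: cover_induct) (auto simp: \<Theta>_simps emb_PV vecpoly_PV rep)

text \<open>The polynomials mapped into the binomial ideal form an ideal. It contains the defining relations of the
symmetric algebra, because representing vectors are additive and linear up to relations of the edge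
module, whose linear forms lie in the binomial ideal.\<close>
lemma \<Theta>_relids: "p \<in> relids \<Longrightarrow> \<Theta> p \<in> binomial_ideal"
proof -
  let ?K = "{p \<in> carrier cover. \<Theta> p \<in> binomial_ideal}"
  interpret C: cring cover by (rule cring_cover)
  have inv: "inv\<^bsub>add_monoid cover\<^esub> p = - p" if "p \<in> carrier cover" for p
    using C.minus_equality[of "- p" p] cover_closed(3)[OF cover_closed(4) that] that
    by (simp add: a_inv_def cover_ops)
  have "subgroup ?K (add_monoid cover)"
  proof (rule subgroup.intro)
    show "inv\<^bsub>add_monoid cover\<^esub> p \<in> ?K" if "p \<in> ?K" for p
      using that inv[of p] cover_closed(3)[OF cover_closed(4), of p] binomial_ideal_uminus[of "\<Theta> p"]
        \<Theta>_simps(4)[of 0 p]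
      by (simp add: \<Theta>_simps(1))
  qed (auto simp: cover_ops cover_closed \<Theta>_simps binomial_ideal_add binomial_ideal_zero)
  then have "ideal ?K cover"
    by (rule idealI[OF C.ring_axioms])
      (auto simp: cover_ops cover_closed \<Theta>_simps binomial_ideal_mult binomial_ideal_mult_right)
  moreover have "sym_relations S M \<subseteq> ?K"
  proof
    fix r assume r: "r \<in> sym_relations S M"
    have "\<Theta> r \<in> binomial_ideal"
    proof -
      consider X Y where "r = mp_var (X \<oplus>\<^bsub>M\<^esub> Y) - mp_var X - mp_var Y" "X \<in> carrier M" "Y \<in> carrier M"
        | s X where "r = mp_var (s \<odot>\<^bsub>M\<^esub> X) - mp_const s * mp_var X" "s \<in> PV V" "X \<in> carrier M"
        using r unfolding sym_relations_def coeff_carrier by blast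
      then show ?thesis
      proof cases
        case 1
        have "cls (rep (X \<oplus>\<^bsub>M\<^esub> Y)) = cls (\<lambda>i. rep X i + rep Y i)"
          using rep(2)[OF edge_module_closed(1)[OF 1(2,3)]] add_edge_module[of "rep X" "rep Y"] rep(2)[OF 1(2)] rep(2)[OF 1(3)]
          by simp
        from vecpoly_cong[OF this] show ?thesis by (simp add: 1(1) \<Theta>_simps vecpoly_add diff_diff_eq)
      next
        case 2
        have "cls (rep (s \<odot>\<^bsub>M\<^esub> X)) = cls (\<lambda>i. s * rep X i)"
          using rep(2)[OF edge_module_closed(2)[OF 2(2,3)]] smult_edge_module[OF 2(2), of "rep X"] rep(2)[OF 2(3)]
          by simp
        from vecpoly_cong[OF this] show ?thesis by (simp add: 2(1) \<Theta>_simps vecpoly_smult)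
      qed
    qed
    then show "r \<in> ?K" using r sym_relations_carrier by blast
  qed
  ultimately have "relids \<subseteq> ?K" unfolding sym_ideal_def by (rule C.genideal_minimal)
  then show "p \<in> relids \<Longrightarrow> \<Theta> p \<in> binomial_ideal" by blast
qed

definition lift :: "(nat + nat, 'k::field) mpoly \<Rightarrow> ((nat \<Rightarrow> (nat, 'k) mpoly) set, (nat, 'k) mpoly) mpoly" where
  "lift = mpoly_eval (\<lambda>a. mp_const (mp_const a))
      (case_sum (\<lambda>i. mp_const (mp_var i)) (\<lambda>i. mp_var (edge_module_gen n E i)))"

lemma coefficient_hom_const2: "coefficient_hom (\<lambda>a. mp_const (mp_const a))"
  by unfold_locales (simp_all add: mp_const_add mp_const_mult)

lemma lift_simps:
  "lift 0 = 0" "lift (p + q) = lift p + lift q" "lift (p * q) = lift p * lift q" "lift (p - q) = lift p - lift q"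
  "lift (mp_const a) = mp_const (mp_const a)" "lift (mp_var (Inl i)) = mp_const (mp_var i)"
  "lift (mp_var (Inr i)) = mp_var (cls (basis_vec i))" "lift 1 = 1"
  by (simp_all add: lift_def edge_module_gen_def coefficient_hom.eval_add[OF coefficient_hom_const2]
      coefficient_hom.eval_mult[OF coefficient_hom_const2] coefficient_hom.eval_diff[OF coefficient_hom_const2]
      coefficient_hom.eval_const[OF coefficient_hom_const2] coefficient_hom.eval_var[OF coefficient_hom_const2]
      coefficient_hom.eval_zero[OF coefficient_hom_const2] coefficient_hom.eval_one[OF coefficient_hom_const2])

lemma lift_sum: "lift (\<Sum>i\<in>I. f i) = (\<Sum>i\<in>I. lift (f i))"
  by (rule additive_sum) (simp_all add: lift_simps)

lemma xy_induct [consumes 1, case_names const x y add mult]: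
  assumes "q \<in> PV (xy_vars n)" "\<And>a. P (mp_const a)" "\<And>i. i \<in> V \<Longrightarrow> P (mp_var (Inl i))"
    "\<And>i. i \<in> V \<Longrightarrow> P (mp_var (Inr i))" "\<And>q r. P q \<Longrightarrow> P r \<Longrightarrow> P (q + r)" "\<And>q r. P q \<Longrightarrow> P r \<Longrightarrow> P (q * r)"
  shows "P q"
  by (rule mpoly_ring_induct[of q UNIV "xy_vars n"])
    (use assms in \<open>auto simp: carrier_mpoly_ring xy_vars_def\<close>)

lemma cls_basis_carrier: "i \<in> V \<Longrightarrow> cls (basis_vec i) \<in> carrier M"
  unfolding carrier_edge_module by (intro imageI vecs_basis_vec)

lemma lift_carrier: "q \<in> PV (xy_vars n) \<Longrightarrow> lift q \<in> carrier cover"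
  by (induction q rule: xy_induct)
    (auto simp: lift_simps intro!: cover_closed cover_const cover_var cls_basis_carrier)

lemma lift_emb_0: "lift (emb 0 s) = mp_const s"
proof -
  have "s \<in> carrier (mpoly_ring UNIV UNIV)" by (simp add: mpoly_ring_def monomials_def)
  then show ?thesis
    by (induction s rule: mpoly_ring_induct)
      (simp_all add: emb_const emb_var lift_simps emb_add mp_const_add mp_const_mult emb_mult[of 0 _ 0, simplified, symmetric])
qed

lemma emb_single_1: "emb (single i 1) 1 = mp_var (Inr i)"
  using emb_single[of "single i 1" 0 1] by (simp add: mp_var_def)

lemma lift_emb_basis: "lift (emb (single i 1) s) = mp_const s * mp_var (cls (basis_vec i))"
  by (subst emb_eq_mult) (simp add: lift_simps lift_emb_0 emb_single_1)

lemma \<Theta>_lift: "q \<in> PV (xy_vars n) \<Longrightarrow> \<Theta> (lift q) - q \<in> binomial_ideal"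
proof (induction q rule: xy_induct)
  case (y i)
  have "vecpoly (rep (cls (basis_vec i))) - vecpoly (basis_vec i) \<in> binomial_ideal"
    by (rule vecpoly_cong) (rule rep(2)[OF cls_basis_carrier[OF y]])
  then show ?case by (simp add: lift_simps \<Theta>_simps vecpoly_basis[OF y])
next
  case (add q r)
  from binomial_ideal_add[OF add] show ?case by (simp add: lift_simps \<Theta>_simps algebra_simps)
next
  case (mult q r)
  have "\<Theta> (lift q) * (\<Theta> (lift r) - r) + r * (\<Theta> (lift q) - q) \<in> binomial_ideal"
    by (intro binomial_ideal_add binomial_ideal_mult mult)
  then show ?case by (simp add: lift_simps \<Theta>_simps algebra_simps)
qed (simp_all add: lift_simps \<Theta>_simps emb_const emb_var binomial_ideal_zero)

text \<open>In the edge module \<open>x\<^sub>i f\<^sub>j = x\<^sub>j f\<^sub>i\<close>, and both sides are linear in the indeterminates modulo the relations.\<close>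
lemma lift_move:
  assumes "{i, j} \<in> E"
  shows "lift (single (xm i + ym j) 1 - single (xm j + ym i) 1 :: (nat + nat, 'k::field) mpoly) \<in> relids"
proof -
  have V: "i \<in> V" "j \<in> V" using edgeD[OF assms] by auto
  let ?e = "\<lambda>i. cls (basis_vec i) :: (nat \<Rightarrow> (nat, 'k) mpoly) set"
  have "mp_var i \<odot>\<^bsub>M\<^esub> ?e j = mp_var j \<odot>\<^bsub>M\<^esub> ?e i"
    using relation_in_edge_relations[OF assms] V by (simp add: smult_edge_module cls_eq_iff)
  moreover have "(mp_var (mp_var j \<odot>\<^bsub>M\<^esub> ?e i) - mp_const (mp_var j) * mp_var (?e i))
      - (mp_var (mp_var i \<odot>\<^bsub>M\<^esub> ?e j) - mp_const (mp_var i) * mp_var (?e j)) \<in> relids"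
    using V by (intro relids_diff relids_relation cls_basis_carrier PV_var) auto
  ultimately have *: "mp_const (mp_var i) * mp_var (?e j) - mp_const (mp_var j) * mp_var (?e i) \<in> relids"
    by simp
  have "(single (xm i + ym j) 1 :: (nat + nat, 'k) mpoly) = mp_var (Inl i) * mp_var (Inr j)" for i j
    by (simp add: mp_var_def mult_single)
  with * show ?thesis by (simp add: lift_simps)
qed

lemma lift_binomial_ideal:
  assumes "q \<in> binomial_ideal" and qV: "q \<in> PV (xy_vars n)"
  shows "lift q \<in> relids"
  using assms(1)
proof (induction q rule: binomial_ideal_induct)
  case (binomial m m' a)
  have "m \<in> monomials (xy_vars n)" using qV binomial(1) by (auto simp: PV_def)
  with binomial(2) show ?case
  proof (induction rule: equivalent.induct)
    case (step m t i j)
    have "t \<in> monomials (xy_vars n)" using equivalent_monomials[OF step(1)] step(4) by simp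
    then have "lift (single t a) \<in> carrier cover" by (intro lift_carrier PV_single)
    from relids_mult[OF lift_move[OF step(2)] this]
    have "lift (single (t + xm i + ym j) a - single (t + xm j + ym i) a) \<in> relids"
      by (simp add: lift_simps(3)[symmetric] right_diff_distrib mult_single add.assoc)
    from relids_add[OF step(3)[OF step(4)] this] show ?case by (simp add: lift_simps)
  qed (simp add: lift_simps relids_zero)
qed (simp_all add: lift_simps relids_zero relids_add)

lemma cls_zero_carrier: "cls (\<lambda>i. 0) \<in> carrier M"
  unfolding carrier_edge_module by (intro imageI vecs_zero)

lemma var_zero_relids: "mp_var (cls (\<lambda>i. 0)) \<in> relids"
  using relids_relation(2)[OF PV_zero cls_zero_carrier] by (simp add: smult_edge_module)

text \<open>Adding one coordinate of \<open>f\<close> at a time, each step uses one additivity and one scalar relation of the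
symmetric algebra.\<close>
lemma lift_vecpoly:
  assumes f: "f \<in> vecs V V"
  shows "lift (vecpoly f) - mp_var (cls f) \<in> relids"
proof -
  have "(\<Sum>i\<in>A. mp_const (f i) * mp_var (cls (basis_vec i))) - mp_var (cls (\<lambda>i. if i \<in> A then f i else 0)) \<in> relids"
    if "finite A" "A \<subseteq> V" for A
    using that
  proof (induction A rule: finite_induct)
    case empty
    then show ?case using relids_uminus[OF var_zero_relids] by simp
  next
    case (insert i A)
    have i: "i \<in> V" "f i \<in> PV V" using insert vecs_PV[OF f] by auto
    let ?g = "\<lambda>i. if i \<in> A then f i else 0"
    have g: "cls ?g \<in> carrier M" unfolding carrier_edge_module
      by (intro imageI) (use f insert in \<open>auto simp: vecs_def\<close>)
    have e: "cls (basis_vec i) \<in> carrier M" by (rule cls_basis_carrier[OF i(1)])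
    note fe = edge_module_closed(2)[OF i(2) e]
    have "cls ?g \<oplus>\<^bsub>M\<^esub> (f i \<odot>\<^bsub>M\<^esub> cls (basis_vec i)) = cls (\<lambda>l. ?g l + f i * basis_vec i l)"
      by (simp add: smult_edge_module i add_edge_module)
    also have "(\<lambda>l. ?g l + f i * basis_vec i l) = (\<lambda>l. if l \<in> insert i A then f l else 0)"
      using insert by (auto simp: basis_vec_def)
    finally have eq: "cls (\<lambda>l. if l \<in> insert i A then f l else 0) = cls ?g \<oplus>\<^bsub>M\<^esub> (f i \<odot>\<^bsub>M\<^esub> cls (basis_vec i))" by simp
    have IH: "(\<Sum>i\<in>A. mp_const (f i) * mp_var (cls (basis_vec i))) - mp_var (cls ?g) \<in> relids"
      using insert by simp
    from relids_diff[OF relids_diff[OF IH relids_relation(1)[OF g fe]] relids_relation(2)[OF i(2) e]]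
    show ?case unfolding eq using insert by (simp add: algebra_simps)
  qed
  from this[of V] have "(\<Sum>i\<in>V. mp_const (f i) * mp_var (cls (basis_vec i))) - mp_var (cls (\<lambda>i. if i \<in> V then f i else 0)) \<in> relids"
    by simp
  moreover have "(\<lambda>i. if i \<in> V then f i else 0) = f" using f by (auto simp: vecs_def)
  moreover have "lift (vecpoly f) = (\<Sum>i\<in>V. mp_const (f i) * mp_var (cls (basis_vec i)))"
    by (simp add: vecpoly_def lift_sum lift_emb_basis)
  ultimately show ?thesis by simp
qed

lemma lift_\<Theta>: "p \<in> carrier cover \<Longrightarrow> lift (\<Theta> p) - p \<in> relids"
proof -
  assume "p \<in> carrier cover"
  then have "p \<in> carrier cover \<and> lift (\<Theta> p) \<in> carrier cover \<and> lift (\<Theta> p) - p \<in> relids"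
  proof (induction p rule: cover_induct)
    case (const s)
    then show ?case by (simp add: \<Theta>_simps lift_emb_0 cover_const relids_zero)
  next
    case (var X)
    then show ?case
      using lift_vecpoly[OF rep(1)[OF var]] rep(2)[OF var] lift_carrier[OF vecpoly_PV[OF rep(1)[OF var]]]
      by (simp add: \<Theta>_simps cover_var)
  next
    case (add q r)
    then have "(lift (\<Theta> q) - q) + (lift (\<Theta> r) - r) \<in> relids" by (intro relids_add) auto
    with add show ?case by (simp add: \<Theta>_simps lift_simps cover_closed algebra_simps)
  next
    case (mult q r)
    then have "lift (\<Theta> q) * (lift (\<Theta> r) - r) + r * (lift (\<Theta> q) - q) \<in> relids"
      by (intro relids_add relids_mult) auto
    with mult show ?case by (simp add: \<Theta>_simps lift_simps cover_closed algebra_simps)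
  qed
  then show ?thesis by blast
qed

lemma relids_iff: "p \<in> carrier cover \<Longrightarrow> p \<in> relids \<longleftrightarrow> \<Theta> p \<in> binomial_ideal"
proof
  assume p: "p \<in> carrier cover" "\<Theta> p \<in> binomial_ideal"
  have "lift (\<Theta> p) \<in> relids" by (rule lift_binomial_ideal[OF p(2) \<Theta>_PV[OF p(1)]])
  from relids_diff[OF this lift_\<Theta>[OF p(1)]] show "p \<in> relids" by simp
qed (rule \<Theta>_relids)

lemma lift_relids_iff: "q \<in> PV (xy_vars n) \<Longrightarrow> lift q \<in> relids \<longleftrightarrow> q \<in> binomial_ideal"
proof
  assume q: "q \<in> PV (xy_vars n)" "lift q \<in> relids"
  from binomial_ideal_diff[OF \<Theta>_relids[OF q(2)] \<Theta>_lift[OF q(1)]] show "q \<in> binomial_ideal" by simp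
qed (rule lift_binomial_ideal)

lemma sym_class_eq_iff:
  assumes "p \<in> carrier cover" "q \<in> carrier cover"
  shows "sym_class S M p = sym_class S M q \<longleftrightarrow> p - q \<in> relids"
proof -
  interpret cring cover by (rule cring_cover)
  show ?thesis
    using quotient_eq_iff_same_a_r_cos[OF ideal_relids assms] cover_minus[OF assms]
    by (simp add: sym_class_def)
qed

lemma sym_class_0: "\<zero>\<^bsub>sym_algebra S M\<^esub> = sym_class S M 0"
  by (simp add: sym_algebra_def FactRing_def sym_class_def a_r_coset_def' cover_ops)

lemma sym_class_zero_iff:
  assumes "p \<in> carrier cover"
  shows "sym_class S M p = \<zero>\<^bsub>sym_algebra S M\<^esub> \<longleftrightarrow> p \<in> relids"
  using sym_class_eq_iff[OF assms cover_closed(4)] by (simp add: sym_class_0)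

text \<open>A polynomial in \<open>y\<close> over \<open>K[x]\<close> vanishes in the symmetric algebra if and only if its lift lies in the ideal of
relations, which by the comparison of both presentations means that it lies in the binomial ideal.\<close>
lemma defining_ideal_eq: "defining_ideal n E = binomial_ideal \<inter> PV (xy_vars n)"
proof -
  have "defining_ideal n E = {q \<in> PV (xy_vars n). sym_class S M (lift q) = \<zero>\<^bsub>sym_algebra S M\<^esub>}"
    by (simp add: defining_ideal_def a_kernel_def kernel_def carrier_mpoly_ring sym_presentation_def lift_def)
  then show ?thesis
    using sym_class_zero_iff[OF lift_carrier] lift_relids_iff by auto
qed

end

section \<open>Initial ideals and the x-condition\<close>

lemma cring_PV: "cring (mpoly_ring UNIV W)"
  by (rule cring_mpoly_ring(1)) auto

lemma mpoly_ideal_closed: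
  assumes "ideal I (mpoly_ring UNIV W)" "p \<in> I" "q \<in> PV W"
  shows "q * p \<in> I"
  using ideal.I_l_closed[OF assms(1,2), of q] assms(3)
  by (simp add: carrier_mpoly_ring) (simp add: mpoly_ring_def)

lemma mpoly_idealI:
  assumes "K \<subseteq> PV W" "0 \<in> K" "\<And>p q. p \<in> K \<Longrightarrow> q \<in> K \<Longrightarrow> p + q \<in> K"
    "\<And>p q. p \<in> K \<Longrightarrow> q \<in> PV W \<Longrightarrow> q * p \<in> K"
  shows "ideal K (mpoly_ring UNIV W)"
proof -
  let ?R = "mpoly_ring UNIV W"
  interpret R: cring ?R by (rule cring_PV)
  have ops: "add ?R = (+)" "mult ?R = (*)" "zero ?R = 0" by (simp_all add: mpoly_ring_def)
  have neg: "- p \<in> K" if "p \<in> K" for p using assms(4)[OF that, of "- 1"] by simp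
  have inv: "inv\<^bsub>add_monoid ?R\<^esub> p = - p" if "p \<in> K" for p
    using R.minus_equality[of "- p" p] that assms(1) neg[OF that]
    by (auto simp: carrier_mpoly_ring ops a_inv_def)
  have "subgroup K (add_monoid ?R)"
    by (rule subgroup.intro) (use assms inv neg in \<open>auto simp: carrier_mpoly_ring ops\<close>)
  then show ?thesis
    by (rule idealI[OF R.ring_axioms])
      (use assms(4) in \<open>auto simp: carrier_mpoly_ring ops mult.commute[of _ "_ :: _ \<Rightarrow>\<^sub>0 _"]\<close>)
qed

lemma monomial_orderD:
  assumes "monomial_order W r"
  shows mo_refl: "u \<in> monomials W \<Longrightarrow> (u, u) \<in> r"
    and mo_trans: "(u, v) \<in> r \<Longrightarrow> (v, w) \<in> r \<Longrightarrow> (u, w) \<in> r"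
    and mo_antisym: "(u, v) \<in> r \<Longrightarrow> (v, u) \<in> r \<Longrightarrow> u = v"
    and mo_total: "u \<in> monomials W \<Longrightarrow> v \<in> monomials W \<Longrightarrow> (u, v) \<in> r \<or> (v, u) \<in> r"
    and mo_add: "(u, v) \<in> r \<Longrightarrow> w \<in> monomials W \<Longrightarrow> (u + w, v + w) \<in> r"
proof -
  have lin: "linear_order_on (monomials W) r" using assms by (simp add: monomial_order_def)
  then have ref: "refl_on (monomials W) r" and tr: "trans r" and an: "antisym r" and to: "total_on (monomials W) r"
    by (auto simp: linear_order_on_def partial_order_on_def preorder_on_def)
  show refl: "u \<in> monomials W \<Longrightarrow> (u, u) \<in> r" for u using ref by (rule refl_onD)
  show "(u, v) \<in> r \<Longrightarrow> (v, w) \<in> r \<Longrightarrow> (u, w) \<in> r" using tr by (rule transD)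
  show "(u, v) \<in> r \<Longrightarrow> (v, u) \<in> r \<Longrightarrow> u = v" using an by (rule antisymD)
  show "u \<in> monomials W \<Longrightarrow> v \<in> monomials W \<Longrightarrow> (u, v) \<in> r \<or> (v, u) \<in> r"
    using to refl unfolding total_on_def by metis
  show "(u, v) \<in> r \<Longrightarrow> w \<in> monomials W \<Longrightarrow> (u + w, v + w) \<in> r"
    using assms unfolding monomial_order_def by blast
qed

lemma initial_monomialI:
  assumes r: "monomial_order W r" and m: "m \<in> keys p" "\<And>v. v \<in> keys p \<Longrightarrow> (v, m) \<in> r"
  shows "initial_monomial r p = m"
  unfolding initial_monomial_def
proof (rule the_equality)
  fix u assume "u \<in> keys p \<and> (\<forall>v\<in>keys p. (v, u) \<in> r)"
  with m show "u = m" by (intro mo_antisym[OF r]) auto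
qed (use m in auto)

lemma initial_monomial_max:
  assumes r: "monomial_order W r" and p: "p \<in> PV W" "p \<noteq> 0"
  shows "initial_monomial r p \<in> keys p" "v \<in> keys p \<Longrightarrow> (v, initial_monomial r p) \<in> r"
proof -
  have "\<exists>m\<in>X. \<forall>v\<in>X. (v, m) \<in> r" if "finite X" "X \<noteq> {}" "X \<subseteq> monomials W" for X
    using that
  proof (induction X rule: finite_ne_induct)
    case (singleton x)
    then show ?case using mo_refl[OF r] by simp
  next
    case (insert x X)
    then obtain m where m: "m \<in> X" "\<And>v. v \<in> X \<Longrightarrow> (v, m) \<in> r" by auto
    have "(x, m) \<in> r \<or> (m, x) \<in> r" using insert m(1) by (intro mo_total[OF r]) auto
    then show ?case
    proof
      assume "(x, m) \<in> r" with m show ?thesis by blast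
    next
      assume "(m, x) \<in> r"
      then have "\<forall>v\<in>insert x X. (v, x) \<in> r" using m(2) mo_trans[OF r] mo_refl[OF r] insert.prems by blast
      then show ?thesis by blast
    qed
  qed
  from this[of "keys p"] p obtain m where m: "m \<in> keys p" "\<And>v. v \<in> keys p \<Longrightarrow> (v, m) \<in> r"
    by (auto simp: PV_def)
  from initial_monomialI[OF r m] m
  show "initial_monomial r p \<in> keys p" "v \<in> keys p \<Longrightarrow> (v, initial_monomial r p) \<in> r" by simp_all
qed

text \<open>The polynomials all of whose monomials are multiples of initial monomials form an ideal, so the ideal
generated by the initial monomials contains no others.\<close>
lemma initial_ideal_monomial_iff:
  fixes J :: "('v, 'k::field) mpoly set"
  assumes r: "monomial_order W r" and J: "J \<subseteq> PV W" and m: "m \<in> monomials W"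
  shows "single m 1 \<in> initial_ideal W r J \<longleftrightarrow> (\<exists>p\<in>J. p \<noteq> 0 \<and> (\<exists>t. m = t + initial_monomial r p))"
proof -
  let ?R = "mpoly_ring UNIV W :: ('v, 'k) mpoly ring"
  interpret R: cring ?R by (rule cring_PV)
  let ?G = "{single (initial_monomial r p) 1 |p. p \<in> J \<and> p \<noteq> 0} :: ('v, 'k) mpoly set"
  have G: "?G \<subseteq> carrier ?R"
    unfolding carrier_mpoly_ring
  proof
    fix g assume "g \<in> ?G"
    then obtain p where p: "p \<in> J" "p \<noteq> 0" "g = single (initial_monomial r p) 1" by blast
    then have "initial_monomial r p \<in> keys p" "keys p \<subseteq> monomials W"
      using initial_monomial_max(1)[OF r] J by (auto simp: PV_def)
    then show "g \<in> PV W" unfolding p(3) by (intro PV_single) blast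
  qed
  let ?D = "\<lambda>m. \<exists>p\<in>J. p \<noteq> 0 \<and> (\<exists>t. m = t + initial_monomial r p)"
  show ?thesis
  proof
    let ?K = "{q \<in> PV W. \<forall>m\<in>keys q. ?D m} :: ('v, 'k) mpoly set"
    have "ideal ?K ?R"
    proof (rule mpoly_idealI)
      show "p + q \<in> ?K" if "p \<in> ?K" "q \<in> ?K" for p q using that keys_add[of p q] by blast
      show "q * p \<in> ?K" if p: "p \<in> ?K" and q: "q \<in> PV W" for p q
      proof -
        have "?D m" if m: "m \<in> keys (q * p)" for m
        proof -
          obtain a b where ab: "m = a + b" "b \<in> keys p" using keys_mult[of q p] m by blast
          then obtain f t where "f \<in> J" "f \<noteq> 0" "b = t + initial_monomial r f" using p by blast
          then show ?thesis by (intro bexI[of _ f]) (auto simp: ab(1) add.assoc[symmetric])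
        qed
        then show ?thesis using p q by blast
      qed
    qed auto
    moreover have "?G \<subseteq> ?K"
    proof
      fix g assume "g \<in> ?G"
      then obtain p where p: "p \<in> J" "p \<noteq> 0" "g = single (initial_monomial r p) 1" by blast
      have "?D (initial_monomial r p)" using p by (intro bexI[of _ p]) (auto intro: exI[of _ 0])
      then show "g \<in> ?K" using G \<open>g \<in> ?G\<close> p(3) by (auto simp: carrier_mpoly_ring)
    qed
    ultimately have "initial_ideal W r J \<subseteq> ?K"
      unfolding initial_ideal_def by (rule R.genideal_minimal)
    then show "single m 1 \<in> initial_ideal W r J \<Longrightarrow> ?D m" by auto
  next
    assume "?D m"
    then obtain p t where p: "p \<in> J" "p \<noteq> 0" "m = t + initial_monomial r p" by blast
    have "single (initial_monomial r p) 1 \<in> initial_ideal W r J"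
      unfolding initial_ideal_def using R.genideal_self[OF G] p by blast
    moreover have "single t 1 \<in> PV W" using m p(3) by (intro PV_single) simp
    moreover have "ideal (initial_ideal W r J) ?R" unfolding initial_ideal_def by (rule R.genideal_ideal[OF G])
    ultimately have "single t 1 * single (initial_monomial r p) 1 \<in> initial_ideal W r J"
      by (intro mpoly_ideal_closed)
    then show "single m 1 \<in> initial_ideal W r J" by (simp add: mult_single p(3))
  qed
qed

lemma lookup_two_le_mon_deg: "v \<noteq> v' \<Longrightarrow> lookup m v + lookup m v' \<le> mon_deg m"
proof -
  assume "v \<noteq> v'"
  then have "lookup m v + lookup m v' = (\<Sum>x\<in>{v, v'}. lookup m x)" by simp
  also have "\<dots> \<le> (\<Sum>x\<in>keys m \<union> {v, v'}. lookup m x)" by (rule sum_mono2) auto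
  also have "\<dots> = mon_deg m" by (rule mon_deg_superset[symmetric]) auto
  finally show ?thesis .
qed

text \<open>A monomial of a monomial ideal that is not a minimal generator has a proper divisor in the ideal, of
smaller degree.\<close>
lemma minimal_generator_exists:
  assumes "single m 1 \<in> I" "m \<in> monomials W"
  shows "\<exists>v t. m = v + t \<and> v \<in> minimal_monomial_generators W I"
  using assms
proof (induction "mon_deg m" arbitrary: m rule: less_induct)
  case less
  show ?case
  proof (cases "m \<in> minimal_monomial_generators W I")
    case True
    then show ?thesis by (intro exI[of _ m] exI[of _ 0]) simp
  next
    case False
    then obtain v w where vw: "m = v + w" "single v 1 \<in> I" "v \<noteq> m"
      using less.prems unfolding minimal_monomial_generators_def by blast
    have "w \<noteq> 0" using vw by auto
    then have "mon_deg v < mon_deg m" using vw(1) by (simp add: neq0_conv[symmetric] del: neq0_conv)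
    moreover have "v \<in> monomials W" using less.prems(2) vw(1) by simp
    ultimately obtain v' t where "v = v' + t" "v' \<in> minimal_monomial_generators W I"
      using less.hyps vw(2) by blast
    then show ?thesis using vw(1) by (intro exI[of _ v'] exI[of _ "t + w"]) (simp add: add.assoc)
  qed
qed

context edge_graph
begin

abbreviation J :: "(nat + nat, 'k::field) mpoly set" where "J \<equiv> binomial_ideal \<inter> PV (xy_vars n)"

lemma monomials_xm [simp]: "xm i \<in> monomials (xy_vars n) \<longleftrightarrow> i \<in> V" "ym i \<in> monomials (xy_vars n) \<longleftrightarrow> i \<in> V"
  by (auto simp: monomials_def xy_vars_def)

lemma binomial_initial:
  assumes r: "monomial_order (xy_vars n) r" and eq: "m \<approx> m'" "m \<noteq> m'" and mV: "m \<in> monomials (xy_vars n)"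
    and less: "(m', m) \<in> r"
  shows "single m 1 \<in> initial_ideal (xy_vars n) r (J :: (nat + nat, 'k::field) mpoly set)"
proof -
  let ?p = "single m 1 - single m' 1 :: (nat + nat, 'k) mpoly"
  have m'V: "m' \<in> monomials (xy_vars n)" using equivalent_monomials[OF eq(1)] mV by simp
  have keys: "keys ?p = {m, m'}"
    using eq(2) by (auto simp: in_keys_iff lookup_minus lookup_single when_def split: if_splits)
  have "?p \<in> J"
    using binomial_in_binomial_ideal[OF eq(1)] mV m'V by (auto intro: PV_single)
  moreover have "?p \<noteq> 0" using keys by auto
  moreover have "initial_monomial r ?p = m"
    by (rule initial_monomialI[OF r]) (use keys less mo_refl[OF r mV] in auto)
  ultimately have "\<exists>p\<in>J :: (nat + nat, 'k) mpoly set. p \<noteq> 0 \<and> (\<exists>t. m = t + initial_monomial r p)"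
    by (intro bexI[of _ ?p] conjI exI[of _ 0]) simp_all
  then show ?thesis using initial_ideal_monomial_iff[OF r _ mV, of J] by blast
qed

lemma equivalent_trivial:
  assumes "g \<approx> m'" and "\<And>i j. i \<in> support g \<Longrightarrow> j \<in> support g \<Longrightarrow> {i, j} \<notin> E"
  shows "m' = g"
  using assms
proof (induction rule: equivalent.induct)
  case (step m t i j)
  have "support m = support (t + xm i + ym j)" using equivalent_support[OF step(1)] by simp
  then have "i \<in> support m" "j \<in> support m" by (simp_all add: support_def multideg_add)
  with step(2,4) show ?case by blast
qed simp

lemma equivalent_xdeg: "m \<approx> m' \<Longrightarrow> mon_deg (xpart m') = mon_deg (xpart m)"
  by (induction rule: equivalent.induct) (auto simp: xpart_add)

text \<open>Exchanges preserve the number of \<open>x\<close>'s and the multidegree, which leaves only two monomials.\<close>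
lemma equivalent_edge:
  assumes "xm m + ym a \<approx> m'" "m' \<noteq> xm m + ym a" "m \<noteq> a"
  shows "m' = xm a + ym m"
proof -
  have "mon_deg (xpart m') = 1" using equivalent_xdeg[OF assms(1)] by (simp add: xpart_add)
  then have "mon_deg (xpart m') = Suc 0" by simp
  then obtain c where c: "xpart m' = single c 1" using mon_deg_eq_1 by blast
  have x: "lookup m' (Inl i) = (if i = c then 1 else 0)" for i
    using arg_cong[OF c, of "\<lambda>w. lookup w i"] by (simp add: lookup_single when_def)
  have md: "lookup m' (Inl i) + lookup m' (Inr i) = of_bool (m = i) + of_bool (a = i)" for i
  proof -
    have "multideg m' i = of_bool (m = i) + of_bool (a = i)"
      using fun_cong[OF equivalent_multideg[OF assms(1)], of i] by (simp only: multideg_add multideg_single)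
    then show ?thesis by (simp only: multideg_def)
  qed
  have "c = m \<or> c = a" using md[of c] x[of c] by (auto simp: of_bool_def split: if_splits)
  then show ?thesis
  proof
    assume "c = m"
    have "m' = xm m + ym a"
    proof (rule sum_mon_eqI)
      show "lookup m' (Inl i) = lookup (xm m + ym a) (Inl i)" for i
        using x[of i] \<open>c = m\<close> by (simp add: lookup_add lookup_single when_def)
      show "lookup m' (Inr i) = lookup (xm m + ym a) (Inr i)" for i
        using x[of i] md[of i] \<open>c = m\<close> by (auto simp: lookup_add lookup_single when_def of_bool_def split: if_splits)
    qed
    with assms show ?thesis by blast
  next
    assume "c = a"
    show ?thesis
    proof (rule sum_mon_eqI)
      show "lookup m' (Inl i) = lookup (xm a + ym m) (Inl i)" for i
        using x[of i] \<open>c = a\<close> by (simp add: lookup_add lookup_single when_def)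
      show "lookup m' (Inr i) = lookup (xm a + ym m) (Inr i)" for i
        using x[of i] md[of i] \<open>c = a\<close> by (auto simp: lookup_add lookup_single when_def of_bool_def split: if_splits)
    qed
  qed
qed

text \<open>Here \<open>a\<close> and \<open>b\<close> are non-adjacent neighbours of \<open>m\<close>. Exchanging along \<open>b - m - a\<close>, the binomial
\<open>x\<^sub>m x\<^sub>b y\<^sub>a - x\<^sub>m x\<^sub>a y\<^sub>b\<close> lies in \<open>J\<close> and has initial monomial \<open>x\<^sub>m x\<^sub>b y\<^sub>a\<close>. By the \<open>x\<close>-condition this is divisible by an
initial monomial \<open>g\<close> of an element of \<open>J\<close> with at most one \<open>x\<close>. If \<open>g\<close> lives on \<open>a\<close> and \<open>b\<close> only, or on \<open>m\<close> only, it admits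
no exchange at all. Otherwise \<open>g = x\<^sub>m y\<^sub>a\<close>, and its only other equivalent monomial \<open>x\<^sub>a y\<^sub>m\<close> is larger. Both
contradict that the element of \<open>J\<close> contains a smaller term equivalent to \<open>g\<close>.\<close>
lemma x_condition_no_valley:
  assumes r: "monomial_order (xy_vars n) r" and x: "x_condition n r (J :: (nat + nat, 'k::field) mpoly set)"
    and E: "{m, a} \<in> E" "{m, b} \<in> E" "{a, b} \<notin> E" "a \<noteq> b"
    and le: "(xm m + ym a, xm a + ym m) \<in> r" "(xm a + ym b, xm b + ym a) \<in> r"
  shows False
proof -
  have V: "m \<in> V" "a \<in> V" "b \<in> V" and ne: "m \<noteq> a" "m \<noteq> b" using edgeD[OF E(1)] edgeD[OF E(2)] by auto
  let ?u = "xm m + xm b + ym a" and ?u' = "xm m + xm a + ym b"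
  have uV: "?u \<in> monomials (xy_vars n)" using V by simp
  have eq: "?u \<approx> ?u'"
  proof (rule equivalent_swap)
    have "m \<in> support ?u" "a \<in> support ?u" "b \<in> support ?u" by (simp_all add: support_def multideg_add)
    then have "(b, m) \<in> edges_in E (support ?u)" "(m, a) \<in> edges_in E (support ?u)"
      using E(1,2) by (simp_all add: edges_in_def insert_commute)
    then show "(b, a) \<in> (edges_in E (support ?u))\<^sup>*" by (meson r_into_rtrancl rtrancl_trans)
  qed
  have "lookup ?u (Inl b) \<noteq> lookup ?u' (Inl b)" using E(4) ne by (simp add: lookup_add lookup_single)
  then have "?u \<noteq> ?u'" by metis
  moreover have "(?u', ?u) \<in> r"
    using mo_add[OF r le(2), of "xm m"] V by (simp add: add_ac)
  ultimately have "single ?u 1 \<in> initial_ideal (xy_vars n) r (J :: (nat + nat, 'k) mpoly set)"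
    by (intro binomial_initial[OF r eq _ uV])
  from minimal_generator_exists[OF this uV] obtain v t where
    v: "?u = v + t" "v \<in> minimal_monomial_generators (xy_vars n) (initial_ideal (xy_vars n) r (J :: (nat + nat, 'k) mpoly set))"
    by blast
  from x v(2) obtain v1 w1 where vw: "v = v1 + w1" "mon_deg v1 \<le> 1" "w1 \<in> monomials (Inr ` V)"
    unfolding x_condition_def by blast
  have vV: "v \<in> monomials (xy_vars n)" and vI: "single v 1 \<in> initial_ideal (xy_vars n) r (J :: (nat + nat, 'k) mpoly set)"
    using v(2) by (simp_all add: minimal_monomial_generators_def)
  have "\<exists>p\<in>J :: (nat + nat, 'k) mpoly set. p \<noteq> 0 \<and> (\<exists>t. v = t + initial_monomial r p)"
    using initial_ideal_monomial_iff[OF r _ vV, of J] vI by blast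
  then obtain p :: "(nat + nat, 'k) mpoly" and t' where p: "p \<in> J" "p \<noteq> 0" "v = t' + initial_monomial r p"
    by blast
  define g where "g = initial_monomial r p"
  have g: "g \<in> keys p" "\<And>m'. m' \<in> keys p \<Longrightarrow> (m', g) \<in> r"
    using initial_monomial_max[OF r _ p(2)] p(1) unfolding g_def by blast+
  obtain m' where m': "m' \<in> keys p" "m' \<noteq> g" "g \<approx> m'"
    using binomial_ideal_other_term[of p g] p(1) g(1) by blast
  have u: "lookup ?u k = lookup t' k + lookup g k + lookup t k" for k
    unfolding v(1) p(3) g_def by (simp add: lookup_add)
  have gu: "lookup g k \<le> lookup ?u k" for k using u[of k] by simp
  have gx: "lookup g (Inl i) = 0" if "i \<noteq> m" "i \<noteq> b" for i
    using gu[of "Inl i"] that by (simp add: lookup_add lookup_single)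
  have gy: "lookup g (Inr i) = 0" if "i \<noteq> a" for i
    using gu[of "Inr i"] that by (simp add: lookup_add lookup_single)
  have gm: "lookup g (Inl m) \<le> 1" "lookup g (Inr a) \<le> 1"
    using gu[of "Inl m"] gu[of "Inr a"] ne by (simp_all add: lookup_add lookup_single)
  have sum1: "lookup g (Inl m) + lookup g (Inl b) \<le> 1"
  proof -
    have w1: "lookup w1 (Inl i) = 0" for i
      using vw(3) by (auto simp: monomials_def in_keys_iff)
    have "lookup g (Inl i) \<le> lookup v1 (Inl i)" for i
      using arg_cong[OF p(3), of "\<lambda>w. lookup w (Inl i)"] w1[of i]
      by (simp add: vw(1) g_def lookup_add)
    then have "lookup g (Inl m) + lookup g (Inl b) \<le> lookup v1 (Inl m) + lookup v1 (Inl b)"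
      by (intro add_mono)
    also have "\<dots> \<le> mon_deg v1" by (rule lookup_two_le_mon_deg) (use ne in simp)
    finally show ?thesis using vw(2) by simp
  qed
  have loops: "{i, i} \<notin> E" for i using edgeD[of i i] by blast
  have E': "{b, a} \<notin> E" using E(3) by (simp add: insert_commute)
  have "support g \<subseteq> {a, b} \<or> support g \<subseteq> {m} \<or> g = xm m + ym a"
  proof (cases "lookup g (Inl m) = 0")
    case True
    have "i \<in> {a, b}" if i: "i \<in> support g" for i
      using i gx[of i] gy[of i] True by (cases "i = m"; cases "i = a") (auto simp: support_def multideg_def)
    then show ?thesis by blast
  next
    case False
    then have 1: "lookup g (Inl m) = 1" "lookup g (Inl b) = 0" using gm sum1 by auto
    show ?thesis
    proof (cases "lookup g (Inr a) = 0")
      case True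
      have "i \<in> {m}" if i: "i \<in> support g" for i
        using i gx[of i] gy[of i] 1 True by (cases "i = a"; cases "i = b") (auto simp: support_def multideg_def)
      then show ?thesis by blast
    next
      case False
      have "g = xm m + ym a"
      proof (rule sum_mon_eqI)
        show "lookup g (Inl i) = lookup (xm m + ym a) (Inl i)" for i
          using gx[of i] 1 by (cases "i = m"; cases "i = b") (auto simp: lookup_add lookup_single)
        show "lookup g (Inr i) = lookup (xm m + ym a) (Inr i)" for i
          using gy[of i] gm False by (cases "i = a") (auto simp: lookup_add lookup_single)
      qed
      then show ?thesis by blast
    qed
  qed
  then show False
  proof (elim disjE)
    assume s: "support g \<subseteq> {a, b}"
    have "m' = g"
    proof (rule equivalent_trivial[OF m'(3)])
      fix i j assume "i \<in> support g" "j \<in> support g"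
      then have "i = a \<or> i = b" "j = a \<or> j = b" using s by auto
      then show "{i, j} \<notin> E" using loops E(3) E' by blast
    qed
    with m'(2) show False ..
  next
    assume s: "support g \<subseteq> {m}"
    have "m' = g"
    proof (rule equivalent_trivial[OF m'(3)])
      fix i j assume "i \<in> support g" "j \<in> support g"
      then have "i = m" "j = m" using s by auto
      then show "{i, j} \<notin> E" using loops by blast
    qed
    with m'(2) show False ..
  next
    assume s: "g = xm m + ym a"
    have "m' = xm a + ym m" using equivalent_edge[of m a m'] m' ne(1) s by simp
    then have "m' = g" using mo_antisym[OF r, of m' g] g(2)[OF m'(1)] le(1) s by simp
    with m'(2) show False ..
  qed
qed

text \<open>Comparing \<open>x\<^sub>a y\<^sub>b\<close> with \<open>x\<^sub>b y\<^sub>a\<close> defines a total order on the vertices, transitive because monomial orders are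
compatible with multiplication. The smallest vertex of an induced cycle together with its two neighbours
on the cycle is the configuration excluded by the preceding lemma.\<close>
theorem x_condition_chordal:
  assumes r: "monomial_order (xy_vars n) r" and x: "x_condition n r (J :: (nat + nat, 'k::field) mpoly set)"
  shows "chordal n E"
  unfolding chordal_def
proof
  assume "\<exists>vs. induced_cycle n E vs \<and> 4 \<le> length vs"
  then obtain vs where cyc: "induced_cycle n E vs" "4 \<le> length vs" by blast
  let ?l = "length vs"
  have dist: "distinct vs" and WV: "set vs \<subseteq> V" using cyc by (auto simp: induced_cycle_def)
  define le where "le a b \<longleftrightarrow> (xm a + ym b, xm b + ym a) \<in> r" for a b
  have le_total: "le a b \<or> le b a" if "a \<in> V" "b \<in> V" for a b
    unfolding le_def using that by (intro mo_total[OF r]) (simp_all del: atLeastAtMost_iff)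
  \<comment> \<open>Multiplying by a third \<open>y\<close> makes the comparisons composable.\<close>
  have le_trans: "le a c" if V: "a \<in> V" "b \<in> V" "c \<in> V" and ab: "le a b" and bc: "le b c" for a b c
  proof (rule ccontr)
    assume "\<not> le a c"
    then have ca: "le c a" using le_total V by blast
    have "(xm a + ym b + ym c, xm b + ym a + ym c) \<in> r"
      using mo_add[OF r ab[unfolded le_def], of "ym c"] V by (simp del: atLeastAtMost_iff)
    moreover have "(xm b + ym a + ym c, xm c + ym b + ym a) \<in> r"
      using mo_add[OF r bc[unfolded le_def], of "ym a"] V by (simp add: add_ac del: atLeastAtMost_iff)
    ultimately have 1: "(xm a + ym b + ym c, xm c + ym b + ym a) \<in> r" by (rule mo_trans[OF r])
    have "(xm c + ym b + ym a, xm a + ym b + ym c) \<in> r"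
      using mo_add[OF r ca[unfolded le_def], of "ym b"] V by (simp add: add_ac del: atLeastAtMost_iff)
    from mo_antisym[OF r 1 this] have eq: "xm a + ym b + ym c = xm c + ym b + ym a" .
    have "lookup (xm a + ym b + ym c) (Inl a) = lookup (xm c + ym b + ym a) (Inl a)" unfolding eq ..
    then have "a = c" by (simp add: lookup_add lookup_single when_def split: if_splits)
    with ca \<open>\<not> le a c\<close> show False by simp
  qed
  have "\<exists>m\<in>X. \<forall>b\<in>X. le m b" if "finite X" "X \<noteq> {}" "X \<subseteq> V" for X
    using that
  proof (induction X rule: finite_ne_induct)
    case (singleton x)
    then show ?case using le_total[of x x] by auto
  next
    case (insert x X)
    have "X \<subseteq> V" using insert.prems by blast
    from insert.IH[OF this] obtain m where "m \<in> X" "\<forall>b\<in>X. le m b" by blast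
    then have m: "m \<in> X" "\<And>b. b \<in> X \<Longrightarrow> le m b" by blast+
    have V: "x \<in> V" "m \<in> V" "X \<subseteq> V" using insert.prems m(1) by auto
    show ?case
    proof (cases "le m x")
      case True with m show ?thesis by blast
    next
      case False
      then have xm: "le x m" using le_total V by blast
      have "le x b" if "b \<in> insert x X" for b
        using that le_total[OF V(1) V(1)] le_trans[OF V(1,2) _ xm m(2)] V(3) by blast
      then show ?thesis by blast
    qed
  qed
  from this[of "set vs"] cyc(2) WV obtain m where m: "m \<in> set vs" "\<And>b. b \<in> set vs \<Longrightarrow> le m b" by force
  then obtain i where i: "i < ?l" "m = vs ! i" by (metis in_set_conv_nth)
  define ia where "ia = (if Suc i = ?l then 0 else Suc i)"
  define ib where "ib = (if i = 0 then ?l - 1 else i - 1)"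
  have ia: "ia < ?l" "i \<noteq> ia" and ib: "ib < ?l" "i \<noteq> ib" and ab: "ia \<noteq> ib"
    using i(1) cyc(2) by (auto simp: ia_def ib_def)
  have E: "{m, vs ! ia} \<in> E" "{m, vs ! ib} \<in> E" "{vs ! ia, vs ! ib} \<notin> E"
    using induced_cycle_adjacent[OF cyc(1) i(1) ia] induced_cycle_adjacent[OF cyc(1) i(1) ib]
      induced_cycle_adjacent[OF cyc(1) ia(1) ib(1) ab] i cyc(2)
    by (auto simp: ia_def ib_def split: if_splits)
  have ne: "vs ! ia \<noteq> vs ! ib" using nth_eq_iff_index_eq[OF dist ia(1) ib(1)] ab by simp
  have in_W: "vs ! ia \<in> set vs" "vs ! ib \<in> set vs" using ia ib by simp_all
  have "le (vs ! ia) (vs ! ib) \<or> le (vs ! ib) (vs ! ia)" using le_total WV in_W by blast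
  then show False
  proof
    assume "le (vs ! ia) (vs ! ib)"
    with m(2)[OF in_W(1)] show False
      unfolding le_def by (rule x_condition_no_valley[OF r x E ne])
  next
    assume "le (vs ! ib) (vs ! ia)"
    moreover have "{vs ! ib, vs ! ia} \<notin> E" using E(3) by (simp add: insert_commute)
    ultimately show False
      using m(2)[OF in_W(2)] x_condition_no_valley[OF r x E(2,1) _ ne[symmetric]] unfolding le_def by simp
  qed
qed

text \<open>The variables are placed in the sequence \<open>x\<close>, \<open>y\<close> of the first vertex, \<open>x\<close>, \<open>y\<close> of the second vertex, and so on. The
order on finitely supported functions is lexicographic with the smallest index most significant, so a
monomial with an \<open>x\<close> at an earlier vertex is larger. Hence downward exchanges decrease monomials.\<close>
definition lex_code :: "(nat \<Rightarrow> nat) \<Rightarrow> (nat + nat \<Rightarrow>\<^sub>0 nat) \<Rightarrow> (nat \<Rightarrow>\<^sub>0 nat)" where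
  "lex_code \<rho> m = (\<Sum>i\<in>V. single (2 * \<rho> i) (lookup m (Inl i)) + single (2 * \<rho> i + 1) (lookup m (Inr i)))"

definition lex_order :: "(nat \<Rightarrow> nat) \<Rightarrow> (nat + nat \<Rightarrow>\<^sub>0 nat) rel" where
  "lex_order \<rho> = {(u, v). u \<in> monomials (xy_vars n) \<and> v \<in> monomials (xy_vars n) \<and> lex_code \<rho> u \<le> lex_code \<rho> v}"

lemma lex_code_add: "lex_code \<rho> (m + m') = lex_code \<rho> m + lex_code \<rho> m'"
  by (simp add: lex_code_def lookup_add single_add sum.distrib add_ac)

lemma lookup_lex_code:
  assumes "inj_on \<rho> V" "i \<in> V"
  shows "lookup (lex_code \<rho> m) (2 * \<rho> i) = lookup m (Inl i)"
    and "lookup (lex_code \<rho> m) (2 * \<rho> i + 1) = lookup m (Inr i)"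
proof -
  have parity: "2 * \<rho> i' + 1 \<noteq> 2 * \<rho> i" "2 * \<rho> i' \<noteq> 2 * \<rho> i + 1" for i' by presburger+
  have inj: "\<rho> i' = \<rho> i \<longleftrightarrow> i' = i" if "i' \<in> V" for i' using assms that by (auto dest: inj_onD)
  have "lookup (lex_code \<rho> m) (2 * \<rho> i) = (\<Sum>i'\<in>V. if i' = i then lookup m (Inl i') else 0)"
    unfolding lex_code_def lookup_sum
    by (intro sum.cong refl) (use inj parity in \<open>auto simp: lookup_add lookup_single when_def\<close>)
  then show "lookup (lex_code \<rho> m) (2 * \<rho> i) = lookup m (Inl i)" using assms(2) by (simp add: sum.delta)
  have "lookup (lex_code \<rho> m) (2 * \<rho> i + 1) = (\<Sum>i'\<in>V. if i' = i then lookup m (Inr i') else 0)"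
    unfolding lex_code_def lookup_sum
    by (intro sum.cong refl) (use inj parity in \<open>auto simp: lookup_add lookup_single when_def\<close>)
  then show "lookup (lex_code \<rho> m) (2 * \<rho> i + 1) = lookup m (Inr i)" using assms(2) by (simp add: sum.delta)
qed

lemma poly_mapping_nat_nonneg: "0 \<le> (p :: nat \<Rightarrow>\<^sub>0 nat)"
proof (rule ccontr)
  assume "\<not> 0 \<le> p"
  then have "p < 0" by simp
  then show False by (auto simp: less_poly_mapping.rep_eq less_fun_def)
qed

lemma monomials_xy_outside:
  assumes "m \<in> monomials (xy_vars n)" "i \<notin> V"
  shows "lookup m (Inl i) = 0" "lookup m (Inr i) = 0"
  using assms unfolding monomials_xy_iff
  unfolding monomials_iff lookup_xpart lookup_ypart by blast+

lemma monomial_order_lex: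
  assumes inj: "inj_on \<rho> V"
  shows "monomial_order (xy_vars n) (lex_order \<rho>)"
proof -
  have code_inj: "u = v" if "u \<in> monomials (xy_vars n)" "v \<in> monomials (xy_vars n)" "lex_code \<rho> u = lex_code \<rho> v" for u v
  proof (rule sum_mon_eqI)
    show "lookup u (Inl i) = lookup v (Inl i)" for i
    proof (cases "i \<in> V")
      case True then show ?thesis using lookup_lex_code(1)[OF inj True, of u] lookup_lex_code(1)[OF inj True, of v] that(3) by simp
    next
      case False then show ?thesis using monomials_xy_outside[OF that(1)] monomials_xy_outside[OF that(2)] by simp
    qed
    show "lookup u (Inr i) = lookup v (Inr i)" for i
    proof (cases "i \<in> V")
      case True then show ?thesis using lookup_lex_code(2)[OF inj True, of u] lookup_lex_code(2)[OF inj True, of v] that(3) by simp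
    next
      case False then show ?thesis using monomials_xy_outside[OF that(1)] monomials_xy_outside[OF that(2)] by simp
    qed
  qed
  have "refl_on (monomials (xy_vars n)) (lex_order \<rho>)" "trans (lex_order \<rho>)" "antisym (lex_order \<rho>)"
    "total_on (monomials (xy_vars n)) (lex_order \<rho>)" "lex_order \<rho> \<subseteq> monomials (xy_vars n) \<times> monomials (xy_vars n)"
    by (auto simp: refl_on_def trans_def antisym_def total_on_def lex_order_def code_inj)
  then have "linear_order_on (monomials (xy_vars n)) (lex_order \<rho>)"
    by (simp add: linear_order_on_def partial_order_on_def preorder_on_def)
  moreover have "(0, u) \<in> lex_order \<rho>" if "u \<in> monomials (xy_vars n)" for u
  proof -
    have "lex_code \<rho> 0 = 0" by (simp add: lex_code_def)
    then show ?thesis using that poly_mapping_nat_nonneg by (simp add: lex_order_def)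
  qed
  moreover have "(u + w, v + w) \<in> lex_order \<rho>" if "(u, v) \<in> lex_order \<rho>" "w \<in> monomials (xy_vars n)" for u v w
    using that by (auto simp: lex_order_def lex_code_add intro: add_right_mono)
  ultimately show ?thesis unfolding monomial_order_def by blast
qed

lemma down_lex_order:
  assumes inj: "inj_on \<rho> V" and d: "(m, m') \<in> down \<rho>" and mV: "m \<in> monomials (xy_vars n)"
  shows "(m', m) \<in> lex_order \<rho>" "m' \<noteq> m"
proof -
  obtain t i j where m: "m = t + xm i + ym j" "m' = t + xm j + ym i" and ij: "\<rho> i < \<rho> j" "m \<approx> m'"
    using d by (auto simp: down_def)
  have V: "i \<in> V" "j \<in> V" and m'V: "m' \<in> monomials (xy_vars n)"
    using mV equivalent_monomials[OF ij(2)] m(1) by (simp_all del: atLeastAtMost_iff)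
  have x: "lex_code \<rho> (xm k) = single (2 * \<rho> k) 1" "lex_code \<rho> (ym k) = single (2 * \<rho> k + 1) 1" if "k \<in> V" for k
  proof -
    have "lex_code \<rho> (xm k) = (\<Sum>i\<in>V. if i = k then single (2 * \<rho> k) 1 else 0)"
      unfolding lex_code_def by (intro sum.cong refl) (auto simp: lookup_single)
    then show "lex_code \<rho> (xm k) = single (2 * \<rho> k) 1" using that by (simp add: sum.delta)
    have "lex_code \<rho> (ym k) = (\<Sum>i\<in>V. if i = k then single (2 * \<rho> k + 1) 1 else 0)"
      unfolding lex_code_def by (intro sum.cong refl) (auto simp: lookup_single)
    then show "lex_code \<rho> (ym k) = single (2 * \<rho> k + 1) 1" using that by (simp add: sum.delta)
  qed
  have "single (2 * \<rho> j) 1 + single (2 * \<rho> i + 1) 1 < (single (2 * \<rho> i) 1 + single (2 * \<rho> j + 1) 1 :: nat \<Rightarrow>\<^sub>0 nat)"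
    unfolding less_poly_mapping.rep_eq less_fun_def
    by (rule exI[of _ "2 * \<rho> i"]) (use ij(1) in \<open>auto simp: lookup_add lookup_single when_def\<close>)
  then have "lex_code \<rho> (xm j + ym i) < lex_code \<rho> (xm i + ym j)"
    using x V by (simp add: lex_code_add)
  then have less: "lex_code \<rho> m' < lex_code \<rho> m"
    by (simp add: m lex_code_add add.assoc)
  then show "(m', m) \<in> lex_order \<rho>" "m' \<noteq> m" using mV m'V by (auto simp: lex_order_def)
qed

text \<open>If the initial monomial of an element of \<open>J\<close> were not bad, all other terms of its class would be larger,
since they reach it by downward exchanges. So it is bad and has a bad divisor with a single \<open>x\<close>, which is
itself an initial monomial, namely of the binomial of a downward exchange. A minimal generator
therefore equals such a divisor.\<close>
theorem chordal_x_condition: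
  assumes "chordal n E"
  obtains r where "monomial_order (xy_vars n) r" "x_condition n r (J :: (nat + nat, 'k::field) mpoly set)"
proof -
  obtain \<rho> where \<rho>: "elimination_order E V \<rho>" by (rule chordal_elimination_order[OF simple assms])
  have inj: "inj_on \<rho> V" using \<rho> by (simp add: elimination_order_def)
  let ?r = "lex_order \<rho>"
  have r: "monomial_order (xy_vars n) ?r" by (rule monomial_order_lex[OF inj])
  let ?I = "initial_ideal (xy_vars n) ?r (J :: (nat + nat, 'k) mpoly set)"
  have reach: "(m, m') \<in> ?r" if "(m', m) \<in> (down \<rho>)\<^sup>*" "m' \<in> monomials (xy_vars n)" for m m'
    using that
  proof (induction rule: converse_rtrancl_induct)
    case base
    then show ?case by (rule mo_refl[OF r])
  next
    case (step y z)
    have "z \<in> monomials (xy_vars n)" using equivalent_monomials[OF down_equivalent[OF step(1)]] step(4) by simp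
    from step(3)[OF this] down_lex_order(1)[OF inj step(1,4)] show ?case by (rule mo_trans[OF r])
  qed
  have "x_condition n ?r (J :: (nat + nat, 'k) mpoly set)"
    unfolding x_condition_def
  proof
    fix u assume "u \<in> minimal_monomial_generators (xy_vars n) ?I"
    then have uV: "u \<in> monomials (xy_vars n)" and uI: "single u 1 \<in> ?I"
      and min: "\<And>v w. u = v + w \<Longrightarrow> single v 1 \<in> ?I \<Longrightarrow> v = u"
      unfolding minimal_monomial_generators_def by blast+
    have "\<exists>p\<in>J :: (nat + nat, 'k) mpoly set. p \<noteq> 0 \<and> (\<exists>t. u = t + initial_monomial ?r p)"
      using initial_ideal_monomial_iff[OF r _ uV, of J] uI by blast
    then obtain p :: "(nat + nat, 'k) mpoly" and t where p: "p \<in> J" "p \<noteq> 0" "u = t + initial_monomial ?r p"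
      by blast
    define g where "g = initial_monomial ?r p"
    have g: "g \<in> keys p" "\<And>m'. m' \<in> keys p \<Longrightarrow> (m', g) \<in> ?r"
      using initial_monomial_max[OF r _ p(2)] p(1) unfolding g_def by blast+
    have ug: "u = t + g" using p(3) g_def by simp
    have gV: "g \<in> monomials (xy_vars n)" using uV ug by simp
    have bad: "bad \<rho> g"
    proof (rule ccontr)
      assume nb: "\<not> bad \<rho> g"
      obtain m' where m': "m' \<in> keys p" "m' \<noteq> g" "g \<approx> m'"
        using binomial_ideal_other_term[of p g] p(1) g(1) by blast
      have "(m', g) \<in> (down \<rho>)\<^sup>*"
        by (rule down_reaches_nonbad[OF equivalent_sym[OF m'(3)] nb inj gV])
      moreover have "m' \<in> monomials (xy_vars n)" using equivalent_monomials[OF m'(3)] gV by simp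
      ultimately have "(g, m') \<in> ?r" by (rule reach)
      from mo_antisym[OF r this g(2)[OF m'(1)]] m'(2) show False by simp
    qed
    obtain i where i: "0 < lookup g (Inl i)" "bad \<rho> (xm i + join 0 (ypart g))"
      by (rule bad_linear_divisor[OF \<rho> bad gV])
    let ?b = "xm i + join 0 (ypart g)"
    have gb: "g = ?b + join (xpart g - single i 1) 0"
      using i(1) by (intro sum_mon_eqI) (auto simp: lookup_add lookup_minus lookup_single when_def)
    have bV: "?b \<in> monomials (xy_vars n)" using gV gb by (metis monomials_add_iff)
    obtain b' where b': "(?b, b') \<in> down \<rho>" by (rule bad_down[OF i(2)])
    have "single ?b 1 \<in> ?I"
      using binomial_initial[OF r down_equivalent[OF b'] _ bV down_lex_order(1)[OF inj b' bV]]
        down_lex_order(2)[OF inj b' bV] by metis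
    moreover have "u = ?b + (join (xpart g - single i 1) 0 + t)"
      using ug gb by (metis add.assoc add.commute)
    ultimately have "u = ?b" using min by metis
    moreover have "xm i \<in> monomials (Inl ` V)" "join 0 (ypart g) \<in> monomials (Inr ` V)"
    proof -
      have "i \<in> V" using bV by (simp del: atLeastAtMost_iff)
      then show "xm i \<in> monomials (Inl ` V)" by (simp add: monomials_def del: atLeastAtMost_iff)
      have y: "ypart g \<in> monomials V" using gV by (simp add: monomials_xy_iff)
      show "join 0 (ypart g) \<in> monomials (Inr ` V)"
        unfolding monomials_iff
      proof (intro allI impI)
        fix k assume "lookup (join 0 (ypart g)) k \<noteq> 0"
        then show "k \<in> Inr ` V" using y by (cases k) (auto simp: monomials_iff simp del: atLeastAtMost_iff)
      qed
    qed
    ultimately show "\<exists>v w. u = v + w \<and> v \<in> monomials (Inl ` V) \<and> mon_deg v \<le> 1 \<and> w \<in> monomials (Inr ` V)"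
      by (intro exI[of _ "xm i"] exI[of _ "join 0 (ypart g)"]) simp
  qed
  with r show ?thesis by (rule that)
qed

end

section \<open>The first symmetric power\<close>

text \<open>A resolution of the source, with its augmentation followed by the isomorphism, resolves the target.\<close>
lemma has_linear_resolution_iso:
  assumes lin: "has_linear_resolution V A" and hom: "graded_hom (mpoly_ring UNIV V) A B \<psi>"
    and surj: "\<psi> ` carrier A = carrier B"
    and zero: "\<And>x. x \<in> carrier A \<Longrightarrow> \<psi> x = \<zero>\<^bsub>B\<^esub> \<longleftrightarrow> x = \<zero>\<^bsub>A\<^esub>"
  shows "has_linear_resolution V B"
proof -
  from lin obtain b a \<phi> \<epsilon> d where
    res: "graded_free_resolution V A b a \<phi> \<epsilon>" and
    min: "\<forall>i. \<forall>f\<in>carrier (free_module V {..<b (Suc i)} (a (Suc i))). \<forall>j<b i. Poly_Mapping.lookup (\<phi> i f j) 0 = 0"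
    and a: "\<forall>i. \<forall>j<b i. a i j = d + int i"
    unfolding has_linear_resolution_def minimal_graded_free_resolution_def by blast
  let ?S = "mpoly_ring UNIV V" and ?F = "\<lambda>i. free_module V {..<b i} (a i)"
  have \<epsilon>: "graded_hom ?S (?F 0) A \<epsilon>" "\<epsilon> ` carrier (?F 0) = carrier A"
    and ker: "a_kernel (?F 0) A \<epsilon> = \<phi> 0 ` carrier (?F 1)"
    and rest: "\<forall>i. graded_hom ?S (?F (Suc i)) (?F i) (\<phi> i)"
      "\<forall>i. a_kernel (?F (Suc i)) (?F i) (\<phi> i) = \<phi> (Suc i) ` carrier (?F (Suc (Suc i)))"
    using res by (simp_all add: graded_free_resolution_def Let_def)
  let ?e = "\<lambda>f. \<psi> (\<epsilon> f)"
  have carr: "\<epsilon> f \<in> carrier A" if "f \<in> carrier (?F 0)" for f using \<epsilon>(2) that by blast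
  have "graded_hom ?S (?F 0) B ?e"
    unfolding graded_hom_def
  proof (intro conjI allI ballI)
    show "?e \<in> hom (add_monoid (?F 0)) (add_monoid B)"
      using \<epsilon>(1) hom carr by (auto simp: graded_hom_def hom_def Pi_def)
    show "?e (s \<odot>\<^bsub>?F 0\<^esub> f) = s \<odot>\<^bsub>B\<^esub> ?e f" if "s \<in> carrier ?S" "f \<in> carrier (?F 0)" for s f
      using \<epsilon>(1) hom carr[OF that(2)] that by (simp add: graded_hom_def)
    show "?e ` component (?F 0) k \<subseteq> component B k" for k
      using graded_hom_component[OF hom graded_hom_component[OF \<epsilon>(1)]] by blast
  qed
  moreover have "?e ` carrier (?F 0) = carrier B"
    using surj \<epsilon>(2) by (metis image_image)
  moreover have "a_kernel (?F 0) B ?e = \<phi> 0 ` carrier (?F 1)"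
    unfolding ker[symmetric] a_kernel_def kernel_def using zero carr by auto
  ultimately have "graded_free_resolution V B b a \<phi> ?e"
    unfolding graded_free_resolution_def Let_def using rest by blast
  then have "minimal_graded_free_resolution V B b a \<phi> ?e"
    unfolding minimal_graded_free_resolution_def using min by blast
  then show ?thesis unfolding has_linear_resolution_def using a by blast
qed

context edge_graph
begin

abbreviation A where "A \<equiv> sym_algebra S M"
abbreviation sc where "sc \<equiv> sym_class S M"

lemma algebra_add: "p \<in> carrier cover \<Longrightarrow> q \<in> carrier cover \<Longrightarrow> sc p \<oplus>\<^bsub>A\<^esub> sc q = sc (p + q)"
  using abelian_subgroup.a_rcos_sum[OF abelian_subgroupI3[OF ideal.axioms(1)[OF ideal_relids]
      ring.is_abelian_group[OF cring.axioms(1)[OF cring_cover]]], of p q]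
  by (simp add: sym_algebra_def FactRing_def sym_class_def cover_ops)

lemma algebra_mult: "p \<in> carrier cover \<Longrightarrow> q \<in> carrier cover \<Longrightarrow> sc p \<otimes>\<^bsub>A\<^esub> sc q = sc (p * q)"
  using ideal.rcoset_mult_add[OF ideal_relids, of p q]
  by (simp add: sym_algebra_def FactRing_def sym_class_def cover_ops)

definition cover_hom :: "nat \<Rightarrow> ((nat \<Rightarrow> (nat, 'k::field) mpoly) set, (nat, 'k) mpoly) mpoly set" where
  "cover_hom j = {p \<in> carrier cover. homogeneous (int j) p}"

lemma sym_power_simps:
  "carrier (sym_power V M j) = sc ` cover_hom j" "\<zero>\<^bsub>sym_power V M j\<^esub> = \<zero>\<^bsub>A\<^esub>"
  "X \<oplus>\<^bsub>sym_power V M j\<^esub> Y = X \<oplus>\<^bsub>A\<^esub> Y" "s \<odot>\<^bsub>sym_power V M j\<^esub> X = sc (mp_const s) \<otimes>\<^bsub>A\<^esub> X"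
  by (simp_all add: sym_power_def Let_def cover_hom_def)

lemma component_sym_power:
  "component (sym_power V M j) k = generate (add_monoid A)
        {sc (Poly_Mapping.single u s) |u s \<delta>.
           s \<in> PV V \<and> u \<in> monomials (carrier M) \<and> mon_deg u = j \<and>
           (\<forall>x\<in>Poly_Mapping.keys u. x \<in> component M (\<delta> x)) \<and>
           homogeneous (k - (\<Sum>x\<in>Poly_Mapping.keys u. int (Poly_Mapping.lookup u x) * \<delta> x)) s}"
  by (simp add: sym_power_def Let_def coeff_carrier)

text \<open>The polynomials that are homogeneous of degree \<open>j\<close> in \<open>y\<close>.\<close>
definition yhom :: "nat \<Rightarrow> (nat + nat, 'k::field) mpoly set" where
  "yhom j = {q \<in> PV (xy_vars n). \<forall>m\<in>keys q. mon_deg (ypart m) = j}"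

lemma yhom_zero: "0 \<in> yhom j" by (simp add: yhom_def)
lemma yhom_add: "p \<in> yhom j \<Longrightarrow> q \<in> yhom j \<Longrightarrow> p + q \<in> yhom j"
  using keys_add[of p q] by (auto simp: yhom_def)
lemma yhom_mult: "p \<in> yhom j \<Longrightarrow> q \<in> yhom k \<Longrightarrow> p * q \<in> yhom (j + k)"
  using keys_mult[of p q] by (fastforce simp: yhom_def ypart_add)
lemma yhom_power: "p \<in> yhom j \<Longrightarrow> p ^ k \<in> yhom (k * j)"
proof (induction k)
  case 0 then show ?case by (simp add: yhom_def)
next
  case (Suc k) then show ?case using yhom_mult[of p j "p ^ k" "k * j"] by simp
qed
lemma yhom_sum: "(\<And>i. i \<in> I \<Longrightarrow> f i \<in> yhom j) \<Longrightarrow> (\<Sum>i\<in>I. f i) \<in> yhom j"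
  by (induction I rule: infinite_finite_induct) (auto simp: yhom_zero yhom_add)
lemma yhom_prod: "finite I \<Longrightarrow> (\<And>i. i \<in> I \<Longrightarrow> f i \<in> yhom (d i)) \<Longrightarrow> (\<Prod>i\<in>I. f i) \<in> yhom (\<Sum>i\<in>I. d i)"
proof (induction I rule: finite_induct)
  case empty then show ?case by (simp add: yhom_def)
next
  case (insert i I) then show ?case using yhom_mult[of "f i" "d i" "prod f I" "sum d I"] by simp
qed
lemma yhom_emb: "s \<in> PV V \<Longrightarrow> w \<in> monomials V \<Longrightarrow> emb w s \<in> yhom (mon_deg w)"
  using emb_PV[of s n w] by (auto simp: yhom_def in_keys_iff lookup_emb split: if_splits)

lemma \<Theta>_yhom: "p \<in> cover_hom j \<Longrightarrow> \<Theta> p \<in> yhom j"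
proof -
  assume p: "p \<in> cover_hom j"
  show ?thesis
    unfolding \<Theta>_def mpoly_eval_def
  proof (rule yhom_sum)
    fix m assume m: "m \<in> keys p"
    have s: "lookup p m \<in> PV V" and mM: "keys m \<subseteq> carrier M" and deg: "mon_deg m = j"
      using p m by (auto simp: cover_hom_def cover_carrier monomials_def homogeneous_def)
    have "vecpoly (rep X) \<in> yhom 1" if "X \<in> carrier M" for X
      unfolding vecpoly_def
    proof (rule yhom_sum)
      fix i assume "i \<in> V"
      then show "emb (single i 1) (rep X i) \<in> yhom 1"
        using yhom_emb[of "rep X i" "single i 1"] vecs_PV[OF rep(1)[OF that]] by (simp add: monomials_def)
    qed
    then have "(\<Prod>X\<in>keys m. vecpoly (rep X) ^ lookup m X) \<in> yhom (\<Sum>X\<in>keys m. lookup m X * 1)"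
      using mM by (intro yhom_prod yhom_power) auto
    moreover have "emb 0 (lookup p m) \<in> yhom 0" using yhom_emb[OF s, of 0] by simp
    ultimately show "emb 0 (lookup p m) * (\<Prod>X\<in>keys m. vecpoly (rep X) ^ lookup m X) \<in> yhom j"
      using yhom_mult[of _ 0 _ j] deg by (simp add: mon_deg_def)
  qed
qed

text \<open>The vector of coefficients of \<open>y\<^sub>i\<close>; on linear forms in \<open>y\<close> it is inverse to \<open>vecpoly\<close>.\<close>
definition ylinear :: "(nat + nat, 'k::field) mpoly \<Rightarrow> nat \<Rightarrow> (nat, 'k) mpoly" where
  "ylinear q = (\<lambda>i. if i \<in> V then ycoeff (single i 1) q else 0)"

lemma ylinear_zero: "ylinear 0 = (\<lambda>i. 0)"
  by (rule ext) (auto simp: ylinear_def)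
lemma ylinear_add: "ylinear (p + q) = (\<lambda>i. ylinear p i + ylinear q i)"
  by (auto simp: ylinear_def ycoeff_add)
lemma ylinear_diff: "ylinear (p - q) = (\<lambda>i. ylinear p i - ylinear q i)"
  by (auto simp: ylinear_def ycoeff_diff)
lemma ylinear_mult: "ylinear (emb 0 s * q) = (\<lambda>i. s * ylinear q i)"
  by (auto simp: ylinear_def ycoeff_mult)
lemma ylinear_vecs: "q \<in> PV (xy_vars n) \<Longrightarrow> ylinear q \<in> vecs V V"
  by (simp add: vecs_def ylinear_def ycoeff_PV)
lemma single_1_eq_iff: "single i (1::nat) = single l 1 \<longleftrightarrow> i = l"
  by (metis lookup_single_eq lookup_single_not_eq zero_neq_one)
lemma ylinear_vecpoly: "f \<in> vecs V V \<Longrightarrow> ylinear (vecpoly f) = f"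
proof
  fix l assume f: "f \<in> vecs V V"
  have "ycoeff (single l 1) (vecpoly f) = (\<Sum>i\<in>V. if i = l then f i else 0)"
    unfolding vecpoly_def
    by (subst additive_sum[of "ycoeff (single l 1)"]) (auto simp: ycoeff_add ycoeff_emb single_1_eq_iff intro!: sum.cong)
  then show "ylinear (vecpoly f) l = f l" using f by (simp add: ylinear_def sum.delta vecs_def)
qed

lemma vecpoly_ylinear:
  assumes q: "q \<in> yhom 1"
  shows "vecpoly (ylinear q) = q"
proof (rule poly_mapping_eqI)
  fix m
  have "lookup (vecpoly (ylinear q)) m = (\<Sum>i\<in>V. if ypart m = single i 1 then lookup q m else 0)"
    unfolding vecpoly_def lookup_sum
  proof (rule sum.cong[OF HOL.refl])
    fix i assume "i \<in> V"
    moreover have "join (xpart m) (single i 1) = m" if "ypart m = single i 1"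
      using that by (simp add: join_eq_iff)
    ultimately show "lookup (emb (single i 1) (ylinear q i)) m = (if ypart m = single i 1 then lookup q m else 0)"
      by (simp add: lookup_emb ylinear_def)
  qed
  also have "\<dots> = lookup q m"
  proof (cases "m \<in> keys q")
    case False
    then have "lookup q m = 0" by (simp add: in_keys_iff)
    then show ?thesis by (intro trans[OF sum.neutral]) auto
  next
    case True
    then have "mon_deg (ypart m) = 1" "m \<in> monomials (xy_vars n)" using q by (auto simp: yhom_def PV_def)
    then have y: "mon_deg (ypart m) = Suc 0" "ypart m \<in> monomials V"
      by (simp_all add: monomials_xy_iff One_nat_def)
    obtain i where i: "ypart m = single i 1" using mon_deg_eq_1[OF y(1)] by blast
    then have "i \<in> V" using y(2) by (simp add: monomials_def del: atLeastAtMost_iff)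
    note i = i this
    then show ?thesis by (simp add: single_1_eq_iff sum.delta)
  qed
  finally show "lookup (vecpoly (ylinear q)) m = lookup q m" .
qed

text \<open>An exchange in a monomial of \<open>y\<close>-degree one is a multiple of a relation \<open>x\<^sub>i y\<^sub>j - x\<^sub>j y\<^sub>i\<close>, and in all other
monomials it has no part of \<open>y\<close>-degree one.\<close>
lemma ylinear_binomial_ideal:
  assumes "q \<in> binomial_ideal" and qV: "q \<in> PV (xy_vars n)"
  shows "ylinear q \<in> edge_relations n E"
  using assms(1)
proof (induction q rule: binomial_ideal_induct)
  case zero
  show ?case unfolding ylinear_zero by (rule zero_in_edge_relations)
next
  case (add q r)
  then show ?case unfolding ylinear_add by (rule is_submodule_add[OF is_submodule_edge_relations])
next
  case (binomial m m' a)
  have "m \<in> monomials (xy_vars n)" using qV binomial(1) by (auto simp: PV_def)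
  with binomial(2) show ?case
  proof (induction rule: equivalent.induct)
    case (refl m)
    show ?case unfolding diff_self ylinear_zero by (rule zero_in_edge_relations)
  next
    case (step m t i j)
    have t: "xpart t \<in> monomials V"
      using equivalent_monomials[OF step(1)] step(4) by (simp add: monomials_xy_iff xpart_add)
    have V: "i \<in> V" "j \<in> V" using edgeD[OF step(2)] by auto
    let ?d = "single (t + xm i + ym j) a - single (t + xm j + ym i) a"
    have y: "ypart t + single j 1 = single l 1 \<longleftrightarrow> ypart t = 0 \<and> j = l" for j l
    proof
      assume eq: "ypart t + single j 1 = single l 1"
      then have "mon_deg (ypart t + single j 1) = mon_deg (single l (1::nat))" by simp
      then have "ypart t = 0" by simp
      with eq show "ypart t = 0 \<and> j = l" by (simp add: single_1_eq_iff)
    qed simp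
    have "ylinear ?d = (\<lambda>l. (if ypart t = 0 then single (xpart t) a else 0) * relation i j l)"
    proof
      fix l
      show "ylinear ?d l = (if ypart t = 0 then single (xpart t) a else 0) * relation i j l"
        using V by (auto simp: ylinear_def ycoeff_diff ycoeff_single ypart_add xpart_add y basis_vec_def
            mp_var_def mult_single right_diff_distrib)
    qed
    also have "\<dots> \<in> edge_relations n E"
      by (rule is_submodule_smult[OF is_submodule_edge_relations _ relation_in_edge_relations[OF step(2)]])
        (use t in \<open>auto intro: PV_single\<close>)
    finally have "ylinear ?d \<in> edge_relations n E" .
    from is_submodule_add[OF is_submodule_edge_relations step(3)[OF step(4)] this]
    show ?case by (simp add: ylinear_diff)
  qed
qed

text \<open>The part of degree one of an element of the symmetric algebra, as an element of the edge module.\<close>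
definition deg1_class :: "((nat \<Rightarrow> (nat, 'k::field) mpoly) set, (nat, 'k) mpoly) mpoly \<Rightarrow> (nat \<Rightarrow> (nat, 'k) mpoly) set" where
  "deg1_class p = cls (ylinear (\<Theta> p))"

lemma deg1_class_cong:
  assumes "p \<in> carrier cover" "q \<in> carrier cover" "p - q \<in> relids"
  shows "deg1_class p = deg1_class q"
  using ylinear_binomial_ideal[OF \<Theta>_relids[OF assms(3)] \<Theta>_PV[OF cover_closed(3)[OF assms(1,2)]]]
  by (simp add: deg1_class_def cls_eq_iff \<Theta>_simps ylinear_diff)

definition sym1_map :: "((nat \<Rightarrow> (nat, 'k::field) mpoly) set, (nat, 'k) mpoly) mpoly set \<Rightarrow> (nat \<Rightarrow> (nat, 'k) mpoly) set" where
  "sym1_map X = deg1_class (SOME p. p \<in> carrier cover \<and> X = sc p)"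

lemma sym1_map_class: "p \<in> carrier cover \<Longrightarrow> sym1_map (sc p) = deg1_class p"
proof -
  assume p: "p \<in> carrier cover"
  let ?q = "SOME q. q \<in> carrier cover \<and> sc p = sc q"
  have "?q \<in> carrier cover \<and> sc p = sc ?q" by (rule someI[of _ p]) (simp add: p)
  then have "?q \<in> carrier cover" "p - ?q \<in> relids" using sym_class_eq_iff[OF p] by auto
  from deg1_class_cong[OF p this] show ?thesis by (simp add: sym1_map_def)
qed

lemma deg1_class_carrier: "p \<in> carrier cover \<Longrightarrow> deg1_class p \<in> carrier M"
  unfolding deg1_class_def carrier_edge_module by (intro imageI ylinear_vecs \<Theta>_PV)

lemma deg1_class_add: "deg1_class (p + q) = deg1_class p \<oplus>\<^bsub>M\<^esub> deg1_class q"
  by (simp add: deg1_class_def \<Theta>_simps ylinear_add add_edge_module)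

lemma deg1_class_smult: "s \<in> PV V \<Longrightarrow> deg1_class (mp_const s * p) = s \<odot>\<^bsub>M\<^esub> deg1_class p"
  by (simp add: deg1_class_def \<Theta>_simps ylinear_mult smult_edge_module)

lemma deg1_class_var: "X \<in> carrier M \<Longrightarrow> deg1_class (mp_var X) = X"
  by (simp add: deg1_class_def \<Theta>_simps ylinear_vecpoly rep)

lemma component_cover_closed:
  "f \<in> component (edge_cover n) k \<Longrightarrow> g \<in> component (edge_cover n) k \<Longrightarrow> (\<lambda>i. f i + g i) \<in> component (edge_cover n) k"
  "f \<in> component (edge_cover n) k \<Longrightarrow> (\<lambda>i. - f i) \<in> component (edge_cover n) k"
  "(\<lambda>i. 0) \<in> component (edge_cover n) k"
  "s \<in> PV V \<Longrightarrow> homogeneous l s \<Longrightarrow> f \<in> component (edge_cover n) k \<Longrightarrow> (\<lambda>i. s * f i) \<in> component (edge_cover n) (l + k)"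
proof -
  show "s \<in> PV V \<Longrightarrow> homogeneous l s \<Longrightarrow> f \<in> component (edge_cover n) k \<Longrightarrow> (\<lambda>i. s * f i) \<in> component (edge_cover n) (l + k)"
    using homogeneous_mult[of l s "k - 1" "f _"] 
    by (auto simp: edge_cover_def component_free_module vecs_smult add_diff_eq)
qed (auto simp: edge_cover_def component_free_module vecs_add vecs_uminus)

text \<open>The graded pieces of a symmetric power are generated as groups by homogeneous products, so the degree
has to be followed through sums and inverses.\<close>
lemma sym1_component:
  assumes "X \<in> component (sym_power V M 1) k"
  shows "sym1_map X \<in> component M k"
proof -
  let ?G = "{sc (Poly_Mapping.single u s) |u s \<delta>.
           s \<in> PV V \<and> u \<in> monomials (carrier M) \<and> mon_deg u = 1 \<and>
           (\<forall>x\<in>Poly_Mapping.keys u. x \<in> component M (\<delta> x)) \<and>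
           homogeneous (k - (\<Sum>x\<in>Poly_Mapping.keys u. int (Poly_Mapping.lookup u x) * \<delta> x)) s}"
  have gen: "\<exists>p\<in>carrier cover. X = sc p \<and> (\<exists>f\<in>component (edge_cover n) k. deg1_class p = cls f)" if "X \<in> ?G" for X
  proof -
    from that obtain u s \<delta> where X: "X = sc (Poly_Mapping.single u s)" and s: "s \<in> PV V"
      and u: "u \<in> monomials (carrier M)" "mon_deg u = 1" "\<forall>x\<in>keys u. x \<in> component M (\<delta> x)"
      and hom: "homogeneous (k - (\<Sum>x\<in>keys u. int (lookup u x) * \<delta> x)) s"
      by blast
    obtain x where x: "u = single x 1" using mon_deg_eq_1[of u] u(2) by (auto simp: One_nat_def)
    then have xM: "x \<in> carrier M" and xc: "x \<in> component M (\<delta> x)" and hom': "homogeneous (k - \<delta> x) s"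
      using u hom by (auto simp: monomials_def)
    from xc obtain f where f: "x = cls f" "f \<in> component (edge_cover n) (\<delta> x)" by (auto simp: component_edge_module)
    have eq: "Poly_Mapping.single u s = mp_const s * mp_var x" by (simp add: x mp_const_def mp_var_def mult_single)
    have "deg1_class (Poly_Mapping.single u s) = cls (\<lambda>i. s * f i)"
      by (simp add: eq deg1_class_smult[OF s] deg1_class_var[OF xM]) (simp add: f(1) smult_edge_module[OF s])
    moreover have "(\<lambda>i. s * f i) \<in> component (edge_cover n) k"
      using component_cover_closed(4)[OF s hom' f(2)] by simp
    moreover have "Poly_Mapping.single u s \<in> carrier cover"
      unfolding eq by (intro cover_closed cover_const cover_var s xM)
    ultimately show ?thesis using X by blast
  qed
  have "X \<in> generate (add_monoid A) ?G" using assms unfolding component_sym_power .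
  then have "\<exists>p\<in>carrier cover. X = sc p \<and> (\<exists>f\<in>component (edge_cover n) k. deg1_class p = cls f)"
  proof (induction rule: generate.induct)
    case one
    have "\<one>\<^bsub>add_monoid A\<^esub> = sc 0" using sym_class_0 by simp
    moreover have "deg1_class 0 = cls (\<lambda>i. 0)"
      by (simp add: deg1_class_def \<Theta>_simps ylinear_zero)
    ultimately show ?case using component_cover_closed(3) cover_closed(4) by blast
  next
    case (incl X) then show ?case by (rule gen)
  next
    case (inv X)
    from gen[OF inv] obtain p f where p: "p \<in> carrier cover" "X = sc p" "f \<in> component (edge_cover n) k" "deg1_class p = cls f"
      by blast
    have np: "- p \<in> carrier cover" using cover_closed(3)[OF cover_closed(4) p(1)] by simp
    interpret Q: ring A unfolding sym_algebra_def by (rule ideal.quotient_is_ring[OF ideal_relids])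
    have carr: "sc q \<in> carrier A" if "q \<in> carrier cover" for q
      using that by (auto simp: sym_algebra_def FactRing_def A_RCOSETS_def' sym_class_def)
    have "\<ominus>\<^bsub>A\<^esub> sc p = sc (- p)"
      by (rule Q.minus_equality) (simp_all add: carr p np algebra_add sym_class_0)
    then have "inv\<^bsub>add_monoid A\<^esub> X = sc (- p)" by (simp add: p a_inv_def)
    moreover have "deg1_class (- p) = cls (\<lambda>i. - f i)"
    proof -
      have "deg1_class (- p) = deg1_class (mp_const (- 1) * p)" by (simp add: mp_const_uminus)
      also have "\<dots> = cls (\<lambda>i. - f i)"
        by (subst deg1_class_smult) (simp_all add: p(4) smult_edge_module del: mult_minus1)
      finally show ?thesis .
    qed
    ultimately show ?case using component_cover_closed(2)[OF p(3)] np by blast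
  next
    case (eng X Y)
    then obtain p f q g where "p \<in> carrier cover" "X = sc p" "f \<in> component (edge_cover n) k" "deg1_class p = cls f"
      "q \<in> carrier cover" "Y = sc q" "g \<in> component (edge_cover n) k" "deg1_class q = cls g" by blast
    moreover from this have "X \<otimes>\<^bsub>add_monoid A\<^esub> Y = sc (p + q)" by (simp add: algebra_add)
    moreover from calculation have "deg1_class (p + q) = cls (\<lambda>i. f i + g i)"
      by (simp add: deg1_class_add add_edge_module)
    ultimately show ?case using component_cover_closed(1) cover_closed(1) by blast
  qed
  then show ?thesis using sym1_map_class by (auto simp: component_edge_module)
qed

text \<open>The elements of degree one of the symmetric algebra form a copy of the edge module: a linear form in \<open>y\<close>
lies in the binomial ideal if and only if its coefficient vector is a relation.\<close>
theorem sym_power_1_linear: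
  assumes "has_linear_resolution V (sym_power V (M :: ((nat, 'k::field) mpoly, (nat \<Rightarrow> (nat, 'k) mpoly) set) graded_module) 1)"
  shows "has_linear_resolution V (M :: ((nat, 'k) mpoly, (nat \<Rightarrow> (nat, 'k) mpoly) set) graded_module)"
proof (rule has_linear_resolution_iso[OF assms])
  let ?M = "M :: ((nat, 'k) mpoly, (nat \<Rightarrow> (nat, 'k) mpoly) set) graded_module"
  have carr: "p \<in> carrier cover" if "p \<in> cover_hom j" for p j using that by (simp add: cover_hom_def)
  have var: "mp_var X \<in> cover_hom 1" if "X \<in> carrier ?M" for X
    using cover_var[OF that] by (simp add: cover_hom_def)
  show "graded_hom S (sym_power V ?M 1) ?M sym1_map"
    unfolding graded_hom_def
  proof (intro conjI ballI allI)
    show "sym1_map \<in> hom (add_monoid (sym_power V ?M 1)) (add_monoid ?M)"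
      by (auto simp: hom_def sym_power_simps sym1_map_class carr deg1_class_carrier algebra_add cover_closed deg1_class_add)
    show "sym1_map (s \<odot>\<^bsub>sym_power V ?M 1\<^esub> X) = s \<odot>\<^bsub>?M\<^esub> sym1_map X"
      if "s \<in> carrier S" "X \<in> carrier (sym_power V ?M 1)" for s X
      using that by (auto simp: sym_power_simps coeff_carrier sym1_map_class carr algebra_mult cover_const cover_closed deg1_class_smult)
    show "sym1_map ` component (sym_power V ?M 1) k \<subseteq> component ?M k" for k
      using sym1_component by blast
  qed
  show "sym1_map ` carrier (sym_power V ?M 1) = carrier ?M"
  proof
    show "sym1_map ` carrier (sym_power V ?M 1) \<subseteq> carrier ?M"
      by (auto simp: sym_power_simps sym1_map_class carr deg1_class_carrier)
    show "carrier ?M \<subseteq> sym1_map ` carrier (sym_power V ?M 1)"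
    proof
      fix X assume X: "X \<in> carrier ?M"
      then have "X = sym1_map (sc (mp_var X))" by (simp add: sym1_map_class cover_var deg1_class_var)
      then show "X \<in> sym1_map ` carrier (sym_power V ?M 1)"
        unfolding sym_power_simps using var[OF X] by blast
    qed
  qed
  fix X assume "X \<in> carrier (sym_power V ?M 1)"
  then obtain p where p: "p \<in> cover_hom 1" "X = sc p" by (auto simp: sym_power_simps)
  have "sym1_map X = \<zero>\<^bsub>?M\<^esub> \<longleftrightarrow> ylinear (\<Theta> p) \<in> edge_relations n E"
    by (simp add: p sym1_map_class carr[OF p(1)] deg1_class_def zero_edge_module cls_eq_zero_iff)
  also have "\<dots> \<longleftrightarrow> \<Theta> p \<in> binomial_ideal"
    using vecpoly_edge_relations[of "ylinear (\<Theta> p)"] vecpoly_ylinear[OF \<Theta>_yhom[OF p(1)]]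
      ylinear_binomial_ideal[OF _ \<Theta>_PV[OF carr[OF p(1)]]] by auto
  also have "\<dots> \<longleftrightarrow> X = \<zero>\<^bsub>A\<^esub>"
    using relids_iff[OF carr[OF p(1)]] sym_class_zero_iff[OF carr[OF p(1)]] p(2) by simp
  finally show "sym1_map X = \<zero>\<^bsub>?M\<^esub> \<longleftrightarrow> X = \<zero>\<^bsub>sym_power V ?M 1\<^esub>" by (simp add: sym_power_simps)
qed

end

section \<open>Symmetric powers for chordal graphs\<close>

lemma finite_monomials_degree: "finite V \<Longrightarrow> finite {w \<in> monomials V. mon_deg w = d}"
proof (induction d)
  case 0
  have "{w \<in> monomials V. mon_deg w = 0} \<subseteq> {0}" by auto
  then show ?case by (rule finite_subset) simp
next
  case (Suc d)
  have "{w \<in> monomials V. mon_deg w = Suc d} \<subseteq> (\<Union>i\<in>V. (\<lambda>w. w + single i 1) ` {w \<in> monomials V. mon_deg w = d})"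
  proof
    fix w assume w: "w \<in> {w \<in> monomials V. mon_deg w = Suc d}"
    then have "w \<noteq> 0" by auto
    then obtain v where "lookup w v \<noteq> 0" by (metis lookup_zero poly_mapping_eqI)
    then obtain t where t: "w = t + single v 1" using mon_split_single[of w v] by auto
    have "t \<in> monomials V" "single v 1 \<in> monomials V" "mon_deg t = d" using w t by simp_all
    moreover have "v \<in> V" using \<open>single v 1 \<in> monomials V\<close> by (simp add: monomials_def)
    ultimately show "w \<in> (\<Union>i\<in>V. (\<lambda>w. w + single i 1) ` {w \<in> monomials V. mon_deg w = d})"
      using t by blast
  qed
  then show ?case by (rule finite_subset) (use Suc in auto)
qed

context edge_graph
begin

lemma lift_emb_1:
  assumes "w \<in> monomials V"
  shows "\<exists>u. lift (emb w 1 :: (nat + nat, 'k::field) mpoly) = Poly_Mapping.single u 1 \<and>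
    keys u \<subseteq> (\<lambda>i. cls (basis_vec i)) ` V \<and> mon_deg u = mon_deg w"
  using assms
proof (induction "mon_deg w" arbitrary: w)
  case 0
  then have "w = 0" by simp
  then show ?case by (intro exI[of _ 0]) (simp add: emb_one lift_simps)
next
  case (Suc d)
  then have "w \<noteq> 0" by auto
  then obtain i where "lookup w i \<noteq> 0" by (metis lookup_zero poly_mapping_eqI)
  then obtain t where t: "w = t + single i 1" using mon_split_single[of w i] by auto
  have tV: "t \<in> monomials V" "single i 1 \<in> monomials V" "d = mon_deg t" using Suc t by simp_all
  have i: "i \<in> V" using tV(2) by (simp add: monomials_def del: atLeastAtMost_iff)
  from Suc(1)[OF tV(3,1)] obtain u where u: "lift (emb t 1 :: (nat + nat, 'k) mpoly) = Poly_Mapping.single u 1"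
    "keys u \<subseteq> (\<lambda>i. cls (basis_vec i)) ` V" "mon_deg u = mon_deg t" by blast
  have "emb w 1 = emb t 1 * (mp_var (Inr i) :: (nat + nat, 'k) mpoly)"
    unfolding emb_single_1[symmetric] by (simp add: emb_mult t)
  then have "lift (emb w 1 :: (nat + nat, 'k) mpoly) = Poly_Mapping.single u 1 * mp_var (cls (basis_vec i))"
    by (simp add: lift_simps u(1))
  also have "\<dots> = Poly_Mapping.single (u + single (cls (basis_vec i)) 1) 1"
    by (simp add: mp_var_def mult_single)
  finally have "lift (emb w 1 :: (nat + nat, 'k) mpoly) = Poly_Mapping.single (u + single (cls (basis_vec i)) 1) 1" .
  moreover have "keys (u + single (cls (basis_vec i)) (1::nat)) \<subseteq> (\<lambda>i. cls (basis_vec i)) ` V"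
    using u(2) i unfolding keys_add_nat by auto
  moreover have "mon_deg (u + single (cls (basis_vec i)) 1) = mon_deg w" using u(3) t by simp
  ultimately show ?case by blast
qed

lemma lift_emb:
  assumes "w \<in> monomials V"
  obtains u where "\<And>s :: (nat, 'k::field) mpoly. lift (emb w s) = Poly_Mapping.single u s"
    "keys u \<subseteq> (\<lambda>i. cls (basis_vec i)) ` V" "mon_deg u = mon_deg w"
proof -
  obtain u where u: "lift (emb w 1 :: (nat + nat, 'k) mpoly) = Poly_Mapping.single u 1"
    "keys u \<subseteq> (\<lambda>i. cls (basis_vec i)) ` V" "mon_deg u = mon_deg w"
    using lift_emb_1[OF assms] by blast
  have "lift (emb w s) = Poly_Mapping.single u s" for s :: "(nat, 'k) mpoly"
    by (subst emb_eq_mult) (simp add: lift_simps lift_emb_0 u(1) mp_const_def mult_single)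
  then show ?thesis using that u by blast
qed

lemma basis_component:
  assumes "i \<in> V"
  shows "cls (basis_vec i :: nat \<Rightarrow> (nat, 'k::field) mpoly) \<in> component M 1"
proof -
  have "homogeneous 0 (basis_vec i l :: (nat, 'k) mpoly)" for l by (simp add: basis_vec_def)
  with vecs_basis_vec[OF assms] have "(basis_vec i :: nat \<Rightarrow> (nat, 'k) mpoly) \<in> component (edge_cover n) 1"
    by (simp add: edge_cover_def component_free_module)
  then show ?thesis unfolding component_edge_module by (rule imageI)
qed

text \<open>The factors \<open>f\<^sub>i\<close> have degree one, so a product of \<open>j\<close> of them with a form of degree \<open>k - j\<close> has degree \<open>k\<close>.\<close>
lemma component_generator:
  assumes w: "w \<in> monomials V" and s: "s \<in> PV V" "homogeneous (k - int (mon_deg w)) s"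
  shows "sc (lift (emb w s)) \<in> component (sym_power V M (mon_deg w)) k"
proof -
  obtain u where u: "lift (emb w s) = Poly_Mapping.single u s"
    "keys u \<subseteq> (\<lambda>i. cls (basis_vec i)) ` V" "mon_deg u = mon_deg w"
    by (rule lift_emb[OF w]) blast
  have "(\<Sum>x\<in>keys u. int (lookup u x) * 1) = int (mon_deg w)"
    unfolding u(3)[symmetric] by (simp add: mon_deg_def)
  then have "homogeneous (k - (\<Sum>x\<in>keys u. int (lookup u x) * 1)) s" using s(2) by simp
  moreover have "u \<in> monomials (carrier M)"
    using u(2) cls_basis_carrier unfolding monomials_def by blast
  moreover have "\<forall>x\<in>keys u. x \<in> component M 1" using u(2) basis_component by blast
  ultimately show ?thesis
    unfolding component_sym_power u(1) using s(1) u(3)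
    by (intro generate.incl CollectI exI[of _ u] exI[of _ s] exI[of _ "\<lambda>_. 1"]) auto
qed

text \<open>Generate \<open>Sym\<^sub>j(M\<^sub>G)\<close> by the monomials \<open>y\<^sup>w\<close> of degree \<open>j\<close>, sorted by weight. A relation in which \<open>y\<^sup>w\<close> is the last
generator has at \<open>y\<^sup>w\<close> only terms \<open>u\<close> for which \<open>u y\<^sup>w\<close> is bad: for a monomial that is not bad, all other
monomials of its class have larger weight. Each such \<open>u\<close> is divisible by a variable \<open>x\<^sub>i\<close> with \<open>x\<^sub>i y\<^sup>w\<close> bad.
Conversely, for such \<open>x\<^sub>i\<close> an exchange \<open>x\<^sub>i y\<^sup>w \<approx> x\<^sub>b y\<^bsup>w'\<^esup>\<close> with \<open>w'\<close> of smaller weight is the required linear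
relation. So all colon ideals are generated by variables.\<close>
theorem sym_power_linear:
  assumes "chordal n E"
  shows "has_linear_resolution V (sym_power V (M :: ((nat, 'k::field) mpoly, _) graded_module) j)"
proof -
  obtain \<rho> where \<rho>: "elimination_order E V \<rho>" by (rule chordal_elimination_order[OF simple assms])
  have inj: "inj_on \<rho> V" using \<rho> by (simp add: elimination_order_def)
  define Y where "Y = {w \<in> monomials V. mon_deg w = j}"
  have "finite Y" unfolding Y_def by (rule finite_monomials_degree) simp
  then obtain ws0 where ws0: "set ws0 = Y" "distinct ws0" using finite_distinct_list by blast
  \<comment> \<open>Monomials of equal weight may come in any order, since only strict inequalities of weights are used.\<close>
  define ws where "ws = sort_key (yweight \<rho>) ws0"
  define r where "r = length ws"
  define w where "w k = ws ! k" for k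
  have dist: "distinct ws" and setws: "set ws = Y" using ws0 by (simp_all add: ws_def)
  have wY: "w k \<in> Y" if "k < r" for k using that setws nth_mem unfolding w_def r_def by blast
  have w: "w k \<in> monomials V" "mon_deg (w k) = j" if "k < r" for k using wY[OF that] by (simp_all add: Y_def)
  have w_eq: "w k = w l \<longleftrightarrow> k = l" if "k < r" "l < r" for k l
    using that dist by (simp add: w_def r_def nth_eq_iff_index_eq)
  have wE: "\<exists>l<r. w l = v" if "v \<in> Y" for v
    using that setws unfolding w_def r_def by (metis in_set_conv_nth)
  have mono: "yweight \<rho> (w k) \<le> yweight \<rho> (w l)" if "k \<le> l" "l < r" for k l
    using sorted_nth_mono[of "map (yweight \<rho>) ws" k l] that by (simp add: ws_def w_def r_def)
  have order: "k < l" if "yweight \<rho> (w k) < yweight \<rho> (w l)" "k < r" for k l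
    using mono[of l k] that by (metis linorder_not_less)
  define q where "q s = (\<Sum>k<r. emb (w k) (s k))" for s :: "nat \<Rightarrow> (nat, 'k) mpoly"
  have q_add: "q (\<lambda>i. s i + t i) = q s + q t" for s t by (simp add: q_def emb_add sum.distrib)
  have q_smult: "q (\<lambda>i. c * s i) = emb 0 c * q s" for c s by (simp add: q_def emb_mult sum_distrib_left)
  have q_zero: "q (\<lambda>i. 0) = 0" by (simp add: q_def)
  have lookup_q: "lookup (q s) m = (\<Sum>k<r. if ypart m = w k then lookup (s k) (xpart m) else 0)" for s m
    by (simp add: q_def lookup_sum lookup_emb)
  have lookup_q': "lookup (q s) m = lookup (s k) (xpart m)" if "ypart m = w k" "k < r" for s m k
  proof -
    have "lookup (q s) m = (\<Sum>l<r. if l = k then lookup (s l) (xpart m) else 0)"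
      unfolding lookup_q using that w_eq by (intro sum.cong refl) auto
    then show ?thesis using that by (simp add: sum.delta)
  qed
  have lookup_q0: "\<exists>l<r. ypart m = w l \<and> lookup (s l) (xpart m) \<noteq> 0" if "lookup (q s) m \<noteq> 0" for s m
  proof (rule ccontr)
    assume "\<not> ?thesis"
    then have "lookup (q s) m = 0" unfolding lookup_q by (intro sum.neutral) auto
    with that show False by simp
  qed
  have q_PV: "q s \<in> PV (xy_vars n)" if "s \<in> vecs V {..<r}" for s
    unfolding q_def by (intro PV_sum emb_PV) (use vecs_PV[OF that] w in auto)
  \<comment> \<open>The relations between the generators \<open>y\<^sup>w\<close> of the symmetric power.\<close>
  define K where "K = {s \<in> vecs V {..<r}. q s \<in> binomial_ideal}"
  define As where "As k = filter (\<lambda>i. bad \<rho> (xm i + join 0 (w k))) [1..<Suc n]" for k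
  have As: "i \<in> set (As k) \<longleftrightarrow> i \<in> V \<and> bad \<rho> (xm i + join 0 (w k))" for i k
    by (auto simp: As_def)
  have "variable_colons V r As K"
    unfolding variable_colons_def
  proof (intro conjI allI impI)
    show "K \<subseteq> vecs V {..<r}" by (auto simp: K_def)
    show "is_submodule V K"
      by (simp add: is_submodule_def K_def q_zero q_add q_smult vecs_add vecs_smult
          binomial_ideal_zero binomial_ideal_add binomial_ideal_mult)
    fix k assume k: "k < r"
    show "distinct (As k)" by (simp add: As_def)
    show "set (As k) \<subseteq> V" using As by blast
    show "\<forall>h\<in>K. (\<forall>l>k. h l = 0) \<longrightarrow> h k \<in> var_ideal (set (As k))"
    proof (intro ballI impI)
      fix h assume h: "h \<in> K" and h0: "\<forall>l>k. h l = 0"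
      show "h k \<in> var_ideal (set (As k))"
        unfolding var_ideal_def
      proof (intro CollectI ballI)
        fix u assume u: "u \<in> keys (h k)"
        let ?m = "join u (w k)"
        have hV: "h \<in> vecs V {..<r}" and hb: "q h \<in> binomial_ideal" using h by (auto simp: K_def)
        have uV: "u \<in> monomials V" using u vecs_PV[OF hV, of k] by (auto simp: PV_def)
        have mV: "?m \<in> monomials (xy_vars n)" using uV w[OF k] by (simp add: monomials_xy_iff)
        have mk: "?m \<in> keys (q h)" using u lookup_q'[of ?m k h] k by (simp add: in_keys_iff)
        have "bad \<rho> ?m"
        proof (rule ccontr)
          assume nb: "\<not> bad \<rho> ?m"
          obtain m' where m': "m' \<in> keys (q h)" "m' \<noteq> ?m" "?m \<approx> m'"
            by (rule binomial_ideal_other_term[OF hb mk])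
          have less: "yweight \<rho> (ypart ?m) < yweight \<rho> (ypart m')"
            by (rule nonbad_min_yweight[OF equivalent_sym[OF m'(3)] nb inj mV m'(2)])
          obtain l where l: "l < r" "ypart m' = w l" "lookup (h l) (xpart m') \<noteq> 0"
            using lookup_q0[of h m'] m'(1) by (auto simp: in_keys_iff)
          have "k < l" using order[of k l] less l k by simp
          with h0 l(3) show False by simp
        qed
        from bad_linear_divisor[OF \<rho> this mV] obtain i where i: "0 < lookup ?m (Inl i)" "bad \<rho> (xm i + join 0 (ypart ?m))"
          by blast
        have "i \<in> keys u" using i(1) by (simp add: in_keys_iff)
        then have "i \<in> V" using uV unfolding monomials_def by blast
        then show "\<exists>a\<in>set (As k). 0 < lookup u a" using i As by (intro bexI[of _ i]) auto
      qed
    qed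
    show "\<forall>a\<in>set (As k). \<exists>h\<in>K. h k = mp_var a \<and> (\<forall>l>k. h l = 0) \<and> (\<forall>l. homogeneous 1 (h l))"
    proof
      fix a assume "a \<in> set (As k)"
      then have aV: "a \<in> V" and "bad \<rho> (xm a + join 0 (w k))" using As by auto
      let ?m = "xm a + join 0 (w k)"
      obtain i b where ib: "\<rho> i < \<rho> b" "0 < lookup ?m (Inl i)" "0 < lookup ?m (Inr b)"
        "(i, b) \<in> (edges_in E (support ?m))\<^sup>*"
        using \<open>bad \<rho> ?m\<close> unfolding bad_def by blast
      have ia: "i = a" using ib(2) by (simp add: lookup_add lookup_single when_def split: if_splits)
      have "0 < lookup (w k) b" using ib(3) by (simp add: lookup_add lookup_single)
      from mon_split_single[OF this] obtain t where t: "w k = t + single b 1" by blast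
      have tb: "t \<in> monomials V" "single b 1 \<in> monomials V" using w(1)[OF k] t by simp_all
      have bV: "b \<in> V" using tb(2) by (simp add: monomials_def del: atLeastAtMost_iff)
      have m: "?m = join 0 t + xm a + ym b"
        unfolding t by (rule sum_mon_eqI) (simp_all add: lookup_add lookup_single)
      let ?m' = "join 0 t + xm b + ym a"
      have eq: "?m \<approx> ?m'" unfolding m by (rule equivalent_swap) (use ib(4) ia m in simp)
      let ?w' = "t + single a 1"
      have "single a 1 \<in> monomials V" using aV by (simp add: monomials_def del: atLeastAtMost_iff)
      then have "?w' \<in> Y" using tb(1) w(2)[OF k] t by (simp add: Y_def)
      then obtain l where l: "l < r" "w l = ?w'" using wE by blast
      have "yweight \<rho> (w l) < yweight \<rho> (w k)" using ib(1) ia by (simp add: l(2) t yweight_add)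
      then have lk: "l < k" using order l(1) by blast
      define h :: "nat \<Rightarrow> (nat, 'k) mpoly" where
        "h = (\<lambda>i. if i = k then mp_var a else if i = l then - mp_var b else 0)"
      have hV: "h \<in> vecs V {..<r}" using aV bV k l(1) by (auto simp: vecs_def h_def simp del: atLeastAtMost_iff)
      have "q h = (\<Sum>i\<in>{k, l}. emb (w i) (h i))"
        unfolding q_def by (rule sum.mono_neutral_right) (use k l in \<open>auto simp: h_def\<close>)
      also have "\<dots> = emb (w k) (mp_var a) - emb (w l) (mp_var b)"
        using lk emb_diff[of "w l" 0 "mp_var b :: (nat, 'k) mpoly"] by (simp add: h_def)
      also have "\<dots> = single ?m 1 - single ?m' 1"
      proof -
        have "join (single a 1) (w k) = ?m" "join (single b 1) (w l) = ?m'"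
          by (simp_all add: join_eq_iff xpart_add ypart_add l(2))
        then show ?thesis by (simp add: mp_var_def emb_single)
      qed
      finally have "q h \<in> binomial_ideal" using binomial_in_binomial_ideal[OF eq] by simp
      then have "h \<in> K" using hV by (simp add: K_def)
      moreover have "h k = mp_var a" "\<forall>l>k. h l = 0" "\<forall>l. homogeneous 1 (h l)"
        using lk by (auto simp: h_def)
      ultimately show "\<exists>h\<in>K. h k = mp_var a \<and> (\<forall>l>k. h l = 0) \<and> (\<forall>l. homogeneous 1 (h l))" by blast
    qed
  qed
  let ?N = "sym_power V (M :: ((nat, 'k) mpoly, _) graded_module) j"
  let ?eps = "\<lambda>s. sc (lift (q s))"
  have carr: "lift (q s) \<in> carrier cover" if "s \<in> vecs V {..<r}" for s
    by (rule lift_carrier[OF q_PV[OF that]])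
  have hom_j: "homogeneous (int j) (lift (emb (w k) c))" if kr: "k < r" for k and c :: "(nat, 'k) mpoly"
  proof -
    obtain u where "lift (emb (w k) c) = Poly_Mapping.single u c" "mon_deg u = mon_deg (w k)"
      by (rule lift_emb[OF w(1)[OF kr]]) blast
    then show ?thesis using w(2)[OF kr] by (simp add: homogeneous_def)
  qed
  have lift_q: "lift (q s) = (\<Sum>k<r. lift (emb (w k) (s k)))" for s by (simp add: q_def lift_sum)
  have in_N: "lift (q s) \<in> cover_hom j" if "s \<in> vecs V {..<r}" for s
    unfolding cover_hom_def using carr[OF that] hom_j by (auto simp: lift_q intro!: homogeneous_sum)
  have "graded_hom (mpoly_ring UNIV V) (free_module V {..<r} (\<lambda>_. int j)) ?N ?eps"
    unfolding graded_hom_def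
  proof (intro conjI ballI allI)
    show "?eps \<in> hom (add_monoid (free_module V {..<r} (\<lambda>_. int j))) (add_monoid ?N)"
      using in_N carr
      by (auto simp: hom_def carrier_free_module free_module_ops sym_power_simps algebra_add q_add lift_simps)
    show "?eps (c \<odot>\<^bsub>free_module V {..<r} (\<lambda>_. int j)\<^esub> s) = c \<odot>\<^bsub>?N\<^esub> ?eps s"
      if "c \<in> carrier (mpoly_ring UNIV V)" "s \<in> carrier (free_module V {..<r} (\<lambda>_. int j))" for c s
      using that carr[of s]
      by (simp add: carrier_free_module free_module_ops carrier_mpoly_ring sym_power_simps algebra_mult
          cover_const q_smult lift_simps lift_emb_0)
    show "?eps ` component (free_module V {..<r} (\<lambda>_. int j)) k \<subseteq> component ?N k" for k
    proof clarify
      fix s :: "nat \<Rightarrow> (nat, 'k) mpoly" assume "s \<in> component (free_module V {..<r} (\<lambda>_. int j)) k"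
      then have s: "s \<in> vecs V {..<r}" "\<And>i. i < r \<Longrightarrow> homogeneous (k - int j) (s i)"
        by (auto simp: component_free_module)
      have "sc (\<Sum>i<m. lift (emb (w i) (s i))) \<in> component ?N k \<and> (\<Sum>i<m. lift (emb (w i) (s i))) \<in> carrier cover"
        if "m \<le> r" for m
        using that
      proof (induction m)
        case 0
        have "\<one>\<^bsub>add_monoid A\<^esub> \<in> component ?N k" unfolding component_sym_power by (rule generate.one)
        then show ?case by (simp add: cover_closed sym_class_0)
      next
        case (Suc m)
        then have m: "m < r" by simp
        have g: "sc (lift (emb (w m) (s m))) \<in> component ?N k"
          using component_generator[OF w(1)[OF m] vecs_PV[OF s(1)], of k m] s(2)[OF m] w(2)[OF m] by simp
        have gc: "lift (emb (w m) (s m)) \<in> carrier cover"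
          by (intro lift_carrier emb_PV vecs_PV[OF s(1)] w m)
        have IH: "sc (\<Sum>i<m. lift (emb (w i) (s i))) \<in> component ?N k" "(\<Sum>i<m. lift (emb (w i) (s i))) \<in> carrier cover"
          using Suc by auto
        have "sc (\<Sum>i<m. lift (emb (w i) (s i))) \<otimes>\<^bsub>add_monoid A\<^esub> sc (lift (emb (w m) (s m))) \<in> component ?N k"
          using IH(1) g unfolding component_sym_power by (rule generate.eng)
        then show ?case using algebra_add[OF IH(2) gc] cover_closed(1)[OF IH(2) gc] by simp
      qed
      from this[of r] show "?eps s \<in> component ?N k" by (simp add: lift_q)
    qed
  qed
  moreover have "?eps ` vecs V {..<r} = carrier ?N"
  proof
    show "?eps ` vecs V {..<r} \<subseteq> carrier ?N" using in_N by (auto simp: sym_power_simps)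
    show "carrier ?N \<subseteq> ?eps ` vecs V {..<r}"
    proof
      fix X assume "X \<in> carrier ?N"
      then obtain p where p: "p \<in> cover_hom j" "X = sc p" by (auto simp: sym_power_simps)
      have pc: "p \<in> carrier cover" using p(1) by (simp add: cover_hom_def)
      have y: "\<Theta> p \<in> yhom j" by (rule \<Theta>_yhom[OF p(1)])
      define s where "s = (\<lambda>k. if k < r then ycoeff (w k) (\<Theta> p) else 0)"
      have sV: "s \<in> vecs V {..<r}" using ycoeff_PV[OF \<Theta>_PV[OF pc]] by (simp add: vecs_def s_def)
      have "q s = \<Theta> p"
      proof (rule poly_mapping_eqI)
        fix m
        show "lookup (q s) m = lookup (\<Theta> p) m"
        proof (cases "ypart m \<in> Y")
          case True
          then obtain k where k: "k < r" "ypart m = w k" using wE by metis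
          have "join (xpart m) (w k) = m" using k(2) by (simp add: join_eq_iff)
          then show ?thesis using lookup_q'[OF k(2,1), of s] k(1) by (simp add: s_def)
        next
          case False
          have "lookup (q s) m = 0" using lookup_q0[of s m] wY False by metis
          moreover have "m \<notin> keys (\<Theta> p)" using y False by (auto simp: yhom_def Y_def PV_def monomials_xy_iff)
          ultimately show ?thesis by (simp add: in_keys_iff)
        qed
      qed
      then have "?eps s = sc p"
        using sym_class_eq_iff[OF carr[OF sV] pc] lift_\<Theta>[OF pc] by simp
      then show "X \<in> ?eps ` vecs V {..<r}" using p(2) sV by blast
    qed
  qed
  moreover have "{s \<in> vecs V {..<r}. ?eps s = \<zero>\<^bsub>?N\<^esub>} = K"
    unfolding K_def sym_power_simps
    using sym_class_zero_iff[OF carr] lift_relids_iff[OF q_PV] by auto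
  ultimately show ?thesis
    by (rule variable_colons_linear_resolution[OF \<open>variable_colons V r As K\<close>])
qed

end

section \<open>The four conditions\<close>

context edge_graph
begin

lemma x_condition_iff_chordal:
  "(\<exists>r. monomial_order (xy_vars n) r \<and> x_condition n r (defining_ideal n E :: (nat + nat, 'k::field) mpoly set))
    \<longleftrightarrow> chordal n E"
  unfolding defining_ideal_eq by (metis x_condition_chordal chordal_x_condition)

lemma linear_resolution_iff_chordal:
  "has_linear_resolution V (edge_module n E :: ((nat, 'k::field) mpoly, (nat \<Rightarrow> (nat, 'k) mpoly) set) graded_module)
    \<longleftrightarrow> chordal n E"
  by (metis sym_power_linear sym_power_1_linear linear_resolution_chordal)

lemma sym_powers_linear_iff_chordal:
  "(\<forall>j. has_linear_resolution V
      (sym_power V (edge_module n E :: ((nat, 'k::field) mpoly, (nat \<Rightarrow> (nat, 'k) mpoly) set) graded_module) j))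
    \<longleftrightarrow> chordal n E"
  by (metis sym_power_linear sym_power_1_linear linear_resolution_chordal)

end

theorem theorem3p1:
  fixes n :: nat and E :: "nat set set"
    and J :: "(nat + nat, 'k::field) mpoly set"
    and M :: "((nat, 'k) mpoly, (nat \<Rightarrow> (nat, 'k) mpoly) set) graded_module"
  assumes "simple_graph n E"
    and "M = edge_module n E"
    and "J = defining_ideal n E"
  shows "((\<exists>r. monomial_order (xy_vars n) r \<and> x_condition n r J) \<longleftrightarrow>
            (\<forall>j. has_linear_resolution {1..n} (sym_power {1..n} M j))) \<and>
         ((\<forall>j. has_linear_resolution {1..n} (sym_power {1..n} M j)) \<longleftrightarrow>
            has_linear_resolution {1..n} M) \<and>
         (has_linear_resolution {1..n} M \<longleftrightarrow> chordal n E)"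
proof -
  note graph = edge_graph.intro[OF assms(1)]
  show ?thesis
    unfolding assms(2,3) edge_graph.x_condition_iff_chordal[OF graph]
      edge_graph.sym_powers_linear_iff_chordal[OF graph] edge_graph.linear_resolution_iff_chordal[OF graph]
    by blast
qed

end
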